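(* Let $\lambda>0$ and $g\in\mathcal{M}_\lambda$. For each $\varepsilon>0$ the problem $$\begin{cases}-\operatorname{div}\mathbf{a}(x,\nabla V(x))+\lambda\,\overline{b}(x,V(x))+\varepsilon|V(x)|^{p(x)-2}V(x)=g(x), & x\in\Omega\\ \mathbf{a}(x,\nabla V)\cdot\nu=0, & x\in\partial\Omega\end{cases}$$ admits a unique weak solution $V_\varepsilon\in W^{1,p(x)}(\Omega)$, and $V_\varepsilon\in\mathcal{U}$.
   Context: Setting. $\Omega\subset\mathbb{R}^N$, $N\ge 2$, is an open, bounded, connected Lipschitz domain. $p:\overline{\Omega}\to(1,\infty)$ is either log-Hölder continuous with $p^-:=\min_{\overline\Omega}p\ge\frac{2N}{N+2}$, or continuous with $p^->\frac{2N}{N+2}$; put $p^+:=\max_{\overline\Omega}p$ and $p'(x)=\frac{p(x)}{p(x)-1}$. (In both cases $W^{1,p(x)}(\Omega)\hookrightarrow L^2(\Omega)$.) $L^{p(x)}(\Omega)$ is the space of measurable $u$ with $\int_\Omega|u|^{p(x)}dx<\infty$, with the Luxemburg norm $\inf\{\lambda>0:\int_\Omega|u/\lambda|^{p(x)}dx\le1\}$, and $W^{1,p(x)}(\Omega)$ is the corresponding Sobolev space of $u\in L^{p(x)}(\Omega)$ with $|\nabla u|\in L^{p(x)}(\Omega)$, with its usual norm. $\Psi:\overline{\Omega}\times(0,\infty)\to(0,\infty)$ satisfies: $\Psi(\cdot,s)$ is measurable for each $s>0$; for a.a. $x\in\Omega$, $\Psi(x,\cdot)$ is locally absolutely continuous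 on $(0,\infty)$, $\lim_{s\to0^+}\Psi(x,s)s=0$, and $s\mapsto\Psi(x,s)s$ is strictly increasing on $(0,\infty)$. Put $\mathbf{a}(x,\xi)=\Psi(x,|\xi|)\xi$ for $\xi\in\mathbb{R}^N\setminus\{\mathbf 0\}$, $\mathbf{a}(x,\mathbf 0)=\mathbf 0$; $\Phi(x,s)=\Psi(x,|s|)|s|$ for $s\ne0$, $\Phi(x,0)=0$; $A(x,\xi)=\int_0^{|\xi|}\Phi(x,s)\,ds$. It is assumed that $\Phi(\cdot,v(\cdot))\in L^{p'(x)}(\Omega)$ for every $v\in L^{p(x)}(\Omega)$, and that for any sequence $(V_n)\subset W^{1,p(x)}(\Omega)$ with $\int_\Omega|\nabla V_n|^{p(x)}dx\to\infty$ one has $\int_\Omega A(x,\nabla V_n)\,dx\to\infty$. $0<\delta_0<\infty$ is a constant and $b:\overline\Omega\times[0,\delta_0]\to[0,\infty)$ is a Carathéodory function (measurable in $x$ for every $s$, continuous in $s$ for a.a. $x$) such that $b(\cdot,0),b(\cdot,\delta_0)\in L^2(\Omega)$ and $s\mapsto b(x,s)$ is strictly increasing on $[0,\delta_0]$ for a.a. $x\in\Omega$. Its extension $\overline b:\overline\Omega\times\mathbb{R}\to\mathbb{R}$ is $\overline b(x,s)=b(x,0)+s$ for $s<0$, $\overline b(x,s)=b(x,s)$ for $s\in[0,\delta_0]$, $\overline b(x,s)=b(x,\delta_0)+s-\delta_0$ for $s>\delta_0$. Notation. $\mathcal{U}=\{U\in L^\infty(\Omega): 0\le U\le\delta_0\text{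 a.e. on }\Omega\}$. For $\lambda>0$, $\mathcal{M}_\lambda=\{g\in L^\infty(\Omega):\lambda b(x,0)\le g(x)\le\lambda b(x,\delta_0)\text{ for a.a. }x\in\Omega\}$. Definition. $V\in W^{1,p(x)}(\Omega)$ is a weak solution of the problem in the claim if for every $\phi\in W^{1,p(x)}(\Omega)$: $$\int_\Omega\mathbf{a}(x,\nabla V)\cdot\nabla\phi\,dx+\lambda\int_\Omega\overline b(x,V)\phi\,dx+\varepsilon\int_\Omega|V|^{p(x)-2}V\phi\,dx=\int_\Omega g\phi\,dx.$$ *)

theory Defs
  imports "HOL-Analysis.Analysis"
begin

section \<open>Lipschitz domains and exponents\<close>

text \<open>
  Near each boundary point, \<open>\<Omega>\<close> is the strict epigraph, in some direction \<open>e\<close>, of a Lipschitz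
  function \<open>\<gamma>\<close> on the hyperplane orthogonal to \<open>e\<close>. The orthogonal coordinates are
  \<open>x - (x \<bullet> e) *\<^sub>R e\<close> and \<open>x \<bullet> e\<close>.
\<close>

definition lipschitz_boundary :: "'a::euclidean_space set \<Rightarrow> bool" where
  "lipschitz_boundary \<Omega> \<longleftrightarrow>
     (\<forall>z\<in>frontier \<Omega>. \<exists>r>0. \<exists>e L. \<exists>\<gamma>::'a \<Rightarrow> real. norm e = 1 \<and> L-lipschitz_on {y. y \<bullet> e = 0} \<gamma> \<and>
        \<Omega> \<inter> ball z r = {x \<in> ball z r. \<gamma> (x - (x \<bullet> e) *\<^sub>R e) < x \<bullet> e})"

definition log_holder_on :: "'a::metric_space set \<Rightarrow> ('a \<Rightarrow> real) \<Rightarrow> bool" where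
  "log_holder_on S p \<longleftrightarrow>
     (\<exists>C>0. \<forall>x\<in>S. \<forall>y\<in>S. 0 < dist x y \<longrightarrow> dist x y \<le> 1/2 \<longrightarrow> \<bar>p x - p y\<bar> \<le> C / (- ln (dist x y)))"

text \<open>For nonempty bounded \<open>\<Omega>\<close> and continuous \<open>p\<close> this infimum is attained, i.e. is a minimum.\<close>

definition exponent_min :: "'a::euclidean_space set \<Rightarrow> ('a \<Rightarrow> real) \<Rightarrow> real" where
  "exponent_min \<Omega> p = (INF x\<in>closure \<Omega>. p x)"

definition conj_exponent :: "('a \<Rightarrow> real) \<Rightarrow> 'a \<Rightarrow> real" where
  "conj_exponent p x = p x / (p x - 1)"

definition admissible_exponent :: "'a::euclidean_space set \<Rightarrow> ('a \<Rightarrow> real) \<Rightarrow> bool" where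
  "admissible_exponent \<Omega> p \<longleftrightarrow>
     (\<forall>x\<in>closure \<Omega>. 1 < p x) \<and>
     (log_holder_on (closure \<Omega>) p \<and> exponent_min \<Omega> p \<ge> 2 * real DIM('a) / (real DIM('a) + 2) \<or>
      continuous_on (closure \<Omega>) p \<and> exponent_min \<Omega> p > 2 * real DIM('a) / (real DIM('a) + 2))"


section \<open>Lebesgue and Sobolev spaces with variable exponent\<close>

text \<open>
  The spaces consist of functions, not of classes: two functions denote the same element
  iff they agree almost everywhere on \<open>\<Omega>\<close>. Values outside \<open>\<Omega>\<close> are irrelevant.
\<close>

definition lebesgue_space :: "'a::euclidean_space set \<Rightarrow> ('a \<Rightarrow> real) \<Rightarrow> ('a \<Rightarrow> real) set" where
  "lebesgue_space \<Omega> p =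
     {u. u \<in> borel_measurable (lebesgue_on \<Omega>) \<and> integrable (lebesgue_on \<Omega>) (\<lambda>x. \<bar>u x\<bar> powr p x)}"

definition ess_bounded :: "'a::euclidean_space set \<Rightarrow> ('a \<Rightarrow> real) set" where
  "ess_bounded \<Omega> =
     {u. u \<in> borel_measurable (lebesgue_on \<Omega>) \<and> (\<exists>C. AE x in lebesgue_on \<Omega>. \<bar>u x\<bar> \<le> C)}"

text \<open>\<open>frechet_derivative f (at x) i\<close> is the partial derivative of \<open>f\<close> at \<open>x\<close> in the basis direction \<open>i\<close>.\<close>

primrec C_k :: "nat \<Rightarrow> ('a::euclidean_space \<Rightarrow> real) \<Rightarrow> bool" where
  "C_k 0 f = continuous_on UNIV f"
| "C_k (Suc k) f = ((\<forall>x. f differentiable (at x)) \<and>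
                    (\<forall>i\<in>Basis. C_k k (\<lambda>x. frechet_derivative f (at x) i)))"

definition test_functions :: "'a::euclidean_space set \<Rightarrow> ('a \<Rightarrow> real) set" where
  "test_functions \<Omega> =
     {\<phi>. (\<forall>k. C_k k \<phi>) \<and> compact (closure {x. \<phi> x \<noteq> 0}) \<and> closure {x. \<phi> x \<noteq> 0} \<subseteq> \<Omega>}"

definition locally_integrable ::
  "'a::euclidean_space set \<Rightarrow> ('a \<Rightarrow> 'b::{banach, second_countable_topology}) \<Rightarrow> bool" where
  "locally_integrable \<Omega> f \<longleftrightarrow> (\<forall>K. compact K \<and> K \<subseteq> \<Omega> \<longrightarrow> set_integrable lebesgue K f)"

definition has_weak_gradient ::
  "'a::euclidean_space set \<Rightarrow> ('a \<Rightarrow> real) \<Rightarrow> ('a \<Rightarrow> 'a) \<Rightarrow> bool" where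
  "has_weak_gradient \<Omega> u G \<longleftrightarrow>
     locally_integrable \<Omega> u \<and> locally_integrable \<Omega> G \<and>
     (\<forall>\<phi>\<in>test_functions \<Omega>. \<forall>i\<in>Basis.
        (LINT x|lebesgue_on \<Omega>. u x * frechet_derivative \<phi> (at x) i) =
        - (LINT x|lebesgue_on \<Omega>. (G x \<bullet> i) * \<phi> x))"

text \<open>
  \<open>sobolev_gradient \<Omega> p u G\<close> says that \<open>u \<in> W\<^bsup>1,p(x)\<^esup>(\<Omega>)\<close> and \<open>\<nabla>u = G\<close>. Since weak gradients are unique
  almost everywhere, quantifying over such \<open>G\<close> below is the same as speaking of \<open>\<nabla>u\<close>.
\<close>

definition sobolev_gradient ::
  "'a::euclidean_space set \<Rightarrow> ('a \<Rightarrow> real) \<Rightarrow> ('a \<Rightarrow> real) \<Rightarrow> ('a \<Rightarrow> 'a) \<Rightarrow> bool" where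
  "sobolev_gradient \<Omega> p u G \<longleftrightarrow>
     u \<in> lebesgue_space \<Omega> p \<and> has_weak_gradient \<Omega> u G \<and> (\<lambda>x. norm (G x)) \<in> lebesgue_space \<Omega> p"


section \<open>The differential operator\<close>

definition abs_continuous_on :: "real \<Rightarrow> real \<Rightarrow> (real \<Rightarrow> real) \<Rightarrow> bool" where
  "abs_continuous_on c d f \<longleftrightarrow>
     (\<forall>\<epsilon>>0. \<exists>\<delta>>0. \<forall>D. finite D \<and> (\<forall>(u, v)\<in>D. c \<le> u \<and> u < v \<and> v \<le> d) \<and>
        pairwise (\<lambda>I J. {fst I<..<snd I} \<inter> {fst J<..<snd J} = {}) D \<and>
        (\<Sum>(u, v)\<in>D. v - u) < \<delta> \<longrightarrow> (\<Sum>(u, v)\<in>D. \<bar>f v - f u\<bar>) < \<epsilon>)"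

definition op_a :: "('a::euclidean_space \<Rightarrow> real \<Rightarrow> real) \<Rightarrow> 'a \<Rightarrow> 'a \<Rightarrow> 'a" where
  "op_a \<Psi> x \<xi> = (if \<xi> = 0 then 0 else \<Psi> x (norm \<xi>) *\<^sub>R \<xi>)"

definition op_Phi :: "('a::euclidean_space \<Rightarrow> real \<Rightarrow> real) \<Rightarrow> 'a \<Rightarrow> real \<Rightarrow> real" where
  "op_Phi \<Psi> x s = (if s = 0 then 0 else \<Psi> x \<bar>s\<bar> * \<bar>s\<bar>)"

definition op_A :: "('a::euclidean_space \<Rightarrow> real \<Rightarrow> real) \<Rightarrow> 'a \<Rightarrow> 'a \<Rightarrow> real" where
  "op_A \<Psi> x \<xi> = (LBINT s:{0..norm \<xi>}. op_Phi \<Psi> x s)"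

definition admissible_Psi ::
  "'a::euclidean_space set \<Rightarrow> ('a \<Rightarrow> real) \<Rightarrow> ('a \<Rightarrow> real \<Rightarrow> real) \<Rightarrow> bool" where
  "admissible_Psi \<Omega> p \<Psi> \<longleftrightarrow>
     (\<forall>x\<in>closure \<Omega>. \<forall>s>0. 0 < \<Psi> x s) \<and>
     (\<forall>s>0. (\<lambda>x. \<Psi> x s) \<in> borel_measurable (lebesgue_on (closure \<Omega>))) \<and>
     (AE x in lebesgue_on \<Omega>.
        (\<forall>c d. 0 < c \<and> c \<le> d \<longrightarrow> abs_continuous_on c d (\<Psi> x)) \<and>
        ((\<lambda>s. \<Psi> x s * s) \<longlongrightarrow> 0) (at_right 0) \<and>
        strict_mono_on {0<..} (\<lambda>s. \<Psi> x s * s)) \<and>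
     (\<forall>v\<in>lebesgue_space \<Omega> p. (\<lambda>x. op_Phi \<Psi> x (v x)) \<in> lebesgue_space \<Omega> (conj_exponent p)) \<and>
     (\<forall>V G. (\<forall>n::nat. sobolev_gradient \<Omega> p (V n) (G n)) \<and>
        filterlim (\<lambda>n. LINT x|lebesgue_on \<Omega>. norm (G n x) powr p x) at_top sequentially \<longrightarrow>
        filterlim (\<lambda>n. LINT x|lebesgue_on \<Omega>. op_A \<Psi> x (G n x)) at_top sequentially)"


section \<open>The reaction term and weak solutions\<close>

definition admissible_b ::
  "'a::euclidean_space set \<Rightarrow> real \<Rightarrow> ('a \<Rightarrow> real \<Rightarrow> real) \<Rightarrow> bool" where
  "admissible_b \<Omega> \<delta>\<^sub>0 b \<longleftrightarrow>
     (\<forall>x\<in>closure \<Omega>. \<forall>s\<in>{0..\<delta>\<^sub>0}. 0 \<le> b x s) \<and>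
     (\<forall>s\<in>{0..\<delta>\<^sub>0}. (\<lambda>x. b x s) \<in> borel_measurable (lebesgue_on (closure \<Omega>))) \<and>
     (AE x in lebesgue_on \<Omega>. continuous_on {0..\<delta>\<^sub>0} (b x) \<and> strict_mono_on {0..\<delta>\<^sub>0} (b x)) \<and>
     (\<lambda>x. b x 0) \<in> lebesgue_space \<Omega> (\<lambda>_. 2) \<and>
     (\<lambda>x. b x \<delta>\<^sub>0) \<in> lebesgue_space \<Omega> (\<lambda>_. 2)"

definition b_ext :: "real \<Rightarrow> ('a \<Rightarrow> real \<Rightarrow> real) \<Rightarrow> 'a \<Rightarrow> real \<Rightarrow> real" where
  "b_ext \<delta>\<^sub>0 b x s =
     (if s < 0 then b x 0 + s else if s \<le> \<delta>\<^sub>0 then b x s else b x \<delta>\<^sub>0 + s - \<delta>\<^sub>0)"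

definition U_set :: "'a::euclidean_space set \<Rightarrow> real \<Rightarrow> ('a \<Rightarrow> real) set" where
  "U_set \<Omega> \<delta>\<^sub>0 = {U \<in> ess_bounded \<Omega>. AE x in lebesgue_on \<Omega>. 0 \<le> U x \<and> U x \<le> \<delta>\<^sub>0}"

definition M_set ::
  "'a::euclidean_space set \<Rightarrow> real \<Rightarrow> ('a \<Rightarrow> real \<Rightarrow> real) \<Rightarrow> real \<Rightarrow> ('a \<Rightarrow> real) set" where
  "M_set \<Omega> \<delta>\<^sub>0 b lam =
     {g \<in> ess_bounded \<Omega>. AE x in lebesgue_on \<Omega>. lam * b x 0 \<le> g x \<and> g x \<le> lam * b x \<delta>\<^sub>0}"

text \<open>
  The Neumann condition is encoded by testing with all of the Sobolev space. Under the standing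
  assumptions \<open>W\<^bsup>1,p(x)\<^esup>(\<Omega>)\<close> embeds into \<open>L\<^sup>2(\<Omega>)\<close>, so every integrand below is integrable.
  At points where \<open>V x = 0\<close> the factor \<open>\<bar>V x\<bar> powr (p x - 2) * V x\<close> is \<open>0\<close>, also if \<open>p x < 2\<close>.
\<close>

definition weak_solution ::
  "'a::euclidean_space set \<Rightarrow> ('a \<Rightarrow> real) \<Rightarrow> ('a \<Rightarrow> real \<Rightarrow> real) \<Rightarrow> real \<Rightarrow> ('a \<Rightarrow> real \<Rightarrow> real) \<Rightarrow>
   real \<Rightarrow> real \<Rightarrow> ('a \<Rightarrow> real) \<Rightarrow> ('a \<Rightarrow> real) \<Rightarrow> bool" where
  "weak_solution \<Omega> p \<Psi> \<delta>\<^sub>0 b lam \<epsilon> g V \<longleftrightarrow>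
     (\<exists>G. sobolev_gradient \<Omega> p V G \<and>
       (\<forall>\<phi> H. sobolev_gradient \<Omega> p \<phi> H \<longrightarrow>
          (LINT x|lebesgue_on \<Omega>. op_a \<Psi> x (G x) \<bullet> H x)
          + lam * (LINT x|lebesgue_on \<Omega>. b_ext \<delta>\<^sub>0 b x (V x) * \<phi> x)
          + \<epsilon> * (LINT x|lebesgue_on \<Omega>. \<bar>V x\<bar> powr (p x - 2) * V x * \<phi> x)
          = (LINT x|lebesgue_on \<Omega>. g x * \<phi> x)))"

end

theory Submission
  imports Defs
begin

text \<open>
  Existence is by the direct method, without weak compactness and without Sobolev embeddings. The energy
  \<open>J(V) = \<integral> A(x,\<nabla>V) + \<integral> F(x,V)\<close>, with \<open>\<partial>\<^sub>s F(x,s) = \<lambda> b(x,s) + \<epsilon> |s|\<^bsup>p(x)-2\<^esup> s - g(x)\<close>, is minimized over the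
  \<open>V\<close> with \<open>0 \<le> V \<le> \<delta>\<^sub>0\<close>. Among near-minimizers one selects a sequence that nearly minimizes, on the sublevel sets
  of \<open>J\<close>, the strictly convex functional \<open>\<integral> \<surd>(1 + |\<nabla>V|\<^sup>2) + \<integral> V\<^sup>2\<close>; its convexity gaps are summable so fast that
  \<open>V\<close> and \<open>\<nabla>V\<close> converge almost everywhere, and Fatou's lemma together with the uniform integrability coming from
  \<open>p \<ge> p\<^sup>- > 1\<close> gives a minimizer. Truncation at \<open>0\<close> and \<open>\<delta>\<^sub>0\<close> does not increase the energy because
  \<open>\<lambda> b(x,0) \<le> g \<le> \<lambda> b(x,\<delta>\<^sub>0)\<close>, hence the constrained minimizer satisfies the Euler-Lagrange equation.
  Uniqueness follows from monotonicity by testing with the truncated difference of two solutions.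
\<close>

section \<open>Smooth bump functions\<close>

text \<open>The map \<open>s \<mapsto> \<Psi> x s * s\<close> is strictly increasing without any
  modulus, so a small energy gap of two near-minimizers gives no rate for the distance of their
  gradients. The auxiliary functional is chosen because it has one: its midpoint gap bounds the
  squared distance of the gradients up to the cube of their size, a loss that geometrically small
  gaps absorb. The constraint \<open>0 \<le> V \<le> \<delta>\<^sub>0\<close> serves twice: the
  potentials of the reaction term get a common integrable majorant, and since truncation returns
  every variation to the constraint set without raising the energy, an equation results and not just
  a variational inequality. It holds first for bounded test functions. Unbounded ones are reached by
  truncating them, where the nonnegativity of \<open>b\<close> takes the place of an estimate for
  \<open>b(x,V) \<phi>\<close>. Every truncation, of competitors, of test functions and of
  differences of solutions, rests on the chain rule for weak gradients; that is what the bump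
  functions and mollifiers are for.\<close>

definition flat :: "nat \<Rightarrow> real \<Rightarrow> real" where
  "flat n t = (if t \<le> 0 then 0 else exp (-1/t) / t^n)"

text \<open>With \<open>inverse h\<close> as variable this is the decay of a power against the
  exponential at infinity.\<close>

lemma flat_quotient_tendsto_0: "((\<lambda>h. exp (-1/h) / h^k) \<longlongrightarrow> (0::real)) (at_right 0)"
proof -
  have "((\<lambda>h::real. (inverse h)^k / exp (inverse h)) \<longlongrightarrow> 0) (at_right 0)"
    by (rule filterlim_compose[OF tendsto_power_div_exp_0 filterlim_inverse_at_top_right])
  moreover have "\<forall>\<^sub>F h::real in at_right 0. (inverse h)^k / exp (inverse h) = exp (-1/h) / h^k"
    by (intro always_eventually) (simp add: exp_minus field_simps inverse_eq_divide)
  ultimately show ?thesis by (rule Lim_transform_eventually)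
qed

lemma flat_nonneg: "0 \<le> flat n t"
  by (simp add: flat_def)

text \<open>The index \<open>n\<close> exists for this formula: the span of the family is closed
  under differentiation, so smoothness of every order becomes one induction. Away from 0 it is
  calculus; at 0 both one-sided difference quotients tend to 0, the right one being
  \<open>exp (-1/h) / h^(n+1)\<close>.\<close>

lemma flat_deriv:
  "(flat n has_real_derivative (flat (n+2) t - real n * flat (n+1) t)) (at t)"
proof -
  consider "t > 0" | "t < 0" | "t = 0" by linarith
  then show ?thesis
  proof cases
    case 1
    have E: "((\<lambda>t. exp (- inverse t)) has_real_derivative exp (- inverse t) * (inverse t)\<^sup>2) (at t)"
      using 1 by (auto intro!: derivative_eq_intros simp: power2_eq_square)
    have I: "(inverse has_real_derivative - (inverse t)\<^sup>2) (at t)"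
      using DERIV_inverse[of t UNIV] 1 by (simp add: numeral_2_eq_2)
    have P: "((\<lambda>t. inverse t ^ n) has_real_derivative - real n * inverse t ^ (n+1)) (at t)"
      using DERIV_power[OF I, of n] by (cases n) (auto simp: power2_eq_square algebra_simps)
    have D: "((\<lambda>t. exp (-1/t) / t^n) has_real_derivative (flat (n+2) t - real n * flat (n+1) t)) (at t)"
      using DERIV_mult[OF E P] 1
      by (simp add: flat_def inverse_eq_divide power_one_over power2_eq_square algebra_simps)
    have "\<forall>\<^sub>F s in nhds t. flat n s = exp (-1/s) / s^n"
      using eventually_nhds_in_open[of "{0<..}" t] 1 by (auto elim!: eventually_mono simp: flat_def)
    then show ?thesis using D by (subst DERIV_cong_ev[OF refl _ refl]) auto
  next
    case 2
    have "\<forall>\<^sub>F s in nhds t. flat n s = 0"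
      using eventually_nhds_in_open[of "{..<0}" t] 2 by (auto elim!: eventually_mono simp: flat_def)
    then show ?thesis using 2 by (subst DERIV_cong_ev[OF refl _ refl, where g = "\<lambda>_. 0"]) (auto simp: flat_def)
  next
    case 3
    have "((\<lambda>h. flat n h / h) \<longlongrightarrow> 0) (at_right 0)"
    proof (rule Lim_transform_eventually[OF flat_quotient_tendsto_0[of "Suc n"]])
      show "\<forall>\<^sub>F h in at_right 0. exp (-1/h) / h^Suc n = flat n h / h"
        using eventually_at_right_less[of 0] by (auto elim!: eventually_mono simp: flat_def field_simps)
    qed
    moreover have "((\<lambda>h. flat n h / h) \<longlongrightarrow> 0) (at_left 0)"
    proof (rule Lim_transform_eventually[OF tendsto_const])
      show "\<forall>\<^sub>F h in at_left 0. 0 = flat n h / (h::real)"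
        using eventually_at_left_real[of "-1" 0] by (auto elim!: eventually_mono simp: flat_def)
    qed
    ultimately have "((\<lambda>h. flat n h / h) \<longlongrightarrow> 0) (at 0)"
      by (simp add: filterlim_split_at)
    then show ?thesis using 3 by (simp add: DERIV_def flat_def)
  qed
qed

text \<open>An algebra that contains the mollifiers and that partial differentiation does not leave.
  Membership therefore implies \<open>C_k\<close> for every \<open>k\<close>, and no higher
  derivative has to be computed.\<close>

inductive smooth_alg :: "('a::euclidean_space \<Rightarrow> real) \<Rightarrow> bool" where
  smooth_const: "smooth_alg (\<lambda>x. c)"
| smooth_coord: "smooth_alg (\<lambda>x. x \<bullet> i)"
| smooth_add: "smooth_alg f \<Longrightarrow> smooth_alg g \<Longrightarrow> smooth_alg (\<lambda>x. f x + g x)"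
| smooth_mult: "smooth_alg f \<Longrightarrow> smooth_alg g \<Longrightarrow> smooth_alg (\<lambda>x. f x * g x)"
| smooth_flat: "smooth_alg f \<Longrightarrow> smooth_alg (\<lambda>x. flat n (f x))"

lemma smooth_alg_sum:
  assumes "\<And>i. i \<in> I \<Longrightarrow> smooth_alg (f i)"
  shows "smooth_alg (\<lambda>x. \<Sum>i\<in>I. f i x)"
proof (cases "finite I")
  case True
  then show ?thesis using assms
    by (induction rule: finite_induct) (auto intro: smooth_const smooth_add)
qed (simp add: smooth_const)

lemma smooth_alg_diff: "smooth_alg f \<Longrightarrow> smooth_alg g \<Longrightarrow> smooth_alg (\<lambda>x. f x - g x)"
  using smooth_add[OF _ smooth_mult[OF smooth_const[of "-1"]], of f g] by simp

lemma smooth_alg_derivative: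
  assumes "smooth_alg f"
  shows "\<exists>f'. (\<forall>x. (f has_derivative f' x) (at x)) \<and> (\<forall>i. smooth_alg (\<lambda>x. f' x i))"
  using assms
proof induction
  case (smooth_const c)
  show ?case by (rule exI[of _ "\<lambda>x i. 0"]) (auto intro: smooth_alg.smooth_const)
next
  case (smooth_coord i)
  show ?case
    by (rule exI[of _ "\<lambda>x h. h \<bullet> i"]) (auto intro!: derivative_eq_intros smooth_alg.smooth_const)
next
  case (smooth_add f g)
  then obtain f' g' where *: "\<forall>x. (f has_derivative f' x) (at x)" "\<forall>i. smooth_alg (\<lambda>x. f' x i)"
    "\<forall>x. (g has_derivative g' x) (at x)" "\<forall>i. smooth_alg (\<lambda>x. g' x i)" by blast
  show ?case
    by (rule exI[of _ "\<lambda>x h. f' x h + g' x h"])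
       (use * in \<open>auto intro!: has_derivative_add smooth_alg.smooth_add\<close>)
next
  case (smooth_mult f g)
  then obtain f' g' where *: "\<forall>x. (f has_derivative f' x) (at x)" "\<forall>i. smooth_alg (\<lambda>x. f' x i)"
    "\<forall>x. (g has_derivative g' x) (at x)" "\<forall>i. smooth_alg (\<lambda>x. g' x i)" by blast
  show ?case
    by (rule exI[of _ "\<lambda>x h. f x * g' x h + f' x h * g x"])
       (use * smooth_mult.hyps in \<open>auto intro!: has_derivative_mult smooth_alg.smooth_add smooth_alg.smooth_mult\<close>)
next
  case (smooth_flat f n)
  then obtain f' where *: "\<forall>x. (f has_derivative f' x) (at x)" "\<forall>i. smooth_alg (\<lambda>x. f' x i)" by blast
  have "((\<lambda>x. flat n (f x)) has_derivative
      (\<lambda>h. (flat (n+2) (f x) - real n * flat (n+1) (f x)) * f' x h)) (at x)" for x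
    using has_derivative_compose[OF *(1)[rule_format, of x]
        flat_deriv[of n "f x", unfolded has_field_derivative_def]] by simp
  moreover have "smooth_alg (\<lambda>x. (flat (n+2) (f x) - real n * flat (n+1) (f x)) * f' x i)" for i
    using * smooth_flat.hyps
    by (intro smooth_alg.smooth_mult smooth_alg_diff smooth_alg.smooth_flat smooth_alg.smooth_const) auto
  ultimately show ?case
    by (intro exI[of _ "\<lambda>x h. (flat (n+2) (f x) - real n * flat (n+1) (f x)) * f' x h"]) auto
qed

lemma smooth_alg_C_k: "smooth_alg f \<Longrightarrow> C_k k f"
proof (induction k arbitrary: f)
  case 0
  then obtain f' where "\<forall>x. (f has_derivative f' x) (at x)" using smooth_alg_derivative by blast
  then show ?case
    by (auto intro!: continuous_at_imp_continuous_on intro: has_derivative_continuous)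
next
  case (Suc k)
  obtain f' where f': "\<forall>x. (f has_derivative f' x) (at x)" "\<forall>i. smooth_alg (\<lambda>x. f' x i)"
    using smooth_alg_derivative[OF Suc.prems] by blast
  have "frechet_derivative f (at x) = f' x" for x
    using frechet_derivative_at[OF f'(1)[rule_format]] by simp
  then show ?case using f' Suc.IH by (auto simp: differentiable_def)
qed

text \<open>The squared norm is used since it is a polynomial in the coordinates, which keeps
  \<open>bump\<close> inside \<open>smooth_alg\<close>. For r > 0 this is exp(-1/(r^2 - |z|^2)) in
  the ball of radius r and 0 elsewhere.\<close>

definition bump :: "real \<Rightarrow> 'a::euclidean_space \<Rightarrow> real" where
  "bump r z = flat 0 (r\<^sup>2 - z \<bullet> z)"

lemma bump_translate_smooth: "smooth_alg (\<lambda>x. bump r (x - y))" for y :: "'a::euclidean_space"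
proof -
  have "(x - y) \<bullet> (x - y) = (\<Sum>i\<in>Basis. (x \<bullet> i - y \<bullet> i) * (x \<bullet> i - y \<bullet> i))" for x :: 'a
    by (subst euclidean_inner) (simp add: inner_diff_left)
  then show ?thesis unfolding bump_def
    by (simp only:)
      (intro smooth_flat smooth_alg_diff smooth_const smooth_alg_sum smooth_mult smooth_coord)
qed

lemma bump_nonneg: "0 \<le> bump r z" by (simp add: bump_def flat_nonneg)

lemma bump_minus: "bump r (- z) = bump r z" by (simp add: bump_def)

lemma bump_eq_0: "r \<ge> 0 \<Longrightarrow> bump r z = 0 \<longleftrightarrow> r \<le> norm z"
proof -
  assume r: "r \<ge> 0"
  have "r\<^sup>2 \<le> z \<bullet> z \<longleftrightarrow> r \<le> norm z"
    using r by (metis abs_norm_cancel abs_of_nonneg dot_square_norm abs_le_square_iff)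
  then show ?thesis by (auto simp: bump_def flat_def)
qed

lemma bump_support: "r > 0 \<Longrightarrow> closure {x. bump r (x - y) \<noteq> 0} = cball y r"
  using closure_ball[of r y] by (simp add: bump_eq_0 ball_def not_le dist_norm norm_minus_commute)

lemma continuous_bump: "continuous_on UNIV (bump r)" 
  using smooth_alg_C_k[OF bump_translate_smooth[of r 0], of 0] by simp

section \<open>Mollification\<close>

text \<open>Density in L1 by induction on the integrable function. For the indicator of
  \<open>A\<close>, a Urysohn function separates a closed set inside \<open>A\<close> from the
  complement of an open set around \<open>A\<close>, both close to \<open>A\<close> in measure; sums
  and limits follow by the triangle inequality.\<close>

lemma integrable_approx_continuous_integrable:
  fixes f :: "'a::euclidean_space \<Rightarrow> real"
  assumes "integrable lborel f"
  shows "\<forall>e>0. \<exists>g. continuous_on UNIV g \<and> integrable lborel g \<and> (LINT x|lborel. \<bar>f x - g x\<bar>) < e"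
  using assms
proof (induction rule: integrable_induct)
  case (base A c)
  show ?case
  proof (intro allI impI)
    fix e :: real assume "e > 0"
    \<comment> \<open>The Urysohn function differs from the indicator of \<open>A\<close> only on
      \<open>U - T\<close>, of measure at most \<open>2 * d\<close>; the error is thus at most
      \<open>\<bar>c\<bar> * (2 * d) < e\<close>, and the \<open>+ 1\<close> covers
      \<open>c = 0\<close>.\<close>
    define d where "d = e / (2 * (\<bar>c\<bar> + 1))"
    have d: "d > 0" using \<open>e > 0\<close> by (simp add: d_def)
    obtain U where U: "open U" "A \<subseteq> U" "emeasure lborel (U - A) < ennreal d"
      using outer_regular_lborel[OF _ d] base by auto
    obtain T where T: "closed T" "T \<subseteq> A" "emeasure lebesgue (A - T) < ennreal d"
      by (rule sets_lebesgue_inner_closed[OF sets_completionI_sets[OF base(1)] d])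
    have disj: "- U \<inter> T = {}" and cU: "closed (- U)" using U T by auto
    obtain h :: "'a \<Rightarrow> real" where h: "continuous_on UNIV h" "\<And>x. h x \<in> closed_segment 0 1"
      "\<And>x. x \<in> - U \<Longrightarrow> h x = 0" "\<And>x. x \<in> T \<Longrightarrow> h x = 1"
      using Urysohn[OF cU T(1) disj, of 0 "1::real"] by metis
    have h01: "0 \<le> h x" "h x \<le> 1" for x
      using h(2)[of x] by (auto simp: closed_segment_eq_real_ivl)
    have [measurable]: "A \<in> sets borel" "U \<in> sets borel" "T \<in> sets borel"
      using base U T by auto
    have "emeasure lborel (U - T) \<le> emeasure lborel (U - A) + emeasure lborel (A - T)"
      by (rule order_trans[OF emeasure_mono emeasure_subadditive]) auto
    also have "\<dots> < ennreal d + ennreal d"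
      using U(3) T(3) by (intro add_strict_mono) auto
    also have "\<dots> = ennreal (2 * d)" using d by (simp flip: ennreal_plus)
    finally have m: "emeasure lborel (U - T) < ennreal (2 * d)" .
    have fin: "emeasure lborel (U - T) < \<infinity>" using m by (simp add: less_trans[OF m])
    have meas: "measure lborel (U - T) \<le> 2 * d"
      unfolding measure_def using m d by (intro enn2real_leI) (auto simp: less_imp_le)
    have [measurable]: "h \<in> borel_measurable borel" using h(1) by (rule borel_measurable_continuous_onI)
    have bound: "\<bar>indicator A x - h x\<bar> \<le> indicator (U - T) x" for x :: 'a
      using h01[of x] h(3)[of x] h(4)[of x] U(2) T(2) by (auto simp: indicator_def)
    have iUT: "integrable lborel (indicator (U - T) :: 'a \<Rightarrow> real)"
      using fin by (intro integrable_real_indicator) auto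
    have idiff: "integrable lborel (\<lambda>x. indicator A x - h x)"
      by (rule Bochner_Integration.integrable_bound[OF iUT]) (use bound in auto)
    have iA: "integrable lborel (indicator A :: 'a \<Rightarrow> real)"
      using base by (intro integrable_real_indicator) auto
    have ih: "integrable lborel h"
      using Bochner_Integration.integrable_diff[OF iA idiff] by simp
    have "(LINT x|lborel. \<bar>indicator A x *\<^sub>R c - c * h x\<bar>) = \<bar>c\<bar> * (LINT x|lborel. \<bar>indicator A x - h x\<bar>)"
      by (subst integral_mult_right_zero[symmetric]) (simp add: abs_mult[symmetric] algebra_simps)
    also have "\<dots> \<le> \<bar>c\<bar> * (LINT x|lborel. indicator (U - T) x)"
      using idiff iUT bound by (intro mult_left_mono integral_mono) auto
    also have "\<dots> = \<bar>c\<bar> * measure lborel (U - T)" by simp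
    also have "\<dots> \<le> \<bar>c\<bar> * (2 * d)" using meas by (intro mult_left_mono) auto
    also have "\<dots> < e" using \<open>e > 0\<close> by (simp add: d_def field_simps)
    finally show "\<exists>g. continuous_on UNIV g \<and> integrable lborel g \<and> (LINT x|lborel. \<bar>indicator A x *\<^sub>R c - g x\<bar>) < e"
      using h(1) ih by (intro exI[of _ "\<lambda>x. c * h x"]) (auto intro!: continuous_intros)
  qed
next
  case (add f g)
  show ?case
  proof (intro allI impI)
    fix e :: real assume "e > 0"
    then have e2: "e/2 > 0" by simp
    obtain f' where f': "continuous_on UNIV f'" "integrable lborel f'" "(LINT x|lborel. \<bar>f x - f' x\<bar>) < e/2"
      using add.IH(1) e2 by blast
    obtain g' where g': "continuous_on UNIV g'" "integrable lborel g'" "(LINT x|lborel. \<bar>g x - g' x\<bar>) < e/2"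
      using add.IH(2) e2 by blast
    note * = f' g'
    have "(LINT x|lborel. \<bar>f x + g x - (f' x + g' x)\<bar>) \<le> (LINT x|lborel. \<bar>f x - f' x\<bar> + \<bar>g x - g' x\<bar>)"
      using * add.hyps by (intro integral_mono) auto
    also have "\<dots> = (LINT x|lborel. \<bar>f x - f' x\<bar>) + (LINT x|lborel. \<bar>g x - g' x\<bar>)"
      using * add.hyps by (intro Bochner_Integration.integral_add) auto
    also have "\<dots> < e" using * by simp
    finally show "\<exists>h. continuous_on UNIV h \<and> integrable lborel h \<and> (LINT x|lborel. \<bar>f x + g x - h x\<bar>) < e"
      using * by (intro exI[of _ "\<lambda>x. f' x + g' x"]) (auto intro!: continuous_intros)
  qed
next
  case (lim f s)
  have "(\<lambda>i. LINT x|lborel. \<bar>f x - s i x\<bar>) \<longlonglongrightarrow> (LINT x|(lborel::'a measure). 0)"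
  proof (rule integral_dominated_convergence[where w = "\<lambda>x. 3 * \<bar>f x\<bar>"])
    show "AE x in lborel. (\<lambda>i. \<bar>f x - s i x\<bar>) \<longlonglongrightarrow> 0"
    proof (rule AE_I2)
      fix x show "(\<lambda>i. \<bar>f x - s i x\<bar>) \<longlonglongrightarrow> 0"
        using tendsto_rabs[OF tendsto_diff[OF tendsto_const[of "f x"] lim.hyps(2)[of x]]] by simp
    qed
    show "AE x in lborel. norm \<bar>f x - s i x\<bar> \<le> 3 * \<bar>f x\<bar>" for i
    proof (rule AE_I2)
      fix x show "norm \<bar>f x - s i x\<bar> \<le> 3 * \<bar>f x\<bar>"
        using lim.hyps(3)[of x i] abs_triangle_ineq4[of "f x" "s i x"] by simp
    qed
  qed (use lim.hyps(1,4) in simp_all)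
  then have L: "(\<lambda>i. LINT x|lborel. \<bar>f x - s i x\<bar>) \<longlonglongrightarrow> 0" by simp
  show ?case
  proof (intro allI impI)
    fix e :: real assume "e > 0"
    then have "\<forall>\<^sub>F i in sequentially. (LINT x|lborel. \<bar>f x - s i x\<bar>) < e/2"
      using order_tendstoD(2)[OF L, of "e/2"] by simp
    then obtain i where i: "(LINT x|lborel. \<bar>f x - s i x\<bar>) < e/2"
      by (auto simp: eventually_sequentially)
    obtain g where g: "continuous_on UNIV g" "integrable lborel g" "(LINT x|lborel. \<bar>s i x - g x\<bar>) < e/2"
      using lim.IH[of i] half_gt_zero[OF \<open>e > 0\<close>] by blast
    have "(LINT x|lborel. \<bar>f x - g x\<bar>) \<le> (LINT x|lborel. \<bar>f x - s i x\<bar> + \<bar>s i x - g x\<bar>)"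
      using lim.hyps(1)[of i] lim.hyps(4) g by (intro integral_mono) auto
    also have "\<dots> = (LINT x|lborel. \<bar>f x - s i x\<bar>) + (LINT x|lborel. \<bar>s i x - g x\<bar>)"
      using lim.hyps(1)[of i] lim.hyps(4) g by (intro Bochner_Integration.integral_add) auto
    also have "\<dots> < e" using i g by simp
    finally show "\<exists>h. continuous_on UNIV h \<and> integrable lborel h \<and> (LINT x|lborel. \<bar>f x - h x\<bar>) < e"
      using g by blast
  qed
qed

text \<open>Multiplication by \<open>cut n\<close>, which is 1 for \<open>norm x \<le> n - 1\<close>
  and 0 for \<open>norm x \<ge> n\<close>, changes \<open>g\<close> little in L1 by dominated
  convergence. The bounded support confines the later estimate of mollifications to a fixed
  ball.\<close>

lemma integrable_approx_continuous:
  fixes f :: "'a::euclidean_space \<Rightarrow> real"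
  assumes f: "integrable lborel f" and e: "e > 0"
  obtains g R where "continuous_on UNIV g" "integrable lborel g" "(LINT x|lborel. \<bar>f x - g x\<bar>) < e"
    "\<And>x. R < norm x \<Longrightarrow> g x = 0"
proof -
  obtain g where g: "continuous_on UNIV g" "integrable lborel g" "(LINT x|lborel. \<bar>f x - g x\<bar>) < e/2"
    using integrable_approx_continuous_integrable[OF f] half_gt_zero[OF e] by blast
  define cut where "cut n x = max 0 (min 1 (real n - norm x))" for n and x :: 'a
  have cut01: "0 \<le> cut n x" "cut n x \<le> 1" for n x by (auto simp: cut_def)
  have cutc: "continuous_on UNIV (cut n)" for n unfolding cut_def by (intro continuous_intros)
  have [measurable]: "cut n \<in> borel_measurable borel" "g \<in> borel_measurable borel" for n
    using cutc g(1) by (auto intro: borel_measurable_continuous_onI)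
  have ig: "integrable lborel (\<lambda>x. cut n x * g x)" for n
    by (rule Bochner_Integration.integrable_bound[OF g(2)])
       (use cut01 in \<open>auto simp: abs_mult intro!: mult_left_le_one_le\<close>)
  have "(\<lambda>n. LINT x|lborel. \<bar>g x - cut n x * g x\<bar>) \<longlonglongrightarrow> (LINT x|(lborel::'a measure). 0)"
  proof (rule integral_dominated_convergence[where w = "\<lambda>x. \<bar>g x\<bar>"])
    show "AE x in lborel. (\<lambda>n. \<bar>g x - cut n x * g x\<bar>) \<longlonglongrightarrow> 0"
    proof (rule AE_I2)
      fix x
      have "\<forall>\<^sub>F n in sequentially. 0 = \<bar>g x - cut n x * g x\<bar>"
        using eventually_ge_at_top[of "nat \<lceil>norm x + 1\<rceil>"]
      proof eventually_elim
        case (elim n)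
        then have "real n - norm x \<ge> 1" by linarith
        then show ?case by (simp add: cut_def)
      qed
      then show "(\<lambda>n. \<bar>g x - cut n x * g x\<bar>) \<longlonglongrightarrow> 0"
        by (rule Lim_transform_eventually[OF tendsto_const])
    qed
    show "AE x in lborel. norm \<bar>g x - cut n x * g x\<bar> \<le> \<bar>g x\<bar>" for n
    proof (rule AE_I2)
      fix x
      have "g x - cut n x * g x = (1 - cut n x) * g x" by (simp add: algebra_simps)
      then show "norm \<bar>g x - cut n x * g x\<bar> \<le> \<bar>g x\<bar>"
        using cut01[of n x] by (auto simp: abs_mult intro!: mult_left_le_one_le)
    qed
  qed (use g in auto)
  then have "\<forall>\<^sub>F n in sequentially. (LINT x|lborel. \<bar>g x - cut n x * g x\<bar>) < e/2"
    using order_tendstoD(2)[of _ 0 sequentially "e/2"] e by simp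
  then obtain n where n: "(LINT x|lborel. \<bar>g x - cut n x * g x\<bar>) < e/2"
    by (auto simp: eventually_sequentially)
  have "(LINT x|lborel. \<bar>f x - cut n x * g x\<bar>) \<le> (LINT x|lborel. \<bar>f x - g x\<bar> + \<bar>g x - cut n x * g x\<bar>)"
    using f g ig[of n] by (intro integral_mono) auto
  also have "\<dots> = (LINT x|lborel. \<bar>f x - g x\<bar>) + (LINT x|lborel. \<bar>g x - cut n x * g x\<bar>)"
    using f g ig[of n] by (intro Bochner_Integration.integral_add) auto
  also have "\<dots> < e" using n g by simp
  finally have close: "(LINT x|lborel. \<bar>f x - cut n x * g x\<bar>) < e" .
  show ?thesis
  proof (rule that[of "\<lambda>x. cut n x * g x" "real n"])
    show "continuous_on UNIV (\<lambda>x. cut n x * g x)" using cutc g by (intro continuous_intros) auto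
    show "real n < norm x \<Longrightarrow> cut n x * g x = 0" for x by (auto simp: cut_def)
  qed (use close ig in auto)
qed

definition moll_kernel :: "real \<Rightarrow> 'a::euclidean_space \<Rightarrow> real" where
  "moll_kernel r z = bump r z / (LINT w|lborel. bump r (w::'a))"

definition mollify :: "real \<Rightarrow> ('a::euclidean_space \<Rightarrow> real) \<Rightarrow> 'a \<Rightarrow> real" where
  "mollify r f x = (LINT y|lborel. moll_kernel r (x - y) * f y)"

lemma integrable_bump: "r > 0 \<Longrightarrow> integrable lborel (bump r :: 'a::euclidean_space \<Rightarrow> real)"
proof -
  assume r: "r > 0"
  have "integrable lborel (\<lambda>x::'a. indicator (cball 0 r) x *\<^sub>R bump r x)"
    by (intro borel_integrable_compact continuous_on_subset[OF continuous_bump]) auto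
  moreover have "(\<lambda>x::'a. indicator (cball 0 r) x *\<^sub>R bump r x) = bump r"
    using r by (auto simp: fun_eq_iff indicator_def bump_eq_0)
  ultimately show ?thesis by simp
qed

lemma bump_mass_pos: "r > 0 \<Longrightarrow> (LINT w|lborel. bump r (w::'a::euclidean_space)) > 0"
proof -
  assume r: "r > 0"
  have "(LINT w|lborel. bump r (w::'a)) \<noteq> 0"
  proof
    assume "(LINT w|lborel. bump r (w::'a)) = 0"
    then have "AE w in lborel. bump r (w::'a) = 0"
      using integral_nonneg_eq_0_iff_AE[OF integrable_bump[OF r]] by (auto simp: bump_nonneg)
    then have "AE w in lborel. (w::'a) \<notin> ball 0 r"
      by eventually_elim (use r in \<open>auto simp: bump_eq_0\<close>)
    then have "ball (0::'a) r \<in> null_sets lborel" by (simp add: AE_iff_null_sets)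
    then have "negligible (ball (0::'a) r)"
      by (simp add: negligible_iff_null_sets null_sets_completionI)
    then show False using open_not_negligible[of "ball (0::'a) r"] r by simp
  qed
  then show ?thesis using Bochner_Integration.integral_nonneg[of lborel "bump r :: 'a \<Rightarrow> real"] by (simp add: bump_nonneg less_le)
qed

lemma moll_kernel_nonneg: "0 < r \<Longrightarrow> 0 \<le> moll_kernel r z"
  unfolding moll_kernel_def by (intro divide_nonneg_nonneg bump_nonneg less_imp_le[OF bump_mass_pos])

lemma moll_kernel_minus: "moll_kernel r (- z) = moll_kernel r z"
  by (simp add: moll_kernel_def bump_minus)

lemma moll_kernel_eq_0: "0 < r \<Longrightarrow> r \<le> norm z \<Longrightarrow> moll_kernel r z = 0"
  by (simp add: moll_kernel_def bump_eq_0)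

lemma continuous_moll_kernel: "0 < r \<Longrightarrow> continuous_on UNIV (moll_kernel r)"
  unfolding moll_kernel_def
  by (intro continuous_intros continuous_bump) (simp add: less_imp_neq[OF bump_mass_pos, symmetric])

lemma borel_measurable_moll_kernel [measurable]: "moll_kernel r \<in> borel_measurable borel"
  unfolding moll_kernel_def
  using borel_measurable_continuous_onI[OF continuous_bump] by measurable

lemma integral_moll_kernel:
  assumes "0 < r"
  shows "integrable lborel (\<lambda>x::'a::euclidean_space. moll_kernel r (x - y))" (is ?I)
    and "(LINT x|lborel. moll_kernel r (x - (y::'a))) = 1" (is "?E = 1")
proof -
  have i: "integrable lborel (moll_kernel r :: 'a \<Rightarrow> real)"
    unfolding moll_kernel_def using integrable_bump[OF assms] by auto
  have l: "lborel = distr lborel borel ((+) (-y))" by (simp add: lborel_distr_plus)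
  have "integrable (distr lborel borel ((+) (-y))) (moll_kernel r)" using i l by simp
  then show ?I by (subst (asm) integrable_distr_eq) auto
  have "(LINT x|lborel. moll_kernel r (x - y)) = (LINT x|distr lborel borel ((+) (-y)). moll_kernel r x)"
    by (subst integral_distr) auto
  also have "\<dots> = 1"
    unfolding l[symmetric] using bump_mass_pos[OF assms, where 'a='a] by (simp add: moll_kernel_def)
  finally show "?E = 1" .
qed

lemma moll_kernel_sym: "moll_kernel r (x - y) = moll_kernel r (y - x)"
  using moll_kernel_minus[of r "x - y"] by simp

lemma moll_kernel_bounded:
  assumes "0 < r"
  obtains C where "C > 0" "\<And>z. \<bar>moll_kernel r (z::'a::euclidean_space)\<bar> \<le> C"
proof -
  have "compact (moll_kernel r ` cball (0::'a) r)"
    by (intro compact_continuous_image continuous_on_subset[OF continuous_moll_kernel[OF assms]]) auto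
  then obtain C where C: "C > 0" "\<And>z. z \<in> cball (0::'a) r \<Longrightarrow> \<bar>moll_kernel r z\<bar> \<le> C"
    using compact_imp_bounded bounded_pos by (metis (no_types, lifting) image_eqI real_norm_def)
  show ?thesis
  proof (rule that[OF C(1)])
    fix z :: 'a show "\<bar>moll_kernel r z\<bar> \<le> C"
      using C moll_kernel_eq_0[OF assms, of z] by (cases "norm z \<le> r") auto
  qed
qed

lemma integrable_moll_kernel_mult:
  fixes f :: "'a::euclidean_space \<Rightarrow> real"
  assumes "0 < r" "integrable lborel f"
  shows "integrable lborel (\<lambda>y. moll_kernel r (x - y) * f y)"
proof -
  obtain C where C: "C > 0" "\<And>z. \<bar>moll_kernel r (z::'a)\<bar> \<le> C" using moll_kernel_bounded[OF assms(1)] by blast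
  show ?thesis
    by (rule Bochner_Integration.integrable_bound[of _ "\<lambda>y. C * f y"])
       (use assms C in \<open>auto simp: abs_mult intro!: mult_right_mono\<close>)
qed

lemma borel_measurable_mollify [measurable]:
  fixes f :: "'a::euclidean_space \<Rightarrow> real"
  assumes [measurable]: "f \<in> borel_measurable borel"
  shows "mollify r f \<in> borel_measurable borel"
  unfolding mollify_def by measurable

text \<open>By Tonelli, since the kernel has mass 1 in \<open>x\<close> for each fixed
  \<open>y\<close>. In terms of extended integrals the estimate yields the integrability of
  \<open>mollify r f\<close> and the contraction in L1 together.\<close>

lemma nn_integral_mollify_le:
  fixes f :: "'a::euclidean_space \<Rightarrow> real"
  assumes r: "0 < r" and f: "integrable lborel f"
  shows "(\<integral>\<^sup>+x. \<bar>mollify r f x\<bar> \<partial>lborel) \<le> (\<integral>\<^sup>+x. \<bar>f x\<bar> \<partial>lborel)"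
proof -
  have [measurable]: "f \<in> borel_measurable borel" using f by auto
  have "(\<integral>\<^sup>+x. \<bar>mollify r f x\<bar> \<partial>lborel) \<le> (\<integral>\<^sup>+x. (\<integral>\<^sup>+y. ennreal (moll_kernel r (x - y)) * ennreal \<bar>f y\<bar> \<partial>lborel) \<partial>lborel)"
  proof (rule nn_integral_mono)
    fix x
    have "ennreal \<bar>mollify r f x\<bar> \<le> (\<integral>\<^sup>+y. norm (moll_kernel r (x - y) * f y) \<partial>lborel)"
      unfolding mollify_def using integral_norm_bound_ennreal[OF integrable_moll_kernel_mult[OF r f]] by simp
    also have "\<dots> = (\<integral>\<^sup>+y. ennreal (moll_kernel r (x - y)) * ennreal \<bar>f y\<bar> \<partial>lborel)"
      by (intro nn_integral_cong) (simp add: abs_mult moll_kernel_nonneg[OF r] ennreal_mult)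
    finally show "ennreal \<bar>mollify r f x\<bar> \<le> \<dots>" .
  qed
  also have "\<dots> = (\<integral>\<^sup>+y. (\<integral>\<^sup>+x. ennreal (moll_kernel r (x - y)) * ennreal \<bar>f y\<bar> \<partial>lborel) \<partial>lborel)"
    by (rule lborel_pair.Fubini'[symmetric]) measurable
  also have "\<dots> = (\<integral>\<^sup>+y. (\<integral>\<^sup>+x. ennreal (moll_kernel r (x - y)) \<partial>lborel) * ennreal \<bar>f y\<bar> \<partial>lborel)"
    by (intro nn_integral_cong nn_integral_multc) measurable
  also have "\<dots> = (\<integral>\<^sup>+y. ennreal \<bar>f y\<bar> \<partial>lborel)"
    by (intro nn_integral_cong)
      (simp add: nn_integral_eq_integral integral_moll_kernel[OF r] moll_kernel_nonneg[OF r])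
  finally show ?thesis .
qed

lemma integrable_mollify:
  fixes f :: "'a::euclidean_space \<Rightarrow> real"
  assumes "0 < r" "integrable lborel f"
  shows "integrable lborel (mollify r f)"
  using nn_integral_mollify_le[OF assms] assms(2)
  by (auto simp: integrable_iff_bounded intro!: borel_measurable_mollify)

lemma mollify_L1_le:
  fixes f :: "'a::euclidean_space \<Rightarrow> real"
  assumes "0 < r" "integrable lborel f"
  shows "(LINT x|lborel. \<bar>mollify r f x\<bar>) \<le> (LINT x|lborel. \<bar>f x\<bar>)"
proof -
  have "ennreal (LINT x|lborel. \<bar>mollify r f x\<bar>) \<le> ennreal (LINT x|lborel. \<bar>f x\<bar>)"
    using nn_integral_mollify_le[OF assms] integrable_mollify[OF assms] assms(2)
    by (simp add: nn_integral_eq_integral)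
  then show ?thesis by (simp add: ennreal_le_iff)
qed

lemma mollify_diff:
  assumes "0 < r" "integrable lborel f" "integrable lborel g"
  shows "mollify r (\<lambda>x. f x - g x) x = mollify r f x - mollify r g x"
  unfolding mollify_def right_diff_distrib
  by (intro Bochner_Integration.integral_diff integrable_moll_kernel_mult assms)

text \<open>A three-term estimate: \<open>f\<close> is replaced by a continuous \<open>g\<close> of
  bounded support, which the contraction property also permits under mollification, and
  mollification moves a uniformly continuous \<open>g\<close> by little on a fixed ball and by
  nothing outside of it.\<close>

lemma mollify_L1_tendsto:
  fixes f :: "'a::euclidean_space \<Rightarrow> real"
  assumes f: "integrable lborel f" and e: "0 < e"
  obtains r0 where "0 < r0" "\<And>r. 0 < r \<Longrightarrow> r < r0 \<Longrightarrow> (LINT x|lborel. \<bar>mollify r f x - f x\<bar>) < e"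
proof -
  obtain g R where g: "continuous_on UNIV g" "integrable lborel g" "(LINT x|lborel. \<bar>f x - g x\<bar>) < e/3"
    "\<And>x. R < norm x \<Longrightarrow> g x = 0"
    using integrable_approx_continuous[OF f, of "e/3"] e by auto
  \<comment> \<open>Mollification with radius \<open>r < 1\<close> enlarges the support of
    \<open>g\<close> by at most 1, hence the radius \<open>\<bar>R\<bar> + 1\<close>. Uniform
    continuity is taken below on radius \<open>\<bar>R\<bar> + 2\<close>, so that it covers the
    points at distance less than 1 from \<open>B\<close>. The absolute value guards against a
    negative \<open>R\<close>.\<close>
  define B where "B = cball (0::'a) (\<bar>R\<bar> + 1)"
  define m where "m = measure lborel B"
  have m: "m \<ge> 0" by (simp add: m_def)
  have that_pos: "0 < e / (3 * (m + 1))" using e m by simp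
  have "uniformly_continuous_on (cball (0::'a) (\<bar>R\<bar> + 2)) g"
    by (intro compact_uniformly_continuous continuous_on_subset[OF g(1)]) auto
  then obtain d where d: "d > 0" "\<And>x y. x \<in> cball 0 (\<bar>R\<bar> + 2) \<Longrightarrow> y \<in> cball 0 (\<bar>R\<bar> + 2) \<Longrightarrow> dist y x < d
      \<Longrightarrow> \<bar>g y - g x\<bar> < e / (3 * (m + 1))"
    unfolding uniformly_continuous_on_def dist_real_def
    using that_pos by meson
  show ?thesis
  proof (rule that[of "min d 1"])
    show "0 < min d 1" using d by simp
    fix r :: real assume r: "0 < r" "r < min d 1"
    have pt: "\<bar>mollify r g x - g x\<bar> \<le> e / (3 * (m + 1)) * indicator B x" for x
    proof -
      have ki: "integrable lborel (\<lambda>y. moll_kernel r (x - y))" "(LINT y|lborel. moll_kernel r (x - y)) = 1"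
        using integral_moll_kernel[OF r(1), of x] by (simp_all add: moll_kernel_sym[of r x])
      have "mollify r g x - g x = (LINT y|lborel. moll_kernel r (x - y) * g y - moll_kernel r (x - y) * g x)"
        unfolding mollify_def
        using integrable_moll_kernel_mult[OF r(1) g(2)] ki
        by (subst Bochner_Integration.integral_diff) auto
      also have "\<bar>\<dots>\<bar> \<le> (LINT y|lborel. moll_kernel r (x - y) * (e / (3 * (m + 1)) * indicator B x))"
      proof (rule integral_abs_bound[THEN order_trans], rule integral_mono)
        show "integrable lborel (\<lambda>y. \<bar>moll_kernel r (x - y) * g y - moll_kernel r (x - y) * g x\<bar>)"
          using integrable_moll_kernel_mult[OF r(1) g(2), of x] ki by auto
        show "integrable lborel (\<lambda>y. moll_kernel r (x - y) * (e / (3 * (m + 1)) * indicator B x))"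
          using ki by auto
        fix y
        show "\<bar>moll_kernel r (x - y) * g y - moll_kernel r (x - y) * g x\<bar>
            \<le> moll_kernel r (x - y) * (e / (3 * (m + 1)) * indicator B x)"
        proof (cases "norm (x - y) < r")
          case False
          then show ?thesis using moll_kernel_eq_0[OF r(1), of "x - y"] by simp
        next
          case True
          have n1: "norm y \<le> norm x + 1" "norm x \<le> norm y + 1"
            using True r norm_triangle_sub[of x y] norm_triangle_sub[of y x] by (auto simp: norm_minus_commute)
          have "\<bar>g y - g x\<bar> \<le> e / (3 * (m + 1)) * indicator B x"
          proof (cases "x \<in> B")
            case xB: True
            then have "\<bar>g y - g x\<bar> < e / (3 * (m + 1))"
              using True r n1 by (intro d) (auto simp: B_def dist_norm norm_minus_commute)
            then show ?thesis using xB by simp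
          next
            case xB: False
            then have "g x = 0" "g y = 0" using n1 by (auto simp: B_def intro!: g(4))
            then show ?thesis using xB by simp
          qed
          from mult_left_mono[OF this moll_kernel_nonneg[OF r(1), of "x - y"]] show ?thesis
            by (simp only: right_diff_distrib[symmetric] abs_mult abs_of_nonneg[OF moll_kernel_nonneg[OF r(1)]])
        qed
      qed
      also have "\<dots> = e / (3 * (m + 1)) * indicator B x"
        using ki by simp
      finally show ?thesis .
    qed
    have iB: "integrable lborel (indicator B :: 'a \<Rightarrow> real)"
      unfolding B_def using emeasure_lborel_cball_finite by (intro integrable_real_indicator) auto
    have img: "integrable lborel (mollify r g)" "integrable lborel (mollify r f)"
      using integrable_mollify[OF r(1)] f g by auto
    have "(LINT x|lborel. \<bar>mollify r g x - g x\<bar>) \<le> (LINT x|lborel. e / (3 * (m + 1)) * indicator B x)"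
      using img g iB pt by (intro integral_mono) auto
    also have "\<dots> = e / (3 * (m + 1)) * m" by (simp add: m_def)
    also have "\<dots> < e/3" using e m by (simp add: field_simps)
    finally have 1: "(LINT x|lborel. \<bar>mollify r g x - g x\<bar>) < e/3" .
    have 2: "(LINT x|lborel. \<bar>mollify r f x - mollify r g x\<bar>) < e/3"
      using mollify_L1_le[OF r(1), of "\<lambda>x. f x - g x"] f g(2,3) by (simp add: mollify_diff[OF r(1)])
    have "(LINT x|lborel. \<bar>mollify r f x - f x\<bar>) \<le>
        (LINT x|lborel. \<bar>mollify r f x - mollify r g x\<bar> + \<bar>mollify r g x - g x\<bar> + \<bar>f x - g x\<bar>)"
      using img f g by (intro integral_mono) auto
    also have "\<dots> = (LINT x|lborel. \<bar>mollify r f x - mollify r g x\<bar>) + (LINT x|lborel. \<bar>mollify r g x - g x\<bar>)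
        + (LINT x|lborel. \<bar>f x - g x\<bar>)"
      using img f g by simp
    also have "\<dots> < e" using 1 2 g by simp
    finally show "(LINT x|lborel. \<bar>mollify r f x - f x\<bar>) < e" .
  qed
qed

section \<open>Directional derivatives, test functions and integration by parts\<close>

lemma has_real_derivative_along_line:
  fixes f :: "'a::euclidean_space \<Rightarrow> real"
  assumes "f differentiable (at (x + t *\<^sub>R i))"
  shows "((\<lambda>t. f (x + t *\<^sub>R i)) has_real_derivative frechet_derivative f (at (x + t *\<^sub>R i)) i) (at t)"
proof -
  let ?D = "frechet_derivative f (at (x + t *\<^sub>R i))"
  have D: "(f has_derivative ?D) (at (x + t *\<^sub>R i))" using assms frechet_derivative_works by blast
  have "((\<lambda>t. f (x + t *\<^sub>R i)) has_derivative (\<lambda>h. ?D (h *\<^sub>R i))) (at t)"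
    by (rule has_derivative_compose[where g = f]) (auto intro!: derivative_eq_intros D)
  then show ?thesis
    using linear_frechet_derivative[OF assms]
    by (simp add: has_field_derivative_def linear_cmul mult.commute[of _ "?D i"])
qed

lemma frechet_derivative_eq_0_outside:
  fixes f :: "'a::euclidean_space \<Rightarrow> real"
  assumes "closed K" "\<And>x. x \<notin> K \<Longrightarrow> f x = 0" "x \<notin> K"
  shows "frechet_derivative f (at x) i = 0"
proof -
  have "(f has_derivative (\<lambda>_. 0)) (at x)"
    using assms by (intro has_derivative_transform_within_open[of "\<lambda>_. 0" _ _ UNIV "- K" f]) auto
  then show ?thesis using frechet_derivative_at by metis
qed

lemma compactly_supported_bounded:
  fixes f :: "'a::euclidean_space \<Rightarrow> real"
  assumes "continuous_on UNIV f" "compact K" "\<And>x. x \<notin> K \<Longrightarrow> f x = 0"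
  obtains C where "C > 0" "\<And>x. \<bar>f x\<bar> \<le> C"
proof -
  have "compact (f ` K)"
    by (intro compact_continuous_image continuous_on_subset[OF assms(1)] assms) auto
  then obtain C where C: "C > 0" "\<And>z. z \<in> K \<Longrightarrow> \<bar>f z\<bar> \<le> C"
    using compact_imp_bounded bounded_pos by (metis (no_types, lifting) image_eqI real_norm_def)
  show ?thesis
  proof (rule that[OF C(1)])
    fix z :: 'a show "\<bar>f z\<bar> \<le> C" using C assms(3)[of z] by (cases "z \<in> K") auto
  qed
qed

lemma compactly_supported_C1_lipschitz:
  fixes f :: "'a::euclidean_space \<Rightarrow> real"
  assumes "\<And>x. f differentiable (at x)" "continuous_on UNIV (\<lambda>x. frechet_derivative f (at x) i)"
    and "compact K" "\<And>x. x \<notin> K \<Longrightarrow> f x = 0"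
  obtains C where "C > 0" "\<And>x. \<bar>frechet_derivative f (at x) i\<bar> \<le> C"
    "\<And>x h. \<bar>f (x + h *\<^sub>R i) - f x\<bar> \<le> C * \<bar>h\<bar>"
proof -
  have "\<And>x. x \<notin> K \<Longrightarrow> frechet_derivative f (at x) i = 0"
    by (rule frechet_derivative_eq_0_outside[OF compact_imp_closed[OF assms(3)] assms(4)])
  then obtain C where C: "C > 0" "\<And>x. \<bar>frechet_derivative f (at x) i\<bar> \<le> C"
    using compactly_supported_bounded[OF assms(2,3)] by metis
  have "\<bar>f (x + h *\<^sub>R i) - f x\<bar> \<le> C * \<bar>h\<bar>" for x h
  proof -
    have "norm ((\<lambda>t. f (x + t *\<^sub>R i)) h - (\<lambda>t. f (x + t *\<^sub>R i)) 0) \<le> C * norm (h - 0)"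
      by (rule field_differentiable_bound[of UNIV _ "\<lambda>t. frechet_derivative f (at (x + t *\<^sub>R i)) i"])
        (use C(2) has_real_derivative_along_line[OF assms(1)] in auto)
    then show ?thesis by simp
  qed
  then show ?thesis using that C by blast
qed

lemma test_functionD:
  assumes "\<phi> \<in> test_functions \<Omega>"
  shows "\<And>x. \<phi> differentiable (at x)" "continuous_on UNIV \<phi>"
    "i \<in> Basis \<Longrightarrow> continuous_on UNIV (\<lambda>x. frechet_derivative \<phi> (at x) i)"
    "compact (closure {x. \<phi> x \<noteq> 0})" "closure {x. \<phi> x \<noteq> 0} \<subseteq> \<Omega>"
    "\<And>x. x \<notin> closure {x. \<phi> x \<noteq> 0} \<Longrightarrow> \<phi> x = 0"
    "\<And>x. x \<notin> closure {x. \<phi> x \<noteq> 0} \<Longrightarrow> frechet_derivative \<phi> (at x) i = 0"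
proof -
  have ck: "C_k k \<phi>" for k using assms by (simp add: test_functions_def)
  show "\<And>x. \<phi> differentiable (at x)" "continuous_on UNIV \<phi>"
    "i \<in> Basis \<Longrightarrow> continuous_on UNIV (\<lambda>x. frechet_derivative \<phi> (at x) i)"
    using ck[of 0] ck[of "Suc 0"] by auto
  show "compact (closure {x. \<phi> x \<noteq> 0})" "closure {x. \<phi> x \<noteq> 0} \<subseteq> \<Omega>"
    using assms by (auto simp: test_functions_def)
  show "\<And>x. x \<notin> closure {x. \<phi> x \<noteq> 0} \<Longrightarrow> \<phi> x = 0"
    using closure_subset[of "{x. \<phi> x \<noteq> 0}"] by auto
  then show "\<And>x. x \<notin> closure {x. \<phi> x \<noteq> 0} \<Longrightarrow> frechet_derivative \<phi> (at x) i = 0"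
    by (rule frechet_derivative_eq_0_outside[OF closed_closure])
qed

lemma lborel_translation:
  fixes f :: "'a::euclidean_space \<Rightarrow> real"
  assumes "integrable lborel f"
  shows "integrable lborel (\<lambda>x. f (x + c))" "(LINT x|lborel. f (x + c)) = (LINT x|lborel. f x)"
proof -
  have l: "lborel = distr lborel borel ((+) c)" by (simp add: lborel_distr_plus)
  have [measurable]: "f \<in> borel_measurable borel" using assms by auto
  have "integrable (distr lborel borel ((+) c)) f" using assms l by simp
  then show "integrable lborel (\<lambda>x. f (x + c))"
    by (subst (asm) integrable_distr_eq) (auto simp: add.commute)
  have "(LINT x|lborel. f (x + c)) = (LINT x|distr lborel borel ((+) c). f x)"
    by (subst integral_distr) (auto simp: add.commute)
  then show "(LINT x|lborel. f (x + c)) = (LINT x|lborel. f x)" by (simp flip: l)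
qed

text \<open>Translation invariance makes the integral of every difference quotient 0; the Lipschitz
  bound and the bounded support supply a majorant for the limit. This serves as the integration by
  parts formula, applied to products with a test function and to test functions themselves.\<close>

lemma integral_directional_derivative_eq_0:
  fixes F :: "'a::euclidean_space \<Rightarrow> real"
  assumes [measurable]: "F \<in> borel_measurable borel"
    and F': "\<And>x. ((\<lambda>t. F (x + t *\<^sub>R i)) has_real_derivative F' x) (at 0)"
    and L: "\<And>x h. \<bar>F (x + h *\<^sub>R i) - F x\<bar> \<le> L * \<bar>h\<bar>"
    and K: "bounded K" "\<And>x. x \<notin> K \<Longrightarrow> F x = 0"
    and F: "integrable lborel F"
    and i: "norm i \<le> 1"
  shows "(LINT x|lborel. F' x) = 0"
proof -
  define h where "h n = 1 / real (Suc n)" for n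
  have h: "0 < h n" "h n \<le> 1" for n by (auto simp: h_def)
  have h0: "h \<longlonglongrightarrow> 0" unfolding h_def by (rule LIMSEQ_Suc[OF lim_1_over_n])
  have hat: "filterlim h (at 0) sequentially"
    unfolding filterlim_at using h h0 by (auto intro!: always_eventually simp: less_imp_neq[THEN not_sym])
  define Q where "Q n x = (F (x + h n *\<^sub>R i) - F x) / h n" for n x
  have lim: "(\<lambda>n. Q n x) \<longlonglongrightarrow> F' x" for x
    using filterlim_compose[OF F'[of x, unfolded DERIV_def] hat] by (simp add: Q_def)
  obtain R where R: "\<And>x. x \<in> K \<Longrightarrow> norm x \<le> R" using K(1) bounded_iff by metis
  have L0: "L \<ge> 0" using L[of 0 1] by simp
  \<comment> \<open>Steps \<open>h n \<le> 1\<close> along a vector of norm at most 1 keep all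
    quotients supported in the ball of radius \<open>R + 1\<close>.\<close>
  have bnd: "\<bar>Q n x\<bar> \<le> L * indicator (cball 0 (R + 1)) x" for n x
  proof (cases "x \<in> cball 0 (R + 1)")
    case True
    have "\<bar>Q n x\<bar> = \<bar>F (x + h n *\<^sub>R i) - F x\<bar> / h n" 
      using h(1)[of n] by (simp add: Q_def abs_divide abs_of_pos)
    also have "\<dots> \<le> L" using L[of x "h n"] h(1)[of n] by (subst divide_le_eq) (simp add: abs_of_pos)
    finally show ?thesis using True by simp
  next
    case False
    have "norm (h n *\<^sub>R i) \<le> 1" using h[of n] i by (simp add: mult_le_one)
    then have "norm x - 1 \<le> norm (x + h n *\<^sub>R i)" using norm_diff_ineq[of x "h n *\<^sub>R i"] by linarith
    then have "x + h n *\<^sub>R i \<notin> K" "x \<notin> K" using False R by force+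
    then show ?thesis using False K(2) by (simp add: Q_def)
  qed
  have [measurable]: "Q n \<in> borel_measurable borel" for n unfolding Q_def by measurable
  have "(\<lambda>n. LINT x|lborel. Q n x) \<longlonglongrightarrow> (LINT x|lborel. F' x)"
  proof (rule integral_dominated_convergence[where w = "\<lambda>x. L * indicator (cball 0 (R + 1)) x"])
    show "F' \<in> borel_measurable lborel"
      by (rule borel_measurable_LIMSEQ_real[of _ Q]) (use lim in auto)
    show "integrable lborel (\<lambda>x. L * indicator (cball 0 (R + 1)) x)"
      using emeasure_lborel_cball_finite by (intro integrable_mult_right integrable_real_indicator) auto
  qed (use lim bnd in auto)
  moreover have "(LINT x|lborel. Q n x) = 0" for n
    using lborel_translation[OF F, of "h n *\<^sub>R i"] F by (simp add: Q_def)
  ultimately show ?thesis by (simp add: LIMSEQ_const_iff)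
qed

lemma moll_kernel_C1:
  fixes x i :: "'a::euclidean_space"
  shows "moll_kernel r differentiable (at x)"
  "continuous_on UNIV (\<lambda>x. frechet_derivative (moll_kernel r) (at x) i)"
proof -
  have "smooth_alg (moll_kernel r :: 'a \<Rightarrow> real)"
    unfolding moll_kernel_def divide_inverse using bump_translate_smooth[of r 0]
    by (intro smooth_mult smooth_const) simp
  then obtain f' where f': "\<forall>x. (moll_kernel r has_derivative f' x) (at x)" "\<forall>i::'a. smooth_alg (\<lambda>x. f' x i)"
    using smooth_alg_derivative by blast
  have eq: "frechet_derivative (moll_kernel r) (at x) = f' x" for x :: 'a
    using frechet_derivative_at[OF f'(1)[rule_format]] by simp
  show "moll_kernel r differentiable (at x)" using f' by (auto simp: differentiable_def)
  show "continuous_on UNIV (\<lambda>x. frechet_derivative (moll_kernel r) (at x) i)"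
    unfolding eq by (rule smooth_alg_C_k[of _ 0, simplified]) (use f'(2) in blast)
qed

lemma moll_kernel_test_function:
  fixes x :: "'a::euclidean_space"
  assumes "0 < r" "cball x r \<subseteq> \<Omega>"
  shows "(\<lambda>y. moll_kernel r (y - x)) \<in> test_functions \<Omega>"
proof -
  have "smooth_alg (\<lambda>y. moll_kernel r (y - x))"
    unfolding moll_kernel_def divide_inverse
    by (intro smooth_mult smooth_const bump_translate_smooth)
  then have "C_k k (\<lambda>y. moll_kernel r (y - x))" for k by (rule smooth_alg_C_k)
  moreover have "{y. moll_kernel r (y - x) \<noteq> 0} = {y. bump r (y - x) \<noteq> 0}"
    using bump_mass_pos[OF assms(1), where 'a='a] by (auto simp: moll_kernel_def)
  ultimately show ?thesis
    unfolding test_functions_def mem_Collect_eq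
    using assms(2) bump_support[OF assms(1), of x] by (metis compact_cball)
qed

text \<open>The derivative of \<open>mollify\<close> differentiates the kernel in \<open>x\<close>,
  the definition of a weak gradient differentiates a test function in \<open>y\<close>. The sign
  that appears here cancels the one in the definition of the weak gradient.\<close>

lemma frechet_derivative_moll_kernel_reflect:
  fixes x :: "'a::euclidean_space"
  shows "frechet_derivative (\<lambda>y. moll_kernel r (y - x)) (at y) i = - frechet_derivative (moll_kernel r) (at (x - y)) i"
proof -
  have k: "(moll_kernel r has_derivative frechet_derivative (moll_kernel r) (at (x - y))) (at (x - y))"
    using moll_kernel_C1(1) frechet_derivative_works by blast
  have "((\<lambda>y. x - y) has_derivative (\<lambda>h. - h)) (at y)" by (auto intro!: derivative_eq_intros)
  from has_derivative_compose[OF this k]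
  have "((\<lambda>y. moll_kernel r (x - y)) has_derivative (\<lambda>h. frechet_derivative (moll_kernel r) (at (x - y)) (- h))) (at y)" .
  then have "((\<lambda>y. moll_kernel r (y - x)) has_derivative (\<lambda>h. frechet_derivative (moll_kernel r) (at (x - y)) (- h))) (at y)"
    by (simp add: moll_kernel_sym[of r _ x])
  then have "frechet_derivative (\<lambda>y. moll_kernel r (y - x)) (at y) = (\<lambda>h. frechet_derivative (moll_kernel r) (at (x - y)) (- h))"
    using frechet_derivative_at by metis
  then show ?thesis
    using linear_frechet_derivative[OF moll_kernel_C1(1), of r "x - y"] by (simp add: linear_neg)
qed

lemma mollify_bounded:
  fixes f :: "'a::euclidean_space \<Rightarrow> real"
  assumes "0 < r" "integrable lborel f"
  obtains C where "\<And>x. \<bar>mollify r f x\<bar> \<le> C"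
proof -
  obtain C where C: "C > 0" "\<And>z. \<bar>moll_kernel r (z::'a)\<bar> \<le> C" using moll_kernel_bounded[OF assms(1)] by blast
  have "\<bar>mollify r f x\<bar> \<le> (LINT y|lborel. C * \<bar>f y\<bar>)" for x
    unfolding mollify_def
  proof (rule integral_abs_bound[THEN order_trans], rule integral_mono)
    show "integrable lborel (\<lambda>y. \<bar>moll_kernel r (x - y) * f y\<bar>)"
      using integrable_moll_kernel_mult[OF assms] by (rule integrable_abs)
    show "\<bar>moll_kernel r (x - y) * f y\<bar> \<le> C * \<bar>f y\<bar>" for y
      using C by (simp add: abs_mult mult_right_mono)
  qed (use assms in auto)
  then show ?thesis by (rule that)
qed

text \<open>Differentiation under the integral sign, with \<open>C * \<bar>f y\<bar>\<close> as
  majorant from the Lipschitz kernel. The two conclusions are what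
  \<open>integral_directional_derivative_eq_0\<close> asks of a mollified factor.\<close>

lemma mollify_directional_derivative:
  fixes f :: "'a::euclidean_space \<Rightarrow> real"
  assumes r: "0 < r" and f: "integrable lborel f"
  shows "((\<lambda>t. mollify r f (x + t *\<^sub>R i)) has_real_derivative
      (LINT y|lborel. frechet_derivative (moll_kernel r) (at (x - y)) i * f y)) (at 0)"
    and "\<exists>L. \<forall>x h. \<bar>mollify r f (x + h *\<^sub>R i) - mollify r f x\<bar> \<le> L * \<bar>h\<bar>"
proof -
  let ?k = "moll_kernel r :: 'a \<Rightarrow> real"
  have [measurable]: "f \<in> borel_measurable borel" using f by auto
  have z: "\<And>x. x \<notin> cball 0 r \<Longrightarrow> ?k x = 0" by (rule moll_kernel_eq_0[OF r]) simp
  obtain C where C: "C > 0" "\<And>x. \<bar>frechet_derivative ?k (at x) i\<bar> \<le> C"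
    "\<And>x h. \<bar>?k (x + h *\<^sub>R i) - ?k x\<bar> \<le> C * \<bar>h\<bar>"
    using compactly_supported_C1_lipschitz[OF moll_kernel_C1 compact_cball z] by blast
  have diff: "mollify r f (x + h *\<^sub>R i) - mollify r f x = (LINT y|lborel. (?k (x - y + h *\<^sub>R i) - ?k (x - y)) * f y)" for x h
    unfolding mollify_def left_diff_distrib
    using integrable_moll_kernel_mult[OF r f, of x] integrable_moll_kernel_mult[OF r f, of "x + h *\<^sub>R i"]
    by (subst Bochner_Integration.integral_diff) (auto simp: algebra_simps)
  have idiff: "integrable lborel (\<lambda>y. (?k (x - y + h *\<^sub>R i) - ?k (x - y)) * f y)" for x h
    unfolding left_diff_distrib
    using integrable_moll_kernel_mult[OF r f, of x] integrable_moll_kernel_mult[OF r f, of "x + h *\<^sub>R i"]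
    by (auto simp: algebra_simps)
  have "\<bar>mollify r f (x + h *\<^sub>R i) - mollify r f x\<bar> \<le> (C * (LINT y|lborel. \<bar>f y\<bar>)) * \<bar>h\<bar>" for x h
  proof -
    have "\<bar>mollify r f (x + h *\<^sub>R i) - mollify r f x\<bar> \<le> (LINT y|lborel. (C * \<bar>h\<bar>) * \<bar>f y\<bar>)"
      unfolding diff
    proof (rule integral_abs_bound[THEN order_trans], rule integral_mono)
      show "integrable lborel (\<lambda>y. \<bar>(?k (x - y + h *\<^sub>R i) - ?k (x - y)) * f y\<bar>)"
        using idiff by (rule integrable_abs)
      show "\<bar>(?k (x - y + h *\<^sub>R i) - ?k (x - y)) * f y\<bar> \<le> C * \<bar>h\<bar> * \<bar>f y\<bar>" for y
        using C(3) by (simp add: abs_mult mult_right_mono)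
    qed (use f in auto)
    then show ?thesis by (simp add: mult_ac)
  qed
  then show "\<exists>L. \<forall>x h. \<bar>mollify r f (x + h *\<^sub>R i) - mollify r f x\<bar> \<le> L * \<bar>h\<bar>" by blast
  show "((\<lambda>t. mollify r f (x + t *\<^sub>R i)) has_real_derivative
      (LINT y|lborel. frechet_derivative ?k (at (x - y)) i * f y)) (at 0)"
    unfolding DERIV_def tendsto_at_iff_sequentially o_def
  proof (intro allI impI)
    fix h :: "nat \<Rightarrow> real" assume h: "\<forall>n. h n \<in> UNIV - {0}" "h \<longlonglongrightarrow> 0"
    then have h0: "h n \<noteq> 0" for n by auto
    have hat: "filterlim h (at 0) sequentially"
      unfolding filterlim_at using h by auto
    have lim: "(\<lambda>n. (?k (x - y + h n *\<^sub>R i) - ?k (x - y)) / h n * f y) \<longlonglongrightarrow>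
        frechet_derivative ?k (at (x - y)) i * f y" for y
    proof -
      have D: "((\<lambda>t. ?k (x - y + t *\<^sub>R i)) has_real_derivative frechet_derivative ?k (at (x - y)) i) (at 0)"
        using has_real_derivative_along_line[of ?k "x - y" 0 i] moll_kernel_C1(1)[of r "x - y"] by simp
      show ?thesis using filterlim_compose[OF D[unfolded DERIV_def] hat] by (intro tendsto_mult) auto
    qed
    have "(\<lambda>n. LINT y|lborel. (?k (x - y + h n *\<^sub>R i) - ?k (x - y)) / h n * f y) \<longlonglongrightarrow>
        (LINT y|lborel. frechet_derivative ?k (at (x - y)) i * f y)"
    proof (rule integral_dominated_convergence[where w = "\<lambda>y. C * \<bar>f y\<bar>"])
      show "AE y in lborel. norm ((?k (x - y + h n *\<^sub>R i) - ?k (x - y)) / h n * f y) \<le> C * \<bar>f y\<bar>" for n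
      proof (rule AE_I2)
        fix y
        show "norm ((?k (x - y + h n *\<^sub>R i) - ?k (x - y)) / h n * f y) \<le> C * \<bar>f y\<bar>"
          using mult_right_mono[OF C(3)[of "x - y" "h n"], of "\<bar>f y\<bar>"] h0[of n]
          by (simp add: abs_mult divide_le_eq mult_ac)
      qed
      show "(\<lambda>y. frechet_derivative ?k (at (x - y)) i * f y) \<in> borel_measurable lborel"
        by (rule borel_measurable_LIMSEQ_real[OF lim]) measurable
    qed (use f lim in auto)
    moreover have "(LINT y|lborel. (?k (x - y + h n *\<^sub>R i) - ?k (x - y)) / h n * f y) =
        (mollify r f (x + (0 + h n) *\<^sub>R i) - mollify r f (x + 0 *\<^sub>R i)) / h n" for n
      by (simp add: diff integral_divide_zero[symmetric] del: integral_divide_zero)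
    ultimately show "(\<lambda>n. (mollify r f (x + (0 + h n) *\<^sub>R i) - mollify r f (x + 0 *\<^sub>R i)) / h n) \<longlonglongrightarrow>
        (LINT y|lborel. frechet_derivative ?k (at (x - y)) i * f y)"
      by (simp only:)
  qed
qed

section \<open>Chain rule and truncation for weak gradients\<close>

lemma integral_lebesgue_on_supported:
  fixes f D :: "'a::euclidean_space \<Rightarrow> real"
  assumes "\<Omega> \<in> sets lebesgue" "K \<subseteq> \<Omega>" "\<And>x. x \<notin> K \<Longrightarrow> D x = 0"
  shows "(LINT x|lebesgue_on \<Omega>. f x * D x) = (LINT x|lebesgue. (indicator K x * f x) * D x)"
proof -
  have "(LINT x|lebesgue_on \<Omega>. f x * D x) = (LINT x|lebesgue. indicator \<Omega> x *\<^sub>R (f x * D x))"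
    using assms by (intro integral_restrict_space) auto
  also have "\<dots> = (LINT x|lebesgue. (indicator K x * f x) * D x)"
    using assms by (intro Bochner_Integration.integral_cong) (auto simp: indicator_def)
  finally show ?thesis .
qed

text \<open>Translations and Fubini are applied over \<open>lborel\<close>, whereas weak gradients
  are integrated over \<open>lebesgue\<close>; an almost everywhere equal Borel function
  mediates.\<close>

lemma borel_integrable_version:
  fixes f :: "'a::euclidean_space \<Rightarrow> real"
  assumes "integrable lebesgue f"
  obtains g where "integrable lborel g" "AE x in lebesgue. f x = g x"
proof -
  obtain g where g: "g \<in> borel_measurable lborel" "AE x in lborel. f x = g x"
    using completion_ex_borel_measurable_real[of f lborel] assms by auto
  have ae: "AE x in lebesgue. f x = g x" using g(2) by (rule AE_completion)
  have gm: "g \<in> borel_measurable lebesgue" using measurable_completion[OF g(1)] .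
  have "integrable lebesgue g"
    using assms ae gm by (subst integrable_cong_AE[symmetric]) auto
  then have "integrable lborel g" using integrable_completion[OF g(1)] by simp
  then show ?thesis using ae that by blast
qed

lemma integral_lebesgue_mult_version:
  fixes f g D :: "'a::euclidean_space \<Rightarrow> real"
  assumes "integrable lebesgue f" "integrable lborel g" "AE x in lebesgue. f x = g x" and [measurable]: "D \<in> borel_measurable borel"
  shows "(LINT x|lebesgue. f x * D x) = (LINT x|lborel. g x * D x)"
proof -
  have [measurable]: "g \<in> borel_measurable borel" "D \<in> borel_measurable lebesgue" "f \<in> borel_measurable lebesgue"
      "g \<in> borel_measurable lebesgue"
    using assms by (auto intro: measurable_completion)
  have "(LINT x|lebesgue. f x * D x) = (LINT x|lebesgue. g x * D x)"
    using assms(3) by (intro integral_cong_AE) auto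
  also have "\<dots> = (LINT x|lborel. g x * D x)"
    by (rule integral_completion) auto
  finally show ?thesis .
qed

text \<open>The margin \<open>d\<close> is room for the mollifier: if \<open>x \<in> K\<close> and
  the radius is at most \<open>d\<close>, the kernel around \<open>x\<close> lives in
  \<open>K'\<close>, where \<open>u\<close> will not have been cut off.\<close>

lemma compact_neighbourhood:
  fixes K :: "'a::euclidean_space set"
  assumes "compact K" "open \<Omega>" "K \<subseteq> \<Omega>"
  obtains d K' where "d > 0" "compact K'" "K' \<subseteq> \<Omega>" "K \<subseteq> K'" "\<And>x. x \<in> K \<Longrightarrow> cball x d \<subseteq> K'"
proof -
  obtain d where d: "d > 0" "(\<Union>x\<in>K. cball x d) \<subseteq> \<Omega>"
    using compact_subset_open_imp_cball_epsilon_subset[OF assms] by auto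
  have eq: "(\<Union>x\<in>K. cball x d) = {x + y |x y. x \<in> K \<and> y \<in> cball 0 d}"
  proof safe
    fix x z assume "x \<in> K" "z \<in> cball x d"
    then show "\<exists>x' y. z = x' + y \<and> x' \<in> K \<and> y \<in> cball 0 d"
      by (intro exI[of _ x] exI[of _ "z - x"]) (auto simp: dist_norm norm_minus_commute)
  next
    fix x and y :: 'a assume "x \<in> K" "y \<in> cball 0 d"
    then show "x + y \<in> (\<Union>x\<in>K. cball x d)" by (intro UN_I[of x]) (auto simp: dist_norm)
  qed
  have "compact (\<Union>x\<in>K. cball x d)" unfolding eq by (intro compact_sums assms compact_cball)
  then show ?thesis using that[of d "\<Union>x\<in>K. cball x d"] d by force
qed

text \<open>A common sequence of radii serves a function and its partial derivative at once.
  Convergence almost everywhere, obtained from a subsequence, is asked for the first one only, which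
  is the one to be inserted into a continuous function.\<close>

lemma mollify_sequence:
  fixes f g :: "'a::euclidean_space \<Rightarrow> real"
  assumes f: "integrable lborel f" and g: "integrable lborel g" and d: "0 < d"
  obtains r where "\<And>n. 0 < r n" "\<And>n. r n < d" "(\<lambda>n::nat. LINT x|lborel. \<bar>mollify (r n) f x - f x\<bar>) \<longlonglongrightarrow> 0"
    "(\<lambda>n. LINT x|lborel. \<bar>mollify (r n) g x - g x\<bar>) \<longlonglongrightarrow> 0" "AE x in lborel. (\<lambda>n. mollify (r n) f x) \<longlonglongrightarrow> f x"
proof -
  have "\<exists>r. 0 < r \<and> r < d \<and> (LINT x|lborel. \<bar>mollify r f x - f x\<bar>) < 1 / real (Suc n)
      \<and> (LINT x|lborel. \<bar>mollify r g x - g x\<bar>) < 1 / real (Suc n)" for n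
  proof -
    have p: "0 < 1 / real (Suc n)" by simp
    obtain r1 where r1: "0 < r1" "\<And>r. 0 < r \<Longrightarrow> r < r1 \<Longrightarrow> (LINT x|lborel. \<bar>mollify r f x - f x\<bar>) < 1 / real (Suc n)"
      using mollify_L1_tendsto[OF f p] by blast
    obtain r2 where r2: "0 < r2" "\<And>r. 0 < r \<Longrightarrow> r < r2 \<Longrightarrow> (LINT x|lborel. \<bar>mollify r g x - g x\<bar>) < 1 / real (Suc n)"
      using mollify_L1_tendsto[OF g p] by blast
    have "0 < min d (min r1 r2)" using r1(1) r2(1) d by simp
    then obtain q where "0 < q" "q < min d (min r1 r2)" using dense by blast
    then show ?thesis using r1(2)[of q] r2(2)[of q] by (intro exI[of _ q]) simp
  qed
  then have "\<forall>n. \<exists>r. 0 < r \<and> r < d \<and> (LINT x|lborel. \<bar>mollify r f x - f x\<bar>) < 1 / real (Suc n)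
      \<and> (LINT x|lborel. \<bar>mollify r g x - g x\<bar>) < 1 / real (Suc n)" by blast
  from choice[OF this] obtain r where r: "\<And>n. 0 < r n" "\<And>n. r n < d" "\<And>n. (LINT x|lborel. \<bar>mollify (r n) f x - f x\<bar>) < 1 / real (Suc n)"
      "\<And>n. (LINT x|lborel. \<bar>mollify (r n) g x - g x\<bar>) < 1 / real (Suc n)" by blast
  have inv0: "(\<lambda>n. 1 / real (Suc n)) \<longlonglongrightarrow> 0" by (rule LIMSEQ_Suc[OF lim_1_over_n])
  have F0: "(\<lambda>n. LINT x|lborel. \<bar>mollify (r n) f x - f x\<bar>) \<longlonglongrightarrow> 0"
    by (rule tendsto_sandwich[OF _ _ tendsto_const inv0]) (use r(3) in \<open>auto intro!: always_eventually less_imp_le\<close>)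
  have G0: "(\<lambda>n. LINT x|lborel. \<bar>mollify (r n) g x - g x\<bar>) \<longlonglongrightarrow> 0"
    by (rule tendsto_sandwich[OF _ _ tendsto_const inv0]) (use r(4) in \<open>auto intro!: always_eventually less_imp_le\<close>)
  have int: "integrable lborel (\<lambda>x. mollify (r n) f x - f x)" for n
    using integrable_mollify[OF r(1) f] f by auto
  obtain s where s: "strict_mono s" "AE x in lborel. (\<lambda>n. mollify (r (s n)) f x - f x) \<longlonglongrightarrow> 0"
    using tendsto_L1_AE_subseq[of lborel "\<lambda>n x. mollify (r n) f x - f x", OF int] F0 by (auto simp only: real_norm_def)
  show ?thesis
  proof (rule that[of "\<lambda>n. r (s n)"])
    show "AE x in lborel. (\<lambda>n. mollify (r (s n)) f x) \<longlonglongrightarrow> f x"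
      using s(2) by eventually_elim (simp add: LIM_zero_iff)
  qed (use r LIMSEQ_subseq_LIMSEQ[OF F0 s(1)] LIMSEQ_subseq_LIMSEQ[OF G0 s(1)] in \<open>auto simp: o_def\<close>)
qed

lemma integral_tendsto_of_L1:
  fixes f :: "'a \<Rightarrow> real"
  assumes "\<And>n. integrable M (s n)" "integrable M f" "\<And>n. (LINT x|M. \<bar>s n x - f x\<bar>) \<le> B n" "B \<longlonglongrightarrow> 0"
  shows "(\<lambda>n. LINT x|M. s n x) \<longlonglongrightarrow> (LINT x|M. f x)"
proof -
  have "\<bar>(LINT x|M. s n x) - (LINT x|M. f x)\<bar> \<le> B n" for n
  proof -
    have "(LINT x|M. s n x) - (LINT x|M. f x) = (LINT x|M. s n x - f x)"
      using assms(1,2) by (simp add: Bochner_Integration.integral_diff)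
    then show ?thesis using integral_abs_bound[of M "\<lambda>x. s n x - f x"] assms(3)[of n] by linarith
  qed
  then have "(\<lambda>n. (LINT x|M. s n x) - (LINT x|M. f x)) \<longlonglongrightarrow> 0"
    by (intro Lim_null_comparison[OF _ assms(4)]) (auto intro!: always_eventually)
  then show ?thesis by (simp add: LIM_zero_iff)
qed

lemma locally_integrable_component:
  assumes "locally_integrable \<Omega> G"
  shows "locally_integrable \<Omega> (\<lambda>x. G x \<bullet> i)"
  using assms unfolding locally_integrable_def set_integrable_def
  by (auto simp flip: inner_scaleR_left intro!: integrable_inner_left)

text \<open>The translated kernel is a test function, so the definition of the weak gradient itself
  says that differentiation commutes with mollification wherever the ball of radius \<open>r\<close>
  stays in \<open>K'\<close>.\<close>

lemma weak_gradient_mollify_identity: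
  fixes u :: "'a::euclidean_space \<Rightarrow> real"
  assumes wg: "has_weak_gradient \<Omega> u G" and \<Omega>: "\<Omega> \<in> sets lebesgue" and i: "i \<in> Basis"
    and K': "compact K'" "K' \<subseteq> \<Omega>" and r: "0 < r" and x: "cball x r \<subseteq> K'"
    and u': "integrable lborel u'" "AE x in lebesgue. indicator K' x * u x = u' x"
    and g': "integrable lborel g'" "AE x in lebesgue. indicator K' x * (G x \<bullet> i) = g' x"
  shows "(LINT y|lborel. frechet_derivative (moll_kernel r) (at (x - y)) i * u' y) = mollify r g' x"
proof -
  let ?\<phi> = "\<lambda>y. moll_kernel r (y - x)"
  have tf: "?\<phi> \<in> test_functions \<Omega>" using moll_kernel_test_function[OF r] x K'(2) by blast
  have iu: "integrable lebesgue (\<lambda>x. indicator K' x * u x)" "integrable lebesgue (\<lambda>x. indicator K' x * (G x \<bullet> i))"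
    using wg locally_integrable_component[of \<Omega> G i] K'
    unfolding has_weak_gradient_def locally_integrable_def set_integrable_def by auto
  have z: "y \<notin> K' \<Longrightarrow> ?\<phi> y = 0" for y
  proof -
    assume "y \<notin> K'"
    then have "y \<notin> cball x r" using x by blast
    then show ?thesis using r by (intro moll_kernel_eq_0) (auto simp: dist_norm norm_minus_commute)
  qed
  have dz: "y \<notin> K' \<Longrightarrow> frechet_derivative ?\<phi> (at y) i = 0" for y
    by (rule frechet_derivative_eq_0_outside[OF compact_imp_closed[OF K'(1)] z])
  have [measurable]: "?\<phi> \<in> borel_measurable borel" "(\<lambda>y. frechet_derivative ?\<phi> (at y) i) \<in> borel_measurable borel"
    using test_functionD(2)[OF tf] test_functionD(3)[OF tf i] by (auto intro: borel_measurable_continuous_onI)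
  have "(LINT y|lborel. frechet_derivative (moll_kernel r) (at (x - y)) i * u' y)
      = - (LINT y|lborel. u' y * frechet_derivative ?\<phi> (at y) i)"
    by (simp add: frechet_derivative_moll_kernel_reflect mult.commute)
  also have "(LINT y|lborel. u' y * frechet_derivative ?\<phi> (at y) i) = (LINT y|lebesgue_on \<Omega>. u y * frechet_derivative ?\<phi> (at y) i)"
    by (subst integral_lebesgue_on_supported[OF \<Omega> K'(2) dz], assumption,
        subst integral_lebesgue_mult_version[OF iu(1) u']) auto
  also have "\<dots> = - (LINT y|lebesgue_on \<Omega>. (G y \<bullet> i) * ?\<phi> y)"
    using wg tf i unfolding has_weak_gradient_def by blast
  also have "(LINT y|lebesgue_on \<Omega>. (G y \<bullet> i) * ?\<phi> y) = (LINT y|lborel. g' y * ?\<phi> y)"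
    by (subst integral_lebesgue_on_supported[OF \<Omega> K'(2) z], assumption,
        subst integral_lebesgue_mult_version[OF iu(2) g']) auto
  also have "\<dots> = mollify r g' x"
    unfolding mollify_def by (simp add: moll_kernel_sym[of r x] mult.commute)
  finally show ?thesis by simp
qed

text \<open>For the mollifications \<open>U n\<close> of \<open>u\<close> the product
  \<open>S (U n x) * \<phi> x\<close> is Lipschitz along \<open>i\<close> with compact support, so
  its derivative integrates to 0. The identity for \<open>u\<close> is the limit of these.\<close>

lemma has_weak_gradient_chain_identity:
  fixes u :: "'a::euclidean_space \<Rightarrow> real"
  assumes wg: "has_weak_gradient \<Omega> u G" and \<Omega>: "open \<Omega>" and i: "i \<in> Basis"
    and S: "\<And>t. (S has_real_derivative S' t) (at t)" "continuous_on UNIV S'" "\<And>t. \<bar>S' t\<bar> \<le> L"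
    and tf: "\<phi> \<in> test_functions \<Omega>"
  shows "(LINT x|lebesgue_on \<Omega>. S (u x) * frechet_derivative \<phi> (at x) i) =
        - (LINT x|lebesgue_on \<Omega>. (S' (u x) *\<^sub>R G x \<bullet> i) * \<phi> x)"
proof -
  have \<Omega>m: "\<Omega> \<in> sets lebesgue" using \<Omega> by (simp add: lmeasurable_open sets_completionI_sets)
  define K where "K = closure {x. \<phi> x \<noteq> 0}"
  define D\<phi> where "D\<phi> x = frechet_derivative \<phi> (at x) i" for x
  note T = test_functionD(1,2)[OF tf] test_functionD(3)[OF tf, where i=i, folded D\<phi>_def]
    test_functionD(4,5,6)[OF tf, folded K_def] test_functionD(7)[OF tf, where i=i, folded K_def D\<phi>_def]
  obtain d K' where K': "d > 0" "compact K'" "K' \<subseteq> \<Omega>" "K \<subseteq> K'" "\<And>x. x \<in> K \<Longrightarrow> cball x d \<subseteq> K'"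
    using compact_neighbourhood[OF T(4) \<Omega> T(5)] by blast
  \<comment> \<open>\<open>u\<close> and \<open>G\<close> are only locally integrable; cut off by
    \<open>K'\<close> they become integrable on the whole space and can be mollified. At points of
    \<open>K\<close> the mollifier does not see the cut-off.\<close>
  have iu: "integrable lebesgue (\<lambda>x. indicator K' x * u x)" "integrable lebesgue (\<lambda>x. indicator K' x * (G x \<bullet> i))"
    using wg locally_integrable_component[of \<Omega> G i] K'
    unfolding has_weak_gradient_def locally_integrable_def set_integrable_def by auto
  obtain u' where u': "integrable lborel u'" "AE x in lebesgue. indicator K' x * u x = u' x"
    using borel_integrable_version[OF iu(1)] by blast
  obtain g' where g': "integrable lborel g'" "AE x in lebesgue. indicator K' x * (G x \<bullet> i) = g' x"
    using borel_integrable_version[OF iu(2)] by blast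
  obtain r where r: "\<And>n. 0 < r n" "\<And>n. r n < d" "(\<lambda>n::nat. LINT x|lborel. \<bar>mollify (r n) u' x - u' x\<bar>) \<longlonglongrightarrow> 0"
    "(\<lambda>n. LINT x|lborel. \<bar>mollify (r n) g' x - g' x\<bar>) \<longlonglongrightarrow> 0" "AE x in lborel. (\<lambda>n. mollify (r n) u' x) \<longlonglongrightarrow> u' x"
    using mollify_sequence[OF u'(1) g'(1) K'(1)] by blast
  define U where "U n = mollify (r n) u'" for n
  define V where "V n = mollify (r n) g'" for n
  obtain B1 where B1: "B1 > 0" "\<And>x. \<bar>\<phi> x\<bar> \<le> B1"
    using compactly_supported_bounded[OF T(2,4,6)] by blast
  obtain B2 where B2: "B2 > 0" "\<And>x. \<bar>D\<phi> x\<bar> \<le> B2" "\<And>x h. \<bar>\<phi> (x + h *\<^sub>R i) - \<phi> x\<bar> \<le> B2 * \<bar>h\<bar>"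
    using compactly_supported_C1_lipschitz[OF T(1) _ T(4,6), of i] T(3)[OF i] unfolding D\<phi>_def by blast
  have L0: "L \<ge> 0" using S(3)[of 0] by simp
  have Slip: "\<bar>S a - S b\<bar> \<le> L * \<bar>a - b\<bar>" for a b
    using field_differentiable_bound[of UNIV S S' L a b] S(1,3) by auto
  have contS: "continuous_on UNIV S" using S(1) by (meson DERIV_isCont continuous_at_imp_continuous_on)
  have [measurable]: "S \<in> borel_measurable borel" "S' \<in> borel_measurable borel" "\<phi> \<in> borel_measurable borel" "D\<phi> \<in> borel_measurable borel"
    "u' \<in> borel_measurable borel" "g' \<in> borel_measurable borel"
    using contS S(2) T(2) T(3)[OF i] u' g' by (auto intro: borel_measurable_continuous_onI)
  have [measurable]: "U n \<in> borel_measurable borel" "V n \<in> borel_measurable borel" for n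
    unfolding U_def V_def by auto
  have iUV: "integrable lborel (U n)" "integrable lborel (V n)" for n
    unfolding U_def V_def using integrable_mollify[OF r(1)] u' g' by auto
  have iK: "integrable lborel (\<lambda>x. c * indicator K x :: real)" for c
    using emeasure_compact_finite[OF T(4)] T(4)
    by (intro integrable_mult_right integrable_real_indicator) (auto simp: compact_imp_closed)
  have Sbd: "\<bar>S a\<bar> \<le> \<bar>S 0\<bar> + L * \<bar>a\<bar>" for a using Slip[of a 0] abs_triangle_ineq2[of "S a" "S 0"] by simp
  have iSD: "integrable lborel (\<lambda>x. S (w x) * D\<phi> x)" if w: "integrable lborel w" for w
  proof (rule Bochner_Integration.integrable_bound[of _ "\<lambda>x. (\<bar>S 0\<bar> * B2) * indicator K x + (L * B2) * \<bar>w x\<bar>"])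
    show "integrable lborel (\<lambda>x. \<bar>S 0\<bar> * B2 * indicator K x + L * B2 * \<bar>w x\<bar>)"
      using w iK by (intro Bochner_Integration.integrable_add) auto
    have [measurable]: "w \<in> borel_measurable borel" using w by auto
    show "(\<lambda>x. S (w x) * D\<phi> x) \<in> borel_measurable lborel" by measurable
    have "\<bar>S (w x) * D\<phi> x\<bar> \<le> \<bar>S 0\<bar> * B2 * indicator K x + L * B2 * \<bar>w x\<bar>" for x
    proof (cases "x \<in> K")
      case True
      have "\<bar>S (w x) * D\<phi> x\<bar> \<le> (\<bar>S 0\<bar> + L * \<bar>w x\<bar>) * B2"
        unfolding abs_mult using Sbd[of "w x"] B2 L0 by (intro mult_mono) auto
      then show ?thesis using True by (simp add: algebra_simps)
    qed (use T(7) L0 B2 in auto)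
    then show "AE x in lborel. norm (S (w x) * D\<phi> x) \<le> norm (\<bar>S 0\<bar> * B2 * indicator K x + L * B2 * \<bar>w x\<bar>)"
      by (intro AE_I2) (metis abs_ge_self order_trans real_norm_def)
  qed
  have iS'V: "integrable lborel (\<lambda>x. S' (w x) * v x * \<phi> x)"
    if [measurable]: "w \<in> borel_measurable borel" and v: "integrable lborel v" for w v
  proof (rule Bochner_Integration.integrable_bound[of _ "\<lambda>x. (L * B1) * v x"])
    have [measurable]: "v \<in> borel_measurable borel" using v by auto
    show "(\<lambda>x. S' (w x) * v x * \<phi> x) \<in> borel_measurable lborel" by measurable
    have "\<bar>S' (w x)\<bar> * \<bar>v x\<bar> * \<bar>\<phi> x\<bar> \<le> L * \<bar>v x\<bar> * B1" for x
      using S(3) B1 L0 by (intro mult_mono) auto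
    then show "AE x in lborel. norm (S' (w x) * v x * \<phi> x) \<le> norm (L * B1 * v x)"
      using L0 B1 by (simp add: abs_mult mult_ac)
  qed (use v in auto)
  have zero: "(LINT x|lborel. S (U n x) * D\<phi> x) + (LINT x|lborel. S' (U n x) * V n x * \<phi> x) = 0" for n
  proof -
    let ?DU = "\<lambda>x. LINT y|lborel. frechet_derivative (moll_kernel (r n)) (at (x - y)) i * u' y"
    obtain LU where LU: "\<And>x h. \<bar>U n (x + h *\<^sub>R i) - U n x\<bar> \<le> LU * \<bar>h\<bar>"
      using mollify_directional_derivative(2)[OF r(1)[of n] u'(1), of i] unfolding U_def by blast
    obtain M where M: "\<And>x. \<bar>U n x\<bar> \<le> M" using mollify_bounded[OF r(1)[of n] u'(1)] unfolding U_def by blast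
    have M0: "M \<ge> 0" using M[of 0] by linarith
    have LU0: "LU \<ge> 0" using LU[of 0 1] by simp
    have "(LINT x|lborel. S (U n x) * D\<phi> x + S' (U n x) * ?DU x * \<phi> x) = 0"
    \<comment> \<open>The Lipschitz constant of a product: the bound of \<open>S (U n x)\<close>
      times the Lipschitz constant of \<open>\<phi>\<close>, plus the Lipschitz constant of
      \<open>S (U n x)\<close> times the bound of \<open>\<phi>\<close>.\<close>
    proof (rule integral_directional_derivative_eq_0[of "\<lambda>x. S (U n x) * \<phi> x" i _ "(\<bar>S 0\<bar> + L * M) * B2 + L * LU * B1" K])
      fix x
      have "((\<lambda>t. U n (x + t *\<^sub>R i)) has_real_derivative ?DU x) (at 0)"
        unfolding U_def by (rule mollify_directional_derivative(1)[OF r(1) u'(1)])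
      from DERIV_chain2[of S, OF _ this] S(1)
      have a: "((\<lambda>t. S (U n (x + t *\<^sub>R i))) has_real_derivative S' (U n x) * ?DU x) (at 0)" by simp
      have b: "((\<lambda>t. \<phi> (x + t *\<^sub>R i)) has_real_derivative D\<phi> x) (at 0)"
        using has_real_derivative_along_line[of \<phi> x 0 i] T(1)[of x] by (simp add: D\<phi>_def)
      show "((\<lambda>t. S (U n (x + t *\<^sub>R i)) * \<phi> (x + t *\<^sub>R i)) has_real_derivative
          S (U n x) * D\<phi> x + S' (U n x) * ?DU x * \<phi> x) (at 0)"
        using DERIV_mult[OF a b] by (simp add: algebra_simps)
      fix h
      have "\<bar>S (U n (x + h *\<^sub>R i)) * \<phi> (x + h *\<^sub>R i) - S (U n x) * \<phi> x\<bar> =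
         \<bar>S (U n (x + h *\<^sub>R i)) * (\<phi> (x + h *\<^sub>R i) - \<phi> x) + (S (U n (x + h *\<^sub>R i)) - S (U n x)) * \<phi> x\<bar>"
        by (simp add: algebra_simps)
      also have "\<dots> \<le> \<bar>S (U n (x + h *\<^sub>R i))\<bar> * \<bar>\<phi> (x + h *\<^sub>R i) - \<phi> x\<bar> + \<bar>S (U n (x + h *\<^sub>R i)) - S (U n x)\<bar> * \<bar>\<phi> x\<bar>"
        by (rule order_trans[OF abs_triangle_ineq]) (simp add: abs_mult)
      also have "\<dots> \<le> (\<bar>S 0\<bar> + L * M) * (B2 * \<bar>h\<bar>) + (L * (LU * \<bar>h\<bar>)) * B1"
      proof (intro add_mono mult_mono)
        show "\<bar>S (U n (x + h *\<^sub>R i))\<bar> \<le> \<bar>S 0\<bar> + L * M"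
          using Sbd[of "U n (x + h *\<^sub>R i)"] mult_left_mono[OF M[of "x + h *\<^sub>R i"] L0] by linarith
        show "\<bar>S (U n (x + h *\<^sub>R i)) - S (U n x)\<bar> \<le> L * (LU * \<bar>h\<bar>)"
          using Slip[of "U n (x + h *\<^sub>R i)" "U n x"] mult_left_mono[OF LU[of x h] L0] by linarith
      qed (use B1 B2 L0 M0 LU0 in auto)
      finally show "\<bar>S (U n (x + h *\<^sub>R i)) * \<phi> (x + h *\<^sub>R i) - S (U n x) * \<phi> x\<bar> \<le> ((\<bar>S 0\<bar> + L * M) * B2 + L * LU * B1) * \<bar>h\<bar>"
        by (simp add: algebra_simps)
    next
      show "integrable lborel (\<lambda>x. S (U n x) * \<phi> x)"
      proof (rule Bochner_Integration.integrable_bound[OF iK[of "(\<bar>S 0\<bar> + L * M) * B1"]])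
        have "\<bar>S (U n x) * \<phi> x\<bar> \<le> (\<bar>S 0\<bar> + L * M) * B1 * indicator K x" for x
        proof (cases "x \<in> K")
          case True
          have "\<bar>S (U n x) * \<phi> x\<bar> \<le> (\<bar>S 0\<bar> + L * M) * B1"
            unfolding abs_mult using Sbd[of "U n x"] mult_left_mono[OF M[of x] L0] B1 L0 M0 by (intro mult_mono) auto
          then show ?thesis using True by simp
        qed (use T(6) in auto)
        then show "AE x in lborel. norm (S (U n x) * \<phi> x) \<le> norm ((\<bar>S 0\<bar> + L * M) * B1 * indicator K x)"
          by (intro AE_I2) (metis abs_ge_self order_trans real_norm_def)
      qed measurable
    qed (use T(4,6) i in \<open>auto simp: compact_imp_bounded\<close>)
    \<comment> \<open>The derivative of the mollification is known to be the mollification of the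
      derivative on \<open>K\<close>; elsewhere \<open>\<phi>\<close> vanishes.\<close>
    also have "(\<lambda>x. S (U n x) * D\<phi> x + S' (U n x) * ?DU x * \<phi> x) = (\<lambda>x. S (U n x) * D\<phi> x + S' (U n x) * V n x * \<phi> x)"
    proof
      fix x
      show "S (U n x) * D\<phi> x + S' (U n x) * ?DU x * \<phi> x = S (U n x) * D\<phi> x + S' (U n x) * V n x * \<phi> x"
      proof (cases "x \<in> K")
        case True
        then have "cball x (r n) \<subseteq> K'" using K'(5)[OF True] r(2)[of n] by (meson less_imp_le order_trans subset_cball)
        then have "?DU x = V n x"
          unfolding V_def by (intro weak_gradient_mollify_identity[OF wg \<Omega>m i K'(2,3) r(1) _ u' g'])
        then show ?thesis by simp
      qed (use T(6) in simp)
    qed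
    finally show ?thesis
      using iSD[OF iUV(1)[of n]] iS'V[OF _ iUV(2)[of n], of "U n"] by simp
  qed
  have lim1: "(\<lambda>n. LINT x|lborel. S (U n x) * D\<phi> x) \<longlonglongrightarrow> (LINT x|lborel. S (u' x) * D\<phi> x)"
  proof (rule integral_tendsto_of_L1[where B = "\<lambda>n. (L * B2) * (LINT x|lborel. \<bar>U n x - u' x\<bar>)"])
    show "(\<lambda>n. (L * B2) * (LINT x|lborel. \<bar>U n x - u' x\<bar>)) \<longlonglongrightarrow> 0"
      using tendsto_mult_left[OF r(3), of "L * B2"] by (simp add: U_def)
    fix n
    have "(LINT x|lborel. \<bar>S (U n x) * D\<phi> x - S (u' x) * D\<phi> x\<bar>) \<le> (LINT x|lborel. (L * B2) * \<bar>U n x - u' x\<bar>)"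
    proof (rule integral_mono)
      show "integrable lborel (\<lambda>x. \<bar>S (U n x) * D\<phi> x - S (u' x) * D\<phi> x\<bar>)"
        by (intro integrable_abs Bochner_Integration.integrable_diff iSD iUV u')
      show "\<bar>S (U n x) * D\<phi> x - S (u' x) * D\<phi> x\<bar> \<le> L * B2 * \<bar>U n x - u' x\<bar>" for x
      proof -
        have "\<bar>S (U n x) - S (u' x)\<bar> * \<bar>D\<phi> x\<bar> \<le> (L * \<bar>U n x - u' x\<bar>) * B2"
          using Slip B2 L0 by (intro mult_mono) auto
        then show ?thesis by (simp only: left_diff_distrib[symmetric] abs_mult) (simp add: mult_ac)
      qed
    qed (use iUV u' in auto)
    then show "(LINT x|lborel. \<bar>S (U n x) * D\<phi> x - S (u' x) * D\<phi> x\<bar>) \<le> (L * B2) * (LINT x|lborel. \<bar>U n x - u' x\<bar>)"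
      by simp
  qed (use iSD iUV u' in auto)
  \<comment> \<open>\<open>V n\<close> converges in L1, but \<open>S' (U n x)\<close> only boundedly
    and almost everywhere. So the product is split: one part goes to 0 by the L1 convergence of
    \<open>V n\<close>, the other, with the fixed \<open>g'\<close>, is dominated.\<close>
  have lim2: "(\<lambda>n. (LINT x|lborel. S' (U n x) * (V n x - g' x) * \<phi> x)) \<longlonglongrightarrow> (LINT x|(lborel::'a measure). 0)"
  proof (rule integral_tendsto_of_L1[where B = "\<lambda>n. (L * B1) * (LINT x|lborel. \<bar>V n x - g' x\<bar>)"])
    show "(\<lambda>n. (L * B1) * (LINT x|lborel. \<bar>V n x - g' x\<bar>)) \<longlonglongrightarrow> 0"
      using tendsto_mult_left[OF r(4), of "L * B1"] by (simp add: V_def)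
    have dd: "integrable lborel (\<lambda>x. V n x - g' x)" for n using iUV g' by auto
    show i1: "integrable lborel (\<lambda>x. S' (U n x) * (V n x - g' x) * \<phi> x)" for n
      by (rule iS'V[OF _ dd]) simp
    fix n
    have "(LINT x|lborel. \<bar>S' (U n x) * (V n x - g' x) * \<phi> x - 0\<bar>) \<le> (LINT x|lborel. (L * B1) * \<bar>V n x - g' x\<bar>)"
    proof (rule integral_mono)
      show "integrable lborel (\<lambda>x. \<bar>S' (U n x) * (V n x - g' x) * \<phi> x - 0\<bar>)"
        using integrable_abs[OF i1[of n]] by simp
      show "\<bar>S' (U n x) * (V n x - g' x) * \<phi> x - 0\<bar> \<le> L * B1 * \<bar>V n x - g' x\<bar>" for x
      proof -
        have "\<bar>S' (U n x)\<bar> * \<bar>V n x - g' x\<bar> * \<bar>\<phi> x\<bar> \<le> L * \<bar>V n x - g' x\<bar> * B1"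
          using S(3) B1 L0 by (intro mult_mono) auto
        then show ?thesis by (simp add: abs_mult mult_ac)
      qed
    qed (use dd in auto)
    then show "(LINT x|lborel. \<bar>S' (U n x) * (V n x - g' x) * \<phi> x - 0\<bar>) \<le> (L * B1) * (LINT x|lborel. \<bar>V n x - g' x\<bar>)"
      by simp
  qed auto
  have lim3: "(\<lambda>n. (LINT x|lborel. S' (U n x) * g' x * \<phi> x)) \<longlonglongrightarrow> (LINT x|lborel. S' (u' x) * g' x * \<phi> x)"
  proof (rule integral_dominated_convergence[where w = "\<lambda>x. (L * B1) * \<bar>g' x\<bar>"])
    show "AE x in lborel. (\<lambda>n. S' (U n x) * g' x * \<phi> x) \<longlonglongrightarrow> S' (u' x) * g' x * \<phi> x"
      using r(5)
    proof eventually_elim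
      case (elim x)
      have "(\<lambda>n. S' (U n x)) \<longlonglongrightarrow> S' (u' x)"
        using continuous_on_tendsto_compose[OF S(2) elim] by (simp add: U_def)
      then show ?case by (intro tendsto_mult tendsto_const)
    qed
    show "AE x in lborel. norm (S' (U n x) * g' x * \<phi> x) \<le> L * B1 * \<bar>g' x\<bar>" for n
    proof (rule AE_I2)
      fix x
      have "\<bar>S' (U n x)\<bar> * \<bar>g' x\<bar> * \<bar>\<phi> x\<bar> \<le> L * \<bar>g' x\<bar> * B1"
        using S(3) B1 L0 by (intro mult_mono) auto
      then show "norm (S' (U n x) * g' x * \<phi> x) \<le> L * B1 * \<bar>g' x\<bar>" by (simp add: abs_mult mult_ac)
    qed
  qed (use g' in auto)
  have "(\<lambda>n. (LINT x|lborel. S (U n x) * D\<phi> x) + ((LINT x|lborel. S' (U n x) * (V n x - g' x) * \<phi> x)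
      + (LINT x|lborel. S' (U n x) * g' x * \<phi> x))) \<longlonglongrightarrow>
    (LINT x|lborel. S (u' x) * D\<phi> x) + ((LINT x|(lborel::'a measure). 0) + (LINT x|lborel. S' (u' x) * g' x * \<phi> x))"
    by (intro tendsto_add lim1 lim2 lim3)
  moreover have "(LINT x|lborel. S (U n x) * D\<phi> x) + ((LINT x|lborel. S' (U n x) * (V n x - g' x) * \<phi> x)
      + (LINT x|lborel. S' (U n x) * g' x * \<phi> x)) = 0" for n
  proof -
    have "(LINT x|lborel. S' (U n x) * (V n x - g' x) * \<phi> x) + (LINT x|lborel. S' (U n x) * g' x * \<phi> x)
      = (LINT x|lborel. S' (U n x) * (V n x - g' x) * \<phi> x + S' (U n x) * g' x * \<phi> x)"
      using iS'V[of "U n" "\<lambda>x. V n x - g' x"] iS'V[of "U n" g'] iUV g' by simp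
    also have "\<dots> = (LINT x|lborel. S' (U n x) * V n x * \<phi> x)"
      by (intro Bochner_Integration.integral_cong) (auto simp: algebra_simps)
    finally show ?thesis using zero[of n] by simp
  qed
  ultimately have fin: "(LINT x|lborel. S (u' x) * D\<phi> x) = - (LINT x|lborel. S' (u' x) * g' x * \<phi> x)"
    by (simp add: LIMSEQ_const_iff)
  have Km [measurable]: "K' \<in> sets lebesgue" using K'(2) by (simp add: lmeasurable_compact fmeasurableD)
  have um [measurable]: "(\<lambda>x. indicator K' x * u x) \<in> borel_measurable lebesgue"
    "(\<lambda>x. indicator K' x * (G x \<bullet> i)) \<in> borel_measurable lebesgue" using iu by auto
  have [measurable]: "\<phi> \<in> borel_measurable lebesgue" "D\<phi> \<in> borel_measurable lebesgue" "u' \<in> borel_measurable lebesgue"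
      "g' \<in> borel_measurable lebesgue"
    by (auto intro: measurable_completion)
  have "(LINT x|lebesgue_on \<Omega>. S (u x) * D\<phi> x) = (LINT x|lebesgue. indicator K x * S (u x) * D\<phi> x)"
    by (rule integral_lebesgue_on_supported[OF \<Omega>m T(5,7)])
  also have "\<dots> = (LINT x|lebesgue. S (indicator K' x * u x) * D\<phi> x)"
  proof (rule Bochner_Integration.integral_cong[OF refl])
    show "indicator K x * S (u x) * D\<phi> x = S (indicator K' x * u x) * D\<phi> x" for x
      using T(7)[of x] K'(4) by (cases "x \<in> K") auto
  qed
  also have "\<dots> = (LINT x|lebesgue. S (u' x) * D\<phi> x)"
    using u'(2) by (intro integral_cong_AE) auto
  also have "\<dots> = (LINT x|lborel. S (u' x) * D\<phi> x)" by (rule integral_completion) auto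
  finally have 1: "(LINT x|lebesgue_on \<Omega>. S (u x) * D\<phi> x) = (LINT x|lborel. S (u' x) * D\<phi> x)" .
  have "(LINT x|lebesgue_on \<Omega>. (S' (u x) *\<^sub>R G x \<bullet> i) * \<phi> x) =
      (LINT x|lebesgue. indicator K x * (S' (u x) *\<^sub>R G x \<bullet> i) * \<phi> x)"
    by (rule integral_lebesgue_on_supported[OF \<Omega>m T(5,6)])
  also have "\<dots> = (LINT x|lebesgue. S' (indicator K' x * u x) * (indicator K' x * (G x \<bullet> i)) * \<phi> x)"
  proof (rule Bochner_Integration.integral_cong[OF refl])
    show "indicator K x * (S' (u x) *\<^sub>R G x \<bullet> i) * \<phi> x = S' (indicator K' x * u x) * (indicator K' x * (G x \<bullet> i)) * \<phi> x" for x
      using T(6)[of x] K'(4) by (cases "x \<in> K") auto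
  qed
  also have "\<dots> = (LINT x|lebesgue. S' (u' x) * g' x * \<phi> x)"
    using u'(2) g'(2) by (intro integral_cong_AE) auto
  also have "\<dots> = (LINT x|lborel. S' (u' x) * g' x * \<phi> x)" by (rule integral_completion) auto
  finally have 2: "(LINT x|lebesgue_on \<Omega>. (S' (u x) *\<^sub>R G x \<bullet> i) * \<phi> x) = (LINT x|lborel. S' (u' x) * g' x * \<phi> x)" .
  show ?thesis using fin 1 2 by (simp add: D\<phi>_def)
qed

lemma locally_integrableD:
  assumes "locally_integrable \<Omega> f" "compact K" "K \<subseteq> \<Omega>"
  shows "integrable lebesgue (\<lambda>x. indicator K x *\<^sub>R f x)"
  using assms unfolding locally_integrable_def set_integrable_def by blast

lemma integrable_compact_const: "compact K \<Longrightarrow> integrable lebesgue (\<lambda>x::'a::euclidean_space. indicator K x * c :: real)"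
  using emeasure_compact_finite[of K]
  by (intro integrable_mult_left integrable_real_indicator) (auto simp: lmeasurable_compact fmeasurableD compact_imp_closed)

lemma locally_integrable_dominated:
  fixes f :: "'a::euclidean_space \<Rightarrow> 'b::{banach, second_countable_topology}"
    and h :: "'a \<Rightarrow> 'c::{banach, second_countable_topology}"
  assumes f: "locally_integrable \<Omega> f"
    and h: "\<And>K. compact K \<Longrightarrow> K \<subseteq> \<Omega> \<Longrightarrow> (\<lambda>x. indicator K x *\<^sub>R h x) \<in> borel_measurable lebesgue"
    and le: "\<And>x. norm (h x) \<le> a + b * norm (f x)" and b: "b \<ge> 0" and a: "a \<ge> 0"
  shows "locally_integrable \<Omega> h"
  unfolding locally_integrable_def set_integrable_def
proof (intro allI impI)
  fix K assume K: "compact K \<and> K \<subseteq> \<Omega>"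
  show "integrable lebesgue (\<lambda>x. indicator K x *\<^sub>R h x)"
  proof (rule Bochner_Integration.integrable_bound)
    show "integrable lebesgue (\<lambda>x. indicator K x * a + b * norm (indicator K x *\<^sub>R f x))"
      using K locally_integrableD[OF f, of K] integrable_compact_const[of K]
      by (intro Bochner_Integration.integrable_add integrable_mult_right integrable_norm) auto
    show "(\<lambda>x. indicator K x *\<^sub>R h x) \<in> borel_measurable lebesgue" using h K by blast
    show "AE x in lebesgue. norm (indicator K x *\<^sub>R h x) \<le> norm (indicator K x * a + b * norm (indicator K x *\<^sub>R f x))"
      using le a b by (intro AE_I2) (auto simp: indicator_def)
  qed
qed

lemma integrable_supported:
  fixes f D :: "'a::euclidean_space \<Rightarrow> real"
  assumes "\<Omega> \<in> sets lebesgue" "K \<subseteq> \<Omega>" "\<And>x. x \<notin> K \<Longrightarrow> D x = 0" "integrable lebesgue (\<lambda>x. indicator K x * f x)"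
    and D: "continuous_on UNIV D" "\<And>x. \<bar>D x\<bar> \<le> C"
  shows "integrable (lebesgue_on \<Omega>) (\<lambda>x. f x * D x)"
proof -
  have [measurable]: "D \<in> borel_measurable lebesgue"
    using borel_measurable_continuous_onI[OF D(1)] by (auto intro: measurable_completion)
  have [measurable]: "(\<lambda>x. indicator K x * f x) \<in> borel_measurable lebesgue" using assms(4) by auto
  have "integrable lebesgue (\<lambda>x. (indicator K x * f x) * D x)"
  proof (rule Bochner_Integration.integrable_bound[of _ "\<lambda>x. C * (indicator K x * f x)"])
    show "AE x in lebesgue. norm (indicator K x * f x * D x) \<le> norm (C * (indicator K x * f x))"
    proof (rule AE_I2)
      fix x
      have "\<bar>D x\<bar> \<le> \<bar>C\<bar>" using D(2)[of x] by linarith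
      from mult_right_mono[OF this, of "\<bar>indicator K x * f x\<bar>"]
      show "norm (indicator K x * f x * D x) \<le> norm (C * (indicator K x * f x))"
        by (simp add: abs_mult mult_ac)
    qed
  qed (use assms in auto)
  also have "(\<lambda>x. (indicator K x * f x) * D x) = (\<lambda>x. indicator \<Omega> x *\<^sub>R (f x * D x))"
    using assms(2,3) by (auto simp: indicator_def fun_eq_iff)
  finally show ?thesis using assms(1) by (subst integrable_restrict_space) auto
qed

lemma integrable_test_function:
  fixes f :: "'a::euclidean_space \<Rightarrow> real"
  assumes "\<Omega> \<in> sets lebesgue" "locally_integrable \<Omega> f" "\<phi> \<in> test_functions \<Omega>"
  shows "integrable (lebesgue_on \<Omega>) (\<lambda>x. f x * \<phi> x)"
    and "i \<in> Basis \<Longrightarrow> integrable (lebesgue_on \<Omega>) (\<lambda>x. f x * frechet_derivative \<phi> (at x) i)"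
proof -
  note T = test_functionD[OF assms(3)]
  have f: "integrable lebesgue (\<lambda>x. indicator (closure {x. \<phi> x \<noteq> 0}) x * f x)"
    using locally_integrableD[OF assms(2) T(4,5)] by simp
  obtain C where C: "\<And>x. \<bar>\<phi> x\<bar> \<le> C" using compactly_supported_bounded[OF T(2,4,6)] by blast
  show "integrable (lebesgue_on \<Omega>) (\<lambda>x. f x * \<phi> x)"
    by (rule integrable_supported[OF assms(1) T(5,6) f T(2) C])
  assume i: "i \<in> Basis"
  obtain C where C: "\<And>x. \<bar>frechet_derivative \<phi> (at x) i\<bar> \<le> C"
    using compactly_supported_bounded[OF T(3)[OF i] T(4,7)] by blast
  show "integrable (lebesgue_on \<Omega>) (\<lambda>x. f x * frechet_derivative \<phi> (at x) i)"
    by (rule integrable_supported[OF assms(1) T(5,7) f T(3)[OF i] C])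
qed

lemma has_weak_gradient_chain:
  fixes u :: "'a::euclidean_space \<Rightarrow> real"
  assumes wg: "has_weak_gradient \<Omega> u G" and \<Omega>: "open \<Omega>"
    and S: "\<And>t. (S has_real_derivative S' t) (at t)" "continuous_on UNIV S'" "\<And>t. \<bar>S' t\<bar> \<le> L"
  shows "has_weak_gradient \<Omega> (\<lambda>x. S (u x)) (\<lambda>x. S' (u x) *\<^sub>R G x)"
  unfolding has_weak_gradient_def
proof (intro conjI ballI)
  have u: "locally_integrable \<Omega> u" and G: "locally_integrable \<Omega> G" using wg by (auto simp: has_weak_gradient_def)
  have L0: "L \<ge> 0" using S(3)[of 0] by simp
  have [measurable]: "S \<in> borel_measurable borel" "S' \<in> borel_measurable borel"
    using S(1,2) by (auto intro!: borel_measurable_continuous_onI DERIV_isCont continuous_at_imp_continuous_on)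
  have Slip: "\<bar>S a - S b\<bar> \<le> L * \<bar>a - b\<bar>" for a b
    using field_differentiable_bound[of UNIV S S' L a b] S(1,3) by auto
  show "locally_integrable \<Omega> (\<lambda>x. S (u x))"
  proof (rule locally_integrable_dominated[OF u])
    fix K assume K: "compact K" "K \<subseteq> \<Omega>"
    have [measurable]: "K \<in> sets lebesgue" using K by (simp add: lmeasurable_compact fmeasurableD)
    have [measurable]: "(\<lambda>x. indicator K x *\<^sub>R u x) \<in> borel_measurable lebesgue" using locally_integrableD[OF u K] by auto
    have eq: "(\<lambda>x. indicator K x *\<^sub>R S (u x)) = (\<lambda>x. indicator K x *\<^sub>R S (indicator K x *\<^sub>R u x))"
      by (auto simp: indicator_def)
    show "(\<lambda>x. indicator K x *\<^sub>R S (u x)) \<in> borel_measurable lebesgue"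
      unfolding eq by measurable
  next
    show "norm (S (u x)) \<le> \<bar>S 0\<bar> + L * norm (u x)" for x
      using Slip[of "u x" 0] abs_triangle_ineq2[of "S (u x)" "S 0"] by simp
  qed (use L0 in auto)
  show "locally_integrable \<Omega> (\<lambda>x. S' (u x) *\<^sub>R G x)"
  proof (rule locally_integrable_dominated[OF G])
    fix K assume K: "compact K" "K \<subseteq> \<Omega>"
    have [measurable]: "K \<in> sets lebesgue" using K by (simp add: lmeasurable_compact fmeasurableD)
    have [measurable]: "(\<lambda>x. indicator K x *\<^sub>R u x) \<in> borel_measurable lebesgue" 
       "(\<lambda>x. indicator K x *\<^sub>R G x) \<in> borel_measurable lebesgue"
      using locally_integrableD[OF u K] locally_integrableD[OF G K] by auto
    have eq: "(\<lambda>x. indicator K x *\<^sub>R S' (u x) *\<^sub>R G x) = (\<lambda>x. S' (indicator K x *\<^sub>R u x) *\<^sub>R (indicator K x *\<^sub>R G x))"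
      by (auto simp: indicator_def)
    show "(\<lambda>x. indicator K x *\<^sub>R S' (u x) *\<^sub>R G x) \<in> borel_measurable lebesgue"
      unfolding eq by measurable
  next
    show "norm (S' (u x) *\<^sub>R G x) \<le> 0 + L * norm (G x)" for x
      using S(3) by (simp add: mult_right_mono)
  qed (use L0 in auto)
  show "(LINT x|lebesgue_on \<Omega>. S (u x) * frechet_derivative \<phi> (at x) i) =
        - (LINT x|lebesgue_on \<Omega>. (S' (u x) *\<^sub>R G x \<bullet> i) * \<phi> x)"
    if "\<phi> \<in> test_functions \<Omega>" "i \<in> Basis" for \<phi> i
    by (rule has_weak_gradient_chain_identity[OF wg \<Omega> that(2) S that(1)])
qed

lemma locally_integrable_lincomb:
  assumes "locally_integrable \<Omega> f" "locally_integrable \<Omega> g"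
  shows "locally_integrable \<Omega> (\<lambda>x. a *\<^sub>R f x + b *\<^sub>R g x)"
  unfolding locally_integrable_def set_integrable_def
proof (intro allI impI)
  fix K assume K: "compact K \<and> K \<subseteq> \<Omega>"
  have "integrable lebesgue (\<lambda>x. a *\<^sub>R (indicator K x *\<^sub>R f x) + b *\<^sub>R (indicator K x *\<^sub>R g x))"
    using K locally_integrableD[OF assms(1), of K] locally_integrableD[OF assms(2), of K]
    by (intro Bochner_Integration.integrable_add integrable_scaleR_right) simp_all
  also have "(\<lambda>x. a *\<^sub>R (indicator K x *\<^sub>R f x) + b *\<^sub>R (indicator K x *\<^sub>R g x)) =
      (\<lambda>x. indicator K x *\<^sub>R (a *\<^sub>R f x + b *\<^sub>R g x))"
    by (auto simp: fun_eq_iff indicator_def)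
  finally show "integrable lebesgue (\<lambda>x. indicator K x *\<^sub>R (a *\<^sub>R f x + b *\<^sub>R g x))" .
qed

lemma has_weak_gradient_lincomb:
  fixes u v :: "'a::euclidean_space \<Rightarrow> real"
  assumes "\<Omega> \<in> sets lebesgue" "has_weak_gradient \<Omega> u G" "has_weak_gradient \<Omega> v H"
  shows "has_weak_gradient \<Omega> (\<lambda>x. a * u x + b * v x) (\<lambda>x. a *\<^sub>R G x + b *\<^sub>R H x)"
  unfolding has_weak_gradient_def
proof (intro conjI ballI)
  have l: "locally_integrable \<Omega> u" "locally_integrable \<Omega> G" "locally_integrable \<Omega> v" "locally_integrable \<Omega> H"
    using assms by (auto simp: has_weak_gradient_def)
  show "locally_integrable \<Omega> (\<lambda>x. a * u x + b * v x)" using locally_integrable_lincomb[OF l(1,3), of a b] by simp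
  show "locally_integrable \<Omega> (\<lambda>x. a *\<^sub>R G x + b *\<^sub>R H x)" by (rule locally_integrable_lincomb[OF l(2,4)])
  fix \<phi> i assume \<phi>: "\<phi> \<in> test_functions \<Omega>" and i: "(i::'a) \<in> Basis"
  note I = integrable_test_function(2)[OF assms(1) _ \<phi> i] and J = integrable_test_function(1)[OF assms(1) _ \<phi>]
  let ?D = "\<lambda>x. frechet_derivative \<phi> (at x) i"
  have "(LINT x|lebesgue_on \<Omega>. (a * u x + b * v x) * ?D x) =
     a * (LINT x|lebesgue_on \<Omega>. u x * ?D x) + b * (LINT x|lebesgue_on \<Omega>. v x * ?D x)"
    using I[OF l(1)] I[OF l(3)] by (simp add: distrib_right mult.assoc)
  also have "\<dots> = a * - (LINT x|lebesgue_on \<Omega>. (G x \<bullet> i) * \<phi> x) + b * - (LINT x|lebesgue_on \<Omega>. (H x \<bullet> i) * \<phi> x)"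
    using assms \<phi> i unfolding has_weak_gradient_def by simp
  also have "\<dots> = - (LINT x|lebesgue_on \<Omega>. ((a *\<^sub>R G x + b *\<^sub>R H x) \<bullet> i) * \<phi> x)"
    using J[OF locally_integrable_component[OF l(2)], of i] J[OF locally_integrable_component[OF l(4)], of i]
    by (simp add: inner_add_left distrib_right mult.assoc)
  finally show "(LINT x|lebesgue_on \<Omega>. (a * u x + b * v x) * ?D x) = - (LINT x|lebesgue_on \<Omega>. ((a *\<^sub>R G x + b *\<^sub>R H x) \<bullet> i) * \<phi> x)" .
qed

text \<open>The reason is that the partial derivatives of a test function have integral 0.\<close>

lemma has_weak_gradient_const:
  assumes "\<Omega> \<in> sets lebesgue"
  shows "has_weak_gradient \<Omega> (\<lambda>x. c) (\<lambda>x. 0)"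
  unfolding has_weak_gradient_def
proof (intro conjI ballI)
  show "locally_integrable \<Omega> (\<lambda>x. c)" "locally_integrable \<Omega> (\<lambda>x. 0::'a)"
    unfolding locally_integrable_def set_integrable_def using integrable_compact_const by auto
  fix \<phi> i assume \<phi>: "\<phi> \<in> test_functions \<Omega>" and i: "(i::'a) \<in> Basis"
  note T = test_functionD[OF \<phi>]
  let ?D = "\<lambda>x. frechet_derivative \<phi> (at x) i" let ?K = "closure {x. \<phi> x \<noteq> 0}"
  obtain B2 where "B2 > 0" "\<And>x. \<bar>?D x\<bar> \<le> B2" and B2: "\<And>x h. \<bar>\<phi> (x + h *\<^sub>R i) - \<phi> x\<bar> \<le> B2 * \<bar>h\<bar>"
    by (rule compactly_supported_C1_lipschitz[OF T(1) T(3)[OF i] T(4,6)]) (assumption, rule that)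
  have [measurable]: "\<phi> \<in> borel_measurable borel" "?D \<in> borel_measurable borel"
    using T(2) T(3)[OF i] by (auto intro: borel_measurable_continuous_onI)
  have "integrable lborel (\<lambda>x. indicator ?K x *\<^sub>R \<phi> x)"
    by (rule borel_integrable_compact[OF T(4) continuous_on_subset[OF T(2)]]) auto
  also have "(\<lambda>x. indicator ?K x *\<^sub>R \<phi> x) = \<phi>"
  proof
    show "indicator ?K x *\<^sub>R \<phi> x = \<phi> x" for x using T(6)[of x] by (cases "x \<in> ?K") auto
  qed
  finally have int: "integrable lborel \<phi>" .
  have z: "(LINT x|lborel. ?D x) = 0"
  proof (rule integral_directional_derivative_eq_0[OF _ _ B2 compact_imp_bounded[OF T(4)] T(6) int])
    show "((\<lambda>t. \<phi> (x + t *\<^sub>R i)) has_real_derivative ?D x) (at 0)" for x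
      using has_real_derivative_along_line[of \<phi> x 0 i] T(1)[of x] by simp
  qed (use i in auto)
  have "(LINT x|lebesgue_on \<Omega>. c * ?D x) = (LINT x|lebesgue. (indicator ?K x * c) * ?D x)"
    by (rule integral_lebesgue_on_supported[OF assms T(5,7)])
  also have "\<dots> = (LINT x|lebesgue. c * ?D x)"
  proof (rule Bochner_Integration.integral_cong[OF refl])
    show "(indicator ?K x * c) * ?D x = c * ?D x" for x using T(7)[of x i] by (cases "x \<in> ?K") auto
  qed
  also have "\<dots> = (LINT x|lborel. c * ?D x)" by (rule integral_completion) auto
  also have "\<dots> = 0" using z by simp
  finally show "(LINT x|lebesgue_on \<Omega>. c * ?D x) = - (LINT x|lebesgue_on \<Omega>. (0 \<bullet> i) * \<phi> x)" by simp
qed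

text \<open>Both sides of the defining identity pass to the limit by dominated convergence, with
  \<open>u\<close> and the norm of \<open>G\<close> times the bounded test function as majorants.
  Smooth approximations of the positive part are dominated in this way by the function they are
  applied to.\<close>

lemma has_weak_gradient_limit:
  fixes u v :: "'a::euclidean_space \<Rightarrow> real"
  assumes \<Omega>: "\<Omega> \<in> sets lebesgue"
    and wg: "\<And>n. has_weak_gradient \<Omega> (s n) (S n)"
    and u: "locally_integrable \<Omega> u" and G: "locally_integrable \<Omega> G"
    and dom: "\<And>n x. \<bar>s n x\<bar> \<le> \<bar>u x\<bar>" "\<And>n x. norm (S n x) \<le> norm (G x)"
    and lim: "\<And>x. (\<lambda>n. s n x) \<longlonglongrightarrow> v x" "\<And>x. (\<lambda>n. S n x) \<longlonglongrightarrow> H x"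
  shows "has_weak_gradient \<Omega> v H"
  unfolding has_weak_gradient_def
proof (intro conjI ballI)
  have l: "locally_integrable \<Omega> (s n)" "locally_integrable \<Omega> (S n)" for n
    using wg by (auto simp: has_weak_gradient_def)
  have dv: "\<bar>v x\<bar> \<le> \<bar>u x\<bar>" for x
    by (rule tendsto_upperbound[OF tendsto_rabs[OF lim(1)]]) (use dom in auto)
  have dH: "norm (H x) \<le> norm (G x)" for x
    by (rule tendsto_upperbound[OF tendsto_norm[OF lim(2)]]) (use dom in auto)
  show lv: "locally_integrable \<Omega> v"
  proof (rule locally_integrable_dominated[OF u, where a = 0 and b = 1])
    fix K assume K: "compact K" "K \<subseteq> \<Omega>"
    show "(\<lambda>x. indicator K x *\<^sub>R v x) \<in> borel_measurable lebesgue"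
      by (rule borel_measurable_LIMSEQ_metric[of "\<lambda>n x. indicator K x *\<^sub>R s n x"])
        (use locally_integrableD[OF l(1) K] lim in \<open>auto intro!: tendsto_intros\<close>)
  qed (use dv in auto)
  show lH: "locally_integrable \<Omega> H"
  proof (rule locally_integrable_dominated[OF G, where a = 0 and b = 1])
    fix K assume K: "compact K" "K \<subseteq> \<Omega>"
    show "(\<lambda>x. indicator K x *\<^sub>R H x) \<in> borel_measurable lebesgue"
      by (rule borel_measurable_LIMSEQ_metric[of "\<lambda>n x. indicator K x *\<^sub>R S n x"])
        (use locally_integrableD[OF l(2) K] lim in \<open>auto intro!: tendsto_intros\<close>)
  qed (use dH in auto)
  fix \<phi> i assume \<phi>: "\<phi> \<in> test_functions \<Omega>" and i: "(i::'a) \<in> Basis"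
  let ?D = "\<lambda>x. frechet_derivative \<phi> (at x) i"
  note I = integrable_test_function(2)[OF \<Omega> _ \<phi> i] and J = integrable_test_function(1)[OF \<Omega> _ \<phi>]
  have Gn: "locally_integrable \<Omega> (\<lambda>x. norm (G x))"
  proof (rule locally_integrable_dominated[OF G, where a = 0 and b = 1])
    fix K assume K: "compact K" "K \<subseteq> \<Omega>"
    have [measurable]: "(\<lambda>x. indicator K x *\<^sub>R G x) \<in> borel_measurable lebesgue"
      using locally_integrableD[OF G K] by auto
    have "(\<lambda>x. norm (indicator K x *\<^sub>R G x)) \<in> borel_measurable lebesgue" by measurable
    then show "(\<lambda>x. indicator K x *\<^sub>R norm (G x)) \<in> borel_measurable lebesgue" by simp
  qed auto
  have 1: "(\<lambda>n. LINT x|lebesgue_on \<Omega>. s n x * ?D x) \<longlonglongrightarrow> (LINT x|lebesgue_on \<Omega>. v x * ?D x)"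
  proof (rule integral_dominated_convergence[where w = "\<lambda>x. \<bar>u x * ?D x\<bar>"])
    show "AE x in lebesgue_on \<Omega>. norm (s n x * ?D x) \<le> \<bar>u x * ?D x\<bar>" for n
      using dom by (intro AE_I2) (auto simp: abs_mult intro!: mult_right_mono)
    show "integrable (lebesgue_on \<Omega>) (\<lambda>x. \<bar>u x * ?D x\<bar>)" using I[OF u] by (rule integrable_abs)
  qed (use I[OF lv] I[OF l(1)] lim in \<open>auto intro!: tendsto_intros\<close>)
  have 2: "(\<lambda>n. LINT x|lebesgue_on \<Omega>. (S n x \<bullet> i) * \<phi> x) \<longlonglongrightarrow> (LINT x|lebesgue_on \<Omega>. (H x \<bullet> i) * \<phi> x)"
  proof (rule integral_dominated_convergence[where w = "\<lambda>x. \<bar>norm (G x) * \<phi> x\<bar>"])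
    show "AE x in lebesgue_on \<Omega>. norm ((S n x \<bullet> i) * \<phi> x) \<le> \<bar>norm (G x) * \<phi> x\<bar>" for n
    proof (rule AE_I2)
      fix x
      have "\<bar>S n x \<bullet> i\<bar> \<le> norm (G x)" using Basis_le_norm[OF i, of "S n x"] dom(2)[of n x] by linarith
      then show "norm ((S n x \<bullet> i) * \<phi> x) \<le> \<bar>norm (G x) * \<phi> x\<bar>" by (simp add: abs_mult mult_right_mono)
    qed
    show "integrable (lebesgue_on \<Omega>) (\<lambda>x. \<bar>norm (G x) * \<phi> x\<bar>)" using J[OF Gn] by (rule integrable_abs)
  qed (use J[OF locally_integrable_component[OF lH]] J[OF locally_integrable_component[OF l(2)]] lim in \<open>auto intro!: tendsto_intros\<close>)
  have "(LINT x|lebesgue_on \<Omega>. s n x * ?D x) = - (LINT x|lebesgue_on \<Omega>. (S n x \<bullet> i) * \<phi> x)" for n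
    using wg \<phi> i by (auto simp: has_weak_gradient_def)
  with 1 have "(\<lambda>n. - (LINT x|lebesgue_on \<Omega>. (S n x \<bullet> i) * \<phi> x)) \<longlonglongrightarrow> (LINT x|lebesgue_on \<Omega>. v x * ?D x)" by simp
  then show "(LINT x|lebesgue_on \<Omega>. v x * ?D x) = - (LINT x|lebesgue_on \<Omega>. (H x \<bullet> i) * \<phi> x)"
    using LIMSEQ_unique tendsto_minus[OF 2] by blast
qed

section \<open>Positive part and truncation of weakly differentiable functions\<close>

lemma DERIV_pos_part_squared: "((\<lambda>t. (max t 0)\<^sup>2) has_real_derivative 2 * max t 0) (at t)" for t :: real
proof -
  consider "t > 0" | "t < 0" | "t = 0" by linarith
  then show ?thesis
  proof cases
    case 1
    have "\<forall>\<^sub>F s in nhds t. (max s 0)\<^sup>2 = s\<^sup>2"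
      using eventually_nhds_in_open[of "{0<..}" t] 1 by (auto elim!: eventually_mono)
    then show ?thesis using 1 by (subst DERIV_cong_ev[OF refl _ refl]) (auto intro!: derivative_eq_intros)
  next
    case 2
    have "\<forall>\<^sub>F s in nhds t. (max s 0)\<^sup>2 = 0"
      using eventually_nhds_in_open[of "{..<0}" t] 2 by (auto elim!: eventually_mono)
    then show ?thesis using 2 by (subst DERIV_cong_ev[OF refl _ refl, where g = "\<lambda>_. 0"]) auto
  next
    case 3
    have "((\<lambda>h::real. (max h 0)\<^sup>2 / h) \<longlongrightarrow> 0) (at 0)"
    proof (rule Lim_null_comparison)
      show "\<forall>\<^sub>F h::real in at 0. norm ((max h 0)\<^sup>2 / h) \<le> \<bar>h\<bar>"
        by (intro always_eventually) (auto simp: max_def power2_eq_square)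
      show "((\<lambda>h::real. \<bar>h\<bar>) \<longlongrightarrow> 0) (at 0)" by (intro tendsto_eq_intros) auto
    qed
    then show ?thesis using 3 by (simp add: DERIV_def)
  qed
qed

text \<open>Approximation by S_n(t) = sqrt(max(t,0)^2 + e_n^2) - e_n, which is C1 because the square
  of the positive part is. Here |S_n(t)| is at most |t|, and S_n' lies between 0 and 1, tends to 1
  for t > 0 and is 0 for t at most 0; this yields the value 0 of the gradient where
  \<open>u x = 0\<close>.\<close>

lemma has_weak_gradient_pos_part:
  fixes u :: "'a::euclidean_space \<Rightarrow> real"
  assumes wg: "has_weak_gradient \<Omega> u G" and \<Omega>: "open \<Omega>"
  shows "has_weak_gradient \<Omega> (\<lambda>x. max (u x) 0) (\<lambda>x. if u x > 0 then G x else 0)"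
proof -
  define e where "e n = 1 / real (Suc n)" for n
  have e: "e n > 0" for n by (simp add: e_def)
  have e0: "e \<longlonglongrightarrow> 0" unfolding e_def by (rule LIMSEQ_Suc[OF lim_1_over_n])
  define S where "S n t = sqrt ((max t 0)\<^sup>2 + (e n)\<^sup>2) - e n" for n and t :: real
  define S' where "S' n t = max t 0 / sqrt ((max t 0)\<^sup>2 + (e n)\<^sup>2)" for n and t :: real
  have pos: "(max t 0)\<^sup>2 + (e n)\<^sup>2 > 0" for n t using e[of n] by (simp add: add_nonneg_pos)
  have D: "(S n has_real_derivative S' n t) (at t)" for n t
  proof -
    have "((\<lambda>t. (max t 0)\<^sup>2 + (e n)\<^sup>2) has_real_derivative 2 * max t 0 + 0) (at t)"
      by (intro DERIV_add DERIV_pos_part_squared DERIV_const)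
    from DERIV_diff[OF DERIV_chain2[OF DERIV_real_sqrt[OF pos[of t n]] this] DERIV_const[of "e n"]]
    show ?thesis unfolding S_def S'_def by (simp add: field_simps)
  qed
  have S'01: "0 \<le> S' n t" "S' n t \<le> 1" for n t
  proof -
    show "0 \<le> S' n t" using pos[of t n] by (simp add: S'_def)
    have "max t 0 \<le> sqrt ((max t 0)\<^sup>2 + (e n)\<^sup>2)" by (rule real_le_rsqrt) simp
    then show "S' n t \<le> 1" using pos[of t n] by (simp add: S'_def)
  qed
  have Sle: "\<bar>S n t\<bar> \<le> \<bar>t\<bar>" for n t
  proof -
    have "sqrt ((max t 0)\<^sup>2 + (e n)\<^sup>2) \<le> max t 0 + e n"
      using sqrt_sum_squares_le_sum[of "max t 0" "e n"] e[of n] by simp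
    moreover have "e n \<le> sqrt ((max t 0)\<^sup>2 + (e n)\<^sup>2)" by (rule real_le_rsqrt) simp
    ultimately show ?thesis by (auto simp: S_def max_def split: if_splits)
  qed
  have cont: "continuous_on UNIV (S' n)" for n
  proof -
    have "sqrt ((max t 0)\<^sup>2 + (e n)\<^sup>2) \<noteq> 0" for t using real_sqrt_gt_zero[OF pos[of t n]] by linarith
    then show ?thesis unfolding S'_def by (intro continuous_intros) auto
  qed
  have w: "has_weak_gradient \<Omega> (\<lambda>x. S n (u x)) (\<lambda>x. S' n (u x) *\<^sub>R G x)" for n
    using S'01 by (intro has_weak_gradient_chain[OF wg \<Omega> D cont, where L = 1]) (auto simp: abs_of_nonneg)
  show ?thesis
  proof (rule has_weak_gradient_limit[OF _ w])
    show "\<Omega> \<in> sets lebesgue" using \<Omega> by (simp add: lmeasurable_open sets_completionI_sets)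
    show "locally_integrable \<Omega> u" "locally_integrable \<Omega> G" using wg by (auto simp: has_weak_gradient_def)
    show "\<bar>S n (u x)\<bar> \<le> \<bar>u x\<bar>" for n x by (rule Sle)
    show "norm (S' n (u x) *\<^sub>R G x) \<le> norm (G x)" for n x
      using S'01[of n "u x"] by (simp add: mult_left_le_one_le)
    fix x
    have "(\<lambda>n. S n (u x)) \<longlonglongrightarrow> sqrt ((max (u x) 0)\<^sup>2 + 0\<^sup>2) - 0"
      unfolding S_def by (intro tendsto_intros e0)
    then show "(\<lambda>n. S n (u x)) \<longlonglongrightarrow> max (u x) 0" by simp
    show "(\<lambda>n. S' n (u x) *\<^sub>R G x) \<longlonglongrightarrow> (if u x > 0 then G x else 0)"
    proof (cases "u x > 0")
      case True
      have "(\<lambda>n. S' n (u x)) \<longlonglongrightarrow> max (u x) 0 / sqrt ((max (u x) 0)\<^sup>2 + 0\<^sup>2)"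
        unfolding S'_def using True by (intro tendsto_intros e0) auto
      then have "(\<lambda>n. S' n (u x)) \<longlonglongrightarrow> 1" using True by simp
      from tendsto_scaleR[OF this tendsto_const[of "G x"]] show ?thesis using True by simp
    next
      case False
      then show ?thesis by (simp add: S'_def max_def)
    qed
  qed
qed

definition clip :: "real \<Rightarrow> real \<Rightarrow> real \<Rightarrow> real" where
  "clip l h t = max l (min h t)"

text \<open>For \<open>l \<le> h\<close> truncation is \<open>l\<close> plus the positive part of
  \<open>t - l\<close> minus that of \<open>t - h\<close>. The half-open condition
  \<open>l < u x \<and> u x \<le> h\<close> is what the two strict inequalities leave.\<close>

lemma has_weak_gradient_clip:
  fixes u :: "'a::euclidean_space \<Rightarrow> real"
  assumes wg: "has_weak_gradient \<Omega> u G" and \<Omega>: "open \<Omega>" and lh: "l \<le> h"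
  shows "has_weak_gradient \<Omega> (\<lambda>x. clip l h (u x)) (\<lambda>x. if l < u x \<and> u x \<le> h then G x else 0)"
proof -
  have \<Omega>m: "\<Omega> \<in> sets lebesgue" using \<Omega> by (simp add: lmeasurable_open sets_completionI_sets)
  note const = has_weak_gradient_const[OF \<Omega>m] and lin = has_weak_gradient_lincomb[OF \<Omega>m]
  have p: "has_weak_gradient \<Omega> (\<lambda>x. max (u x - c) 0) (\<lambda>x. if u x > c then G x else 0)" for c
    using has_weak_gradient_pos_part[OF lin[OF wg const[of c], of 1 "-1"] \<Omega>] by (simp cong: if_cong)
  have "has_weak_gradient \<Omega> (\<lambda>x. 1 * (1 * max (u x - l) 0 + (-1) * max (u x - h) 0) + 1 * l)
     (\<lambda>x. 1 *\<^sub>R (1 *\<^sub>R (if u x > l then G x else 0) + (-1) *\<^sub>R (if u x > h then G x else 0)) + 1 *\<^sub>R 0)"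
    by (intro lin p const)
  moreover have "(\<lambda>x. 1 * (1 * max (u x - l) 0 + (-1) * max (u x - h) 0) + 1 * l) = (\<lambda>x. clip l h (u x))"
    using lh by (auto simp: fun_eq_iff clip_def max_def min_def)
  moreover have "(\<lambda>x. 1 *\<^sub>R (1 *\<^sub>R (if u x > l then G x else 0) + (-1) *\<^sub>R (if u x > h then G x else 0)) + 1 *\<^sub>R 0)
      = (\<lambda>x. if l < u x \<and> u x \<le> h then G x else 0)"
    using lh by (auto simp: fun_eq_iff)
  ultimately show ?thesis by simp
qed

section \<open>Potentials of monotone functions\<close>

text \<open>The antiderivative of a continuous \<open>f\<close> that vanishes at 0, with the
  integration variable rescaled to \<open>{0..1}\<close>: one formula covers negative
  \<open>s\<close>, and Riemann sums over fixed nodes show measurability when \<open>f\<close> and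
  \<open>s\<close> depend on a point.\<close>

definition pot :: "(real \<Rightarrow> real) \<Rightarrow> real \<Rightarrow> real" where
  "pot f s = integral {0..1} (\<lambda>r. s * f (r * s))"

lemma pot_antiderivative:
  assumes f: "continuous_on UNIV f"
  obtains g where "\<And>x. x \<in> {-R..R} \<Longrightarrow> (g has_vector_derivative f x) (at x within {-R..R})"
    "\<And>s. s \<in> {-R..R} \<Longrightarrow> pot f s = g s - g 0"
proof -
  obtain g where g: "\<And>x. x \<in> {-R..R} \<Longrightarrow> (g has_vector_derivative f x) (at x within {-R..R})"
    using antiderivative_continuous[of "-R" R f] continuous_on_subset[OF f] by blast
  show ?thesis
  proof (rule that[OF g])
    fix s assume s: "s \<in> {-R..R}"
    have "((\<lambda>r. s * f (r * s)) has_integral ((g \<circ> (\<lambda>r. r * s)) 1 - (g \<circ> (\<lambda>r. r * s)) 0)) {0..1}"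
    proof (rule fundamental_theorem_of_calculus)
      fix r :: real assume r: "r \<in> {0..1}"
      have im: "(\<lambda>r. r * s) ` {0..1} \<subseteq> {-R..R}"
      proof
        fix y assume "y \<in> (\<lambda>r. r * s) ` {0..1}"
        then obtain t where t: "0 \<le> t" "t \<le> 1" "y = t * s" by auto
        have "\<bar>y\<bar> \<le> \<bar>s\<bar>" using t by (simp add: abs_mult mult_left_le_one_le)
        then show "y \<in> {-R..R}" using s by auto
      qed
      have a: "((\<lambda>r. r * s) has_vector_derivative s) (at r within {0..1})"
        by (auto intro!: derivative_eq_intros simp: has_vector_derivative_def mult.commute)
      have b: "(g has_vector_derivative f (r * s)) (at (r * s) within (\<lambda>r. r * s) ` {0..1})"
      proof (rule has_vector_derivative_within_subset[OF g im])
        show "r * s \<in> {-R..R}" using im r by (rule_tac subsetD[OF im]) (rule imageI)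
      qed
      show "(g \<circ> (\<lambda>r. r * s) has_vector_derivative s * f (r * s)) (at r within {0..1})"
        using vector_diff_chain_within[OF a b] by simp
    qed simp
    from integral_unique[OF this] show "pot f s = g s - g 0" by (simp only: pot_def o_def mult_1 mult_zero_left)
  qed
qed

lemma pot_mvt:
  assumes f: "continuous_on UNIV f" and le: "s \<le> t"
  shows "\<exists>z\<in>{s..t}. pot f t - pot f s = f z * (t - s)"
proof -
  obtain g where g: "\<And>x. x \<in> {- max \<bar>s\<bar> \<bar>t\<bar>..max \<bar>s\<bar> \<bar>t\<bar>} \<Longrightarrow> (g has_vector_derivative f x) (at x within {- max \<bar>s\<bar> \<bar>t\<bar>..max \<bar>s\<bar> \<bar>t\<bar>})"
    "\<And>x. x \<in> {- max \<bar>s\<bar> \<bar>t\<bar>..max \<bar>s\<bar> \<bar>t\<bar>} \<Longrightarrow> pot f x = g x - g 0"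
    by (rule pot_antiderivative[OF f, of "max \<bar>s\<bar> \<bar>t\<bar>"]) (rule that)
  have sub: "{s..t} \<subseteq> {- max \<bar>s\<bar> \<bar>t\<bar>..max \<bar>s\<bar> \<bar>t\<bar>}" by auto
  have "\<exists>z\<in>{s..t}. g t - g s = (t - s) *\<^sub>R f z"
  proof (rule mvt_very_simple[OF le])
    fix x assume "s \<le> x" "x \<le> t"
    then show "(g has_derivative (\<lambda>h. h *\<^sub>R f x)) (at x within {s..t})"
      using g(1)[of x] sub by (auto simp: has_vector_derivative_def intro: has_derivative_subset)
  qed
  moreover have "pot f t - pot f s = g t - g s"
  proof -
    have "s \<in> {- max \<bar>s\<bar> \<bar>t\<bar>..max \<bar>s\<bar> \<bar>t\<bar>}" "t \<in> {- max \<bar>s\<bar> \<bar>t\<bar>..max \<bar>s\<bar> \<bar>t\<bar>}"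
      by (auto simp: max_def)
    then show ?thesis using g(2)[of s] g(2)[of t] by simp
  qed
  ultimately show ?thesis by (auto simp: mult.commute)
qed

text \<open>By the mean value theorem and monotonicity; \<open>pot f\<close> is convex with
  \<open>f\<close> as a subgradient. Growth bounds, continuity, midpoint convexity and the first
  variation are read off from this inequality.\<close>

lemma pot_subgradient:
  assumes f: "continuous_on UNIV f" and m: "mono f"
  shows "pot f t - pot f s \<ge> f s * (t - s)"
proof (cases "s \<le> t")
  case True
  obtain z where z: "z \<in> {s..t}" "pot f t - pot f s = f z * (t - s)" using pot_mvt[OF f True] by blast
  then show ?thesis using True monoD[OF m, of s z] by (simp add: mult_right_mono)
next
  case False
  then obtain z where z: "z \<in> {t..s}" "pot f s - pot f t = f z * (s - t)" using pot_mvt[OF f, of t s] by auto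
  then have "f z * (s - t) \<le> f s * (s - t)" using False monoD[OF m, of z s] by (simp add: mult_right_mono)
  then show ?thesis using z by (simp add: algebra_simps)
qed

lemma pot_0 [simp]: "pot f 0 = 0" by (simp add: pot_def)

text \<open>The subgradient inequalities at \<open>s\<close> and at \<open>t\<close> enclose the
  increment between \<open>f s * (t - s)\<close> and \<open>f t * (t - s)\<close>.\<close>

lemma isCont_pot:
  assumes f: "continuous_on UNIV f" and m: "mono f"
  shows "isCont (pot f) s"
proof -
  have "((\<lambda>t. pot f t - pot f s) \<longlongrightarrow> 0) (at s)"
  proof (rule tendsto_sandwich)
    show "\<forall>\<^sub>F t in at s. f s * (t - s) \<le> pot f t - pot f s"
      using pot_subgradient[OF f m] by (intro always_eventually) auto
    show "\<forall>\<^sub>F t in at s. pot f t - pot f s \<le> f t * (t - s)"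
    proof (intro always_eventually allI)
      fix t show "pot f t - pot f s \<le> f t * (t - s)"
        using pot_subgradient[OF f m, of t s] by (simp add: algebra_simps)
    qed
    show "((\<lambda>t. f s * (t - s)) \<longlongrightarrow> 0) (at s)" by (auto intro!: tendsto_eq_intros)
    have "(f \<longlongrightarrow> f s) (at s)" using f by (simp add: continuous_on_def)
    then show "((\<lambda>t. f t * (t - s)) \<longlongrightarrow> 0) (at s)" by (auto intro!: tendsto_eq_intros)
  qed
  then show ?thesis by (simp add: isCont_def LIM_zero_iff)
qed

lemma pot_eq_integral:
  assumes f: "continuous_on UNIV f" and b: "0 \<le> b"
  shows "pot f b = integral {0..b} f"
proof -
  obtain g where g: "\<And>x. x \<in> {-b..b} \<Longrightarrow> (g has_vector_derivative f x) (at x within {-b..b})"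
    "\<And>x. x \<in> {-b..b} \<Longrightarrow> pot f x = g x - g 0"
    by (rule pot_antiderivative[OF f, of b]) (rule that)
  have "(f has_integral (g b - g 0)) {0..b}"
    using b by (intro fundamental_theorem_of_calculus has_vector_derivative_within_subset[OF g(1)]) auto
  then show ?thesis using g(2)[of b] b by (simp add: integral_unique)
qed

text \<open>On each cell a monotone function lies between its end values, and the errors telescope.
  The partial sums up to \<open>m\<close> are there for the induction.\<close>

lemma riemann_sum_bounds:
  fixes h :: "real \<Rightarrow> real"
  assumes h: "mono_on {0..1} h" "continuous_on {0..1} h" and n: "n > 0" and m: "m \<le> n"
  shows "(\<Sum>k<m. h (real k / real n)) / real n \<le> integral {0..real m / real n} h \<and>
     integral {0..real m / real n} h \<le> (\<Sum>k<m. h (real k / real n)) / real n + (h (real m / real n) - h 0) / real n"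
  using m
proof (induction m)
  case (Suc m)
  define a where "a = real m / real n"
  define b where "b = real (Suc m) / real n"
  have ab: "0 \<le> a" "a \<le> b" "b \<le> 1" "b - a = 1 / real n"
    using Suc.prems n by (auto simp: field_simps a_def b_def)
  have c: "continuous_on {0..b} h" "continuous_on {a..b} h"
    using ab by (auto intro!: continuous_on_subset[OF h(2)])
  have comb: "integral {0..b} h = integral {0..a} h + integral {a..b} h"
    using Henstock_Kurzweil_Integration.integral_combine[OF ab(1,2) integrable_continuous_real[OF c(1)]] by simp
  have i: "h integrable_on {a..b}" using integrable_continuous_real[OF c(2)] .
  have "integral {a..b} (\<lambda>_. h a) \<le> integral {a..b} h"
    using ab by (intro integral_le i integrable_const_ivl mono_onD[OF h(1)]) auto
  then have lo: "h a / real n \<le> integral {a..b} h" using ab by simp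
  have "integral {a..b} h \<le> integral {a..b} (\<lambda>_. h b)"
    using ab by (intro integral_le i integrable_const_ivl mono_onD[OF h(1)]) auto
  then have hi: "integral {a..b} h \<le> h b / real n" using ab by simp
  have IH: "(\<Sum>k<m. h (real k / real n)) / real n \<le> integral {0..a} h"
     "integral {0..a} h \<le> (\<Sum>k<m. h (real k / real n)) / real n + (h a - h 0) / real n"
    using Suc.IH Suc.prems by (auto simp: a_def)
  have S: "(\<Sum>k<Suc m. h (real k / real n)) / real n = (\<Sum>k<m. h (real k / real n)) / real n + h a / real n"
    by (simp add: a_def add_divide_distrib)
  show ?case unfolding S b_def[symmetric] using IH comb lo hi by (simp add: diff_divide_distrib)
qed simp

lemma riemann_sum_tendsto:
  fixes h :: "real \<Rightarrow> real"
  assumes h: "mono_on {0..1} h" "continuous_on {0..1} h"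
  shows "(\<lambda>n. (\<Sum>k<Suc n. h (real k / real (Suc n))) / real (Suc n)) \<longlonglongrightarrow> integral {0..1} h"
proof (rule tendsto_sandwich)
  have b: "(\<Sum>k<Suc n. h (real k / real (Suc n))) / real (Suc n) \<le> integral {0..1} h \<and>
     integral {0..1} h \<le> (\<Sum>k<Suc n. h (real k / real (Suc n))) / real (Suc n) + (h 1 - h 0) / real (Suc n)" for n
    using riemann_sum_bounds[OF h, of "Suc n" "Suc n"] by (simp del: sum.lessThan_Suc of_nat_Suc)
  show "\<forall>\<^sub>F n in sequentially. integral {0..1} h - (h 1 - h 0) / real (Suc n) \<le> (\<Sum>k<Suc n. h (real k / real (Suc n))) / real (Suc n)"
    using b by (intro always_eventually allI) (smt (verit))
  show "\<forall>\<^sub>F n in sequentially. (\<Sum>k<Suc n. h (real k / real (Suc n))) / real (Suc n) \<le> integral {0..1} h"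
    using b by (intro always_eventually) blast
  have "(\<lambda>n. (h 1 - h 0) * (1 / real (Suc n))) \<longlonglongrightarrow> (h 1 - h 0) * 0"
    by (intro tendsto_mult tendsto_const LIMSEQ_Suc[OF lim_1_over_n])
  from tendsto_diff[OF tendsto_const[of "integral {0..1} h"] this]
  show "(\<lambda>n. integral {0..1} h - (h 1 - h 0) / real (Suc n)) \<longlonglongrightarrow> integral {0..1} h" by simp
qed simp

section \<open>Measurability of compositions and of potentials\<close>

lemma borel_measurable_lebesgue_on_AE:
  fixes f g :: "'a::euclidean_space \<Rightarrow> 'b::euclidean_space"
  assumes S: "S \<in> sets lebesgue" and f: "f \<in> borel_measurable (lebesgue_on S)" and ae: "AE x in lebesgue_on S. f x = g x"
  shows "g \<in> borel_measurable (lebesgue_on S)"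
proof -
  have "(\<lambda>x. if x \<in> S then f x else 0) \<in> borel_measurable lebesgue" using borel_measurable_if[OF S] f by blast
  moreover have "AE x in lebesgue. (if x \<in> S then f x else 0) = (if x \<in> S then g x else 0)"
    using ae S by (simp add: AE_restrict_space_iff)
  ultimately have "(\<lambda>x. if x \<in> S then g x else 0) \<in> borel_measurable lebesgue" by (rule borel_measurable_AE)
  then show ?thesis using borel_measurable_if[OF S] by blast
qed

lemma borel_measurable_lebesgue_on_AE_limit:
  fixes f :: "nat \<Rightarrow> 'a::euclidean_space \<Rightarrow> real"
  assumes S: "S \<in> sets lebesgue" and f: "\<And>n. f n \<in> borel_measurable (lebesgue_on S)"
    and ae: "AE x in lebesgue_on S. (\<lambda>n. f n x) \<longlonglongrightarrow> g x"
  shows "g \<in> borel_measurable (lebesgue_on S)"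
proof (rule borel_measurable_lebesgue_on_AE[OF S])
  show "(\<lambda>x. lim (\<lambda>n. f n x)) \<in> borel_measurable (lebesgue_on S)" using f by (rule borel_measurable_lim_metric)
  show "AE x in lebesgue_on S. lim (\<lambda>n. f n x) = g x" using ae by eventually_elim (rule limI)
qed

text \<open>\<open>v\<close> is rounded down to multiples of 1/(n+1); the composition with a
  countably valued function is measurable, and continuity of \<open>f x\<close> for almost every
  \<open>x\<close> gives the limit.\<close>

lemma caratheodory_measurable:
  fixes f :: "'a::euclidean_space \<Rightarrow> real \<Rightarrow> real"
  assumes S: "S \<in> sets lebesgue" and f: "\<And>s. (\<lambda>x. f x s) \<in> borel_measurable (lebesgue_on S)"
    and c: "AE x in lebesgue_on S. continuous_on UNIV (f x)" and v: "v \<in> borel_measurable (lebesgue_on S)"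
  shows "(\<lambda>x. f x (v x)) \<in> borel_measurable (lebesgue_on S)"
proof (rule borel_measurable_lebesgue_on_AE_limit[OF S])
  fix n :: nat
  have [measurable]: "v \<in> borel_measurable (lebesgue_on S)" by fact
  show "(\<lambda>x. f x (real_of_int \<lfloor>real (Suc n) * v x\<rfloor> / real (Suc n))) \<in> borel_measurable (lebesgue_on S)"
    by (rule measurable_compose_countable[of "\<lambda>i x. f x (real_of_int i / real (Suc n))", OF f]) measurable
next
  show "AE x in lebesgue_on S. (\<lambda>n. f x (real_of_int \<lfloor>real (Suc n) * v x\<rfloor> / real (Suc n))) \<longlonglongrightarrow> f x (v x)"
    using c
  proof eventually_elim
    case (elim x)
    have "(\<lambda>n. real_of_int \<lfloor>real (Suc n) * v x\<rfloor> / real (Suc n)) \<longlonglongrightarrow> v x"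
    proof (rule tendsto_sandwich)
      have "(\<lambda>n. v x - 1 / real (Suc n)) \<longlonglongrightarrow> v x - 0"
        by (intro tendsto_diff tendsto_const LIMSEQ_Suc[OF lim_1_over_n])
      then show "(\<lambda>n. v x - 1 / real (Suc n)) \<longlonglongrightarrow> v x" by simp
      show "\<forall>\<^sub>F n in sequentially. v x - 1 / real (Suc n) \<le> real_of_int \<lfloor>real (Suc n) * v x\<rfloor> / real (Suc n)"
      proof (intro always_eventually allI)
        fix n
        have "(real (Suc n) * v x - 1) / real (Suc n) \<le> real_of_int \<lfloor>real (Suc n) * v x\<rfloor> / real (Suc n)"
          by (intro divide_right_mono) linarith+
        then show "v x - 1 / real (Suc n) \<le> real_of_int \<lfloor>real (Suc n) * v x\<rfloor> / real (Suc n)"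
          by (simp add: diff_divide_distrib del: of_nat_Suc)
      qed
      show "\<forall>\<^sub>F n in sequentially. real_of_int \<lfloor>real (Suc n) * v x\<rfloor> / real (Suc n) \<le> v x"
      proof (intro always_eventually allI)
        fix n
        have "real_of_int \<lfloor>real (Suc n) * v x\<rfloor> \<le> real (Suc n) * v x" by linarith
        then show "real_of_int \<lfloor>real (Suc n) * v x\<rfloor> / real (Suc n) \<le> v x"
          by (simp add: pos_divide_le_eq mult.commute del: of_nat_Suc)
      qed
    qed simp
    then show ?case by (rule continuous_on_tendsto_compose[OF elim]) auto
  qed
qed

text \<open>The Riemann sums of \<open>pot\<close> involve \<open>f x\<close> only along the
  multiples \<open>r * v x\<close>, and measurability is assumed just there: for the flux it comes
  from the hypothesis on the functions of the Lebesgue space that are inserted into it.\<close>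

lemma borel_measurable_pot:
  fixes f :: "'a::euclidean_space \<Rightarrow> real \<Rightarrow> real"
  assumes S: "S \<in> sets lebesgue" and c: "AE x in lebesgue_on S. continuous_on UNIV (f x) \<and> mono (f x)"
    and v: "v \<in> borel_measurable (lebesgue_on S)"
    and f: "\<And>r. 0 \<le> r \<Longrightarrow> r \<le> 1 \<Longrightarrow> (\<lambda>x. f x (r * v x)) \<in> borel_measurable (lebesgue_on S)"
  shows "(\<lambda>x. pot (f x) (v x)) \<in> borel_measurable (lebesgue_on S)"
proof (rule borel_measurable_lebesgue_on_AE_limit[OF S])
  fix n :: nat
  have "(\<lambda>x. f x (real k / real (Suc n) * v x)) \<in> borel_measurable (lebesgue_on S)" if "k < Suc n" for k
    using that by (intro f) auto
  then show "(\<lambda>x. (\<Sum>k<Suc n. v x * f x (real k / real (Suc n) * v x)) / real (Suc n)) \<in> borel_measurable (lebesgue_on S)"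
    using v by (intro borel_measurable_divide borel_measurable_sum borel_measurable_times) auto
next
  show "AE x in lebesgue_on S. (\<lambda>n. (\<Sum>k<Suc n. v x * f x (real k / real (Suc n) * v x)) / real (Suc n)) \<longlonglongrightarrow> pot (f x) (v x)"
    using c
  proof eventually_elim
    case (elim x)
    then have c: "continuous_on UNIV (f x)" and m: "mono (f x)" by auto
    show ?case unfolding pot_def
    proof (rule riemann_sum_tendsto[of "\<lambda>r. v x * f x (r * v x)"])
      show "continuous_on {0..1} (\<lambda>r. v x * f x (r * v x))"
        by (intro continuous_intros continuous_on_compose2[OF c]) auto
      \<comment> \<open>For a negative \<open>v x\<close> the inner factor and the outer one both
        reverse the order, so the integrand increases in \<open>r\<close> for either sign.\<close>
      show "mono_on {0..1} (\<lambda>r. v x * f x (r * v x))"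
      proof (rule mono_onI)
        fix r s :: real assume "r \<le> s"
        show "v x * f x (r * v x) \<le> v x * f x (s * v x)"
        proof (cases "v x \<ge> 0")
          case True
          then show ?thesis using \<open>r \<le> s\<close> by (intro mult_left_mono monoD[OF m] mult_right_mono) auto
        next
          case False
          then show ?thesis using \<open>r \<le> s\<close> by (intro mult_left_mono_neg monoD[OF m] mult_right_mono_neg) auto
        qed
      qed
    qed
  qed
qed

text \<open>An exhaustion of \<open>\<Omega>\<close> by compact sets presents \<open>G\<close> on
  \<open>\<Omega>\<close> as a pointwise limit of functions that local integrability makes
  measurable.\<close>

lemma locally_integrable_measurable:
  fixes G :: "'a::euclidean_space \<Rightarrow> 'b::euclidean_space"
  assumes "open \<Omega>" "locally_integrable \<Omega> G"
  shows "G \<in> borel_measurable (lebesgue_on \<Omega>)"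
proof -
  have \<Omega>: "\<Omega> \<in> sets lebesgue" using assms by (simp add: lmeasurable_open sets_completionI_sets)
  obtain C where C: "\<And>n::nat. compact (C n)" "\<And>n. C n \<subseteq> \<Omega>" "\<And>n. C n \<subseteq> interior (C (Suc n))" "\<Union>(range C) = \<Omega>"
    "\<And>K. compact K \<Longrightarrow> K \<subseteq> \<Omega> \<Longrightarrow> \<exists>N. \<forall>n\<ge>N. K \<subseteq> C n"
    by (rule open_Union_compact_subsets[OF assms(1)]) (rule that)
  have m: "(\<lambda>x. indicator (C n) x *\<^sub>R G x) \<in> borel_measurable lebesgue" for n
    using locally_integrableD[OF assms(2) C(1,2)] by auto
  have mono: "C n \<subseteq> C (Suc n)" for n using C(3)[of n] interior_subset by blast
  have "(\<lambda>n. indicator (C n) x *\<^sub>R G x) \<longlonglongrightarrow> (if x \<in> \<Omega> then G x else 0)" for x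
  proof (cases "x \<in> \<Omega>")
    case True
    then obtain N where N: "x \<in> C N" using C(4) by blast
    have "\<forall>\<^sub>F n in sequentially. G x = indicator (C n) x *\<^sub>R G x"
    proof (rule eventually_sequentiallyI)
      fix n assume "N \<le> n"
      then have "C N \<subseteq> C n" using mono by (rule lift_Suc_mono_le[rotated])
      then show "G x = indicator (C n) x *\<^sub>R G x" using N by auto
    qed
    then show ?thesis using True by (simp add: Lim_transform_eventually[OF tendsto_const])
  next
    case False
    then have "x \<notin> C n" for n using C(2) by blast
    then show ?thesis using False by simp
  qed
  then have "(\<lambda>x. if x \<in> \<Omega> then G x else 0) \<in> borel_measurable lebesgue"
    by (rule borel_measurable_LIMSEQ_metric[OF m])
  then show ?thesis using borel_measurable_if[OF \<Omega>] by blast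
qed

section \<open>Lebesgue and Sobolev spaces with a bounded measurable exponent\<close>

locale variable_exponent =
  fixes \<Omega> :: "'a::euclidean_space set" and p :: "'a \<Rightarrow> real" and pm pM :: real
  assumes open_\<Omega>: "open \<Omega>" and bounded_\<Omega>: "bounded \<Omega>"
    and p_measurable [measurable]: "p \<in> borel_measurable (lebesgue_on \<Omega>)"
    and pm: "1 < pm" and p_bounds: "\<And>x. x \<in> \<Omega> \<Longrightarrow> pm \<le> p x" "\<And>x. x \<in> \<Omega> \<Longrightarrow> p x \<le> pM"
begin

abbreviation "M \<equiv> lebesgue_on \<Omega>"

lemma \<Omega>_measurable [measurable, simp]: "\<Omega> \<in> sets lebesgue"
  using open_\<Omega> by (simp add: lmeasurable_open sets_completionI_sets)

lemma finite_M: "finite_measure M"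
  using bounded_\<Omega> open_\<Omega> by (intro finite_measure_lebesgue_on lmeasurable_open)

lemma integrable_const_M [simp]: "integrable M (\<lambda>x. c :: real)"
  using finite_M by (simp add: finite_measure.integrable_const)

lemma integrable_AE_bounded:
  fixes f g :: "'a \<Rightarrow> real"
  assumes "integrable M f" "g \<in> borel_measurable M" "AE x in M. \<bar>g x\<bar> \<le> f x"
  shows "integrable M g"
  by (rule Bochner_Integration.integrable_bound[OF assms(1,2)]) (use assms(3) in eventually_elim, auto)

lemma Lp_measurable: "u \<in> lebesgue_space \<Omega> q \<Longrightarrow> u \<in> borel_measurable M"
  by (simp add: lebesgue_space_def)

lemma Lp_I:
  assumes [measurable]: "u \<in> borel_measurable M" and f: "integrable M f" and le: "AE x in M. \<bar>u x\<bar> powr p x \<le> f x"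
  shows "u \<in> lebesgue_space \<Omega> p"
proof -
  have "integrable M (\<lambda>x. \<bar>u x\<bar> powr p x)"
  proof (rule integrable_AE_bounded[OF f])
    show "(\<lambda>x. \<bar>u x\<bar> powr p x) \<in> borel_measurable M" by measurable
    show "AE x in M. \<bar>\<bar>u x\<bar> powr p x\<bar> \<le> f x" using le by simp
  qed
  then show ?thesis using assms(1) by (simp add: lebesgue_space_def)
qed

lemma p_pos: "x \<in> \<Omega> \<Longrightarrow> 0 < p x" "x \<in> \<Omega> \<Longrightarrow> 1 < p x"
  using p_bounds(1)[of x] pm by auto

lemma Lp_dominated:
  assumes "u \<in> lebesgue_space \<Omega> p" "v \<in> borel_measurable M" "AE x in M. \<bar>v x\<bar> \<le> \<bar>u x\<bar>"
  shows "v \<in> lebesgue_space \<Omega> p"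
proof (rule Lp_I[OF assms(2)])
  show "integrable M (\<lambda>x. \<bar>u x\<bar> powr p x)" using assms(1) by (simp add: lebesgue_space_def)
  show "AE x in M. \<bar>v x\<bar> powr p x \<le> \<bar>u x\<bar> powr p x"
    using assms(3) AE_space[of M] by eventually_elim (auto intro!: powr_mono2 dest: p_pos)
qed

lemma powr_p_add_le:
  assumes "x \<in> \<Omega>" "0 \<le> a" "0 \<le> b"
  shows "(a + b) powr p x \<le> 2 powr pM * (a powr p x + b powr p x)"
proof -
  have p: "0 < p x" "p x \<le> pM" using p_pos[OF assms(1)] p_bounds[OF assms(1)] by auto
  have "(a + b) powr p x \<le> (2 * max a b) powr p x" using assms p by (intro powr_mono2) auto
  also have "\<dots> = 2 powr p x * max a b powr p x" using assms by (simp add: powr_mult)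
  also have "\<dots> \<le> 2 powr pM * (a powr p x + b powr p x)"
    using p by (intro mult_mono powr_mono) (auto simp: max_def)
  finally show ?thesis .
qed

lemma Lp_add:
  assumes "u \<in> lebesgue_space \<Omega> p" "v \<in> lebesgue_space \<Omega> p"
  shows "(\<lambda>x. u x + v x) \<in> lebesgue_space \<Omega> p"
proof (rule Lp_I)
  show "(\<lambda>x. u x + v x) \<in> borel_measurable M" using assms by (auto simp: lebesgue_space_def)
  show "integrable M (\<lambda>x. 2 powr pM * (\<bar>u x\<bar> powr p x + \<bar>v x\<bar> powr p x))"
    using assms by (auto simp: lebesgue_space_def)
  show "AE x in M. \<bar>u x + v x\<bar> powr p x \<le> 2 powr pM * (\<bar>u x\<bar> powr p x + \<bar>v x\<bar> powr p x)"
  proof (rule AE_I2)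
    fix x assume "x \<in> space M"
    then have x: "x \<in> \<Omega>" by simp
    have "\<bar>u x + v x\<bar> powr p x \<le> (\<bar>u x\<bar> + \<bar>v x\<bar>) powr p x"
      using p_pos[OF x] by (intro powr_mono2) auto
    also have "\<dots> \<le> 2 powr pM * (\<bar>u x\<bar> powr p x + \<bar>v x\<bar> powr p x)" by (rule powr_p_add_le[OF x]) auto
    finally show "\<bar>u x + v x\<bar> powr p x \<le> \<dots>" .
  qed
qed

lemma Lp_cmult:
  assumes "u \<in> lebesgue_space \<Omega> p"
  shows "(\<lambda>x. c * u x) \<in> lebesgue_space \<Omega> p"
proof (rule Lp_I)
  show "(\<lambda>x. c * u x) \<in> borel_measurable M" using assms by (auto simp: lebesgue_space_def)
  \<comment> \<open>A base of at least 1 makes the power increasing in the exponent, hence bounded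
    by the power with \<open>pM\<close> uniformly in \<open>x\<close>.\<close>
  show "integrable M (\<lambda>x. (1 + \<bar>c\<bar>) powr pM * \<bar>u x\<bar> powr p x)"
    using assms by (auto simp: lebesgue_space_def)
  show "AE x in M. \<bar>c * u x\<bar> powr p x \<le> (1 + \<bar>c\<bar>) powr pM * \<bar>u x\<bar> powr p x"
  proof (rule AE_I2)
    fix x assume "x \<in> space M"
    then have x: "x \<in> \<Omega>" by simp
    have "\<bar>c\<bar> powr p x \<le> (1 + \<bar>c\<bar>) powr p x" using p_pos[OF x] by (intro powr_mono2) auto
    also have "\<dots> \<le> (1 + \<bar>c\<bar>) powr pM" using p_bounds(2)[OF x] by (intro powr_mono) auto
    finally show "\<bar>c * u x\<bar> powr p x \<le> (1 + \<bar>c\<bar>) powr pM * \<bar>u x\<bar> powr p x"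
      by (simp add: abs_mult powr_mult mult_right_mono)
  qed
qed

lemma Lp_const: "(\<lambda>x. c) \<in> lebesgue_space \<Omega> p"
proof (rule Lp_I)
  show "integrable M (\<lambda>x. (1 + \<bar>c\<bar>) powr pM)" by simp
  show "AE x in M. \<bar>c\<bar> powr p x \<le> (1 + \<bar>c\<bar>) powr pM"
  proof (rule AE_I2)
    fix x assume "x \<in> space M"
    then have x: "x \<in> \<Omega>" by simp
    have "\<bar>c\<bar> powr p x \<le> (1 + \<bar>c\<bar>) powr p x" using p_pos[OF x] by (intro powr_mono2) auto
    also have "\<dots> \<le> (1 + \<bar>c\<bar>) powr pM" using p_bounds(2)[OF x] by (intro powr_mono) auto
    finally show "\<bar>c\<bar> powr p x \<le> (1 + \<bar>c\<bar>) powr pM" .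
  qed
qed simp

lemma abs_le_1_powr: "x \<in> \<Omega> \<Longrightarrow> \<bar>s\<bar> \<le> 1 + \<bar>s\<bar> powr p x"
proof (cases "\<bar>s\<bar> \<le> 1")
  case False
  assume "x \<in> \<Omega>"
  then have "\<bar>s\<bar> powr 1 \<le> \<bar>s\<bar> powr p x" using False p_pos(2)[of x] by (intro powr_mono) auto
  then show ?thesis using False by simp
qed (use powr_ge_zero[of "\<bar>s\<bar>" "p x"] in linarith)

lemma Lp_integrable:
  assumes "u \<in> lebesgue_space \<Omega> p"
  shows "integrable M u"
proof (rule integrable_AE_bounded[of "\<lambda>x. 1 + \<bar>u x\<bar> powr p x"])
  show "AE x in M. \<bar>u x\<bar> \<le> 1 + \<bar>u x\<bar> powr p x"
    by (intro AE_I2) (simp add: abs_le_1_powr)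
qed (use assms in \<open>simp_all add: lebesgue_space_def\<close>)

text \<open>Young's inequality with constants 1. The comparison of \<open>b\<close> with
  \<open>a powr (p x - 1)\<close> decides which of the two powers alone dominates the
  product.\<close>

lemma young:
  assumes x: "x \<in> \<Omega>" and "0 \<le> a" "0 \<le> b"
  shows "a * b \<le> a powr p x + b powr conj_exponent p x"
proof (cases "b \<le> a powr (p x - 1)")
  case True
  have "a * b \<le> a * a powr (p x - 1)" using True assms by (intro mult_left_mono)
  also have "\<dots> = a powr p x"
    using assms p_pos[OF x] by (cases "a = 0") (auto simp: powr_mult_base)
  finally show ?thesis using powr_ge_zero[of b "conj_exponent p x"] by linarith
next
  case False
  then have b: "b > 0" using powr_ge_zero[of a "p x - 1"] by linarith
  have p1: "p x - 1 > 0" using p_pos[OF x] by simp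
  have "a = (a powr (p x - 1)) powr (1 / (p x - 1))"
    using assms p1 by (cases "a = 0") (auto simp: powr_powr)
  also have "\<dots> \<le> b powr (1 / (p x - 1))" using False p1 by (intro powr_mono2) auto
  finally have "a * b \<le> b powr (1 / (p x - 1)) * b" using b by (intro mult_right_mono) auto
  also have "\<dots> = b powr conj_exponent p x"
  proof -
    have "b powr (1 / (p x - 1)) * b = b powr (1 / (p x - 1)) * b powr 1" using b by simp
    also have "\<dots> = b powr (1 / (p x - 1) + 1)" by (rule powr_add[symmetric])
    also have "1 / (p x - 1) + 1 = conj_exponent p x" using p1 by (simp add: conj_exponent_def field_simps)
    finally show ?thesis .
  qed
  finally show ?thesis using powr_ge_zero[of a "p x"] by linarith
qed

lemma Lp_mult_integrable:
  assumes "u \<in> lebesgue_space \<Omega> p" "w \<in> lebesgue_space \<Omega> (conj_exponent p)"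
  shows "integrable M (\<lambda>x. u x * w x)"
proof (rule integrable_AE_bounded)
  show "integrable M (\<lambda>x. \<bar>u x\<bar> powr p x + \<bar>w x\<bar> powr conj_exponent p x)"
    using assms by (auto simp: lebesgue_space_def)
  show "AE x in M. \<bar>u x * w x\<bar> \<le> \<bar>u x\<bar> powr p x + \<bar>w x\<bar> powr conj_exponent p x"
    unfolding abs_mult by (intro AE_I2 young) auto
qed (use assms in \<open>auto simp: lebesgue_space_def\<close>)

lemma sob_measurable:
  assumes "sobolev_gradient \<Omega> p V G"
  shows "V \<in> borel_measurable M" "G \<in> borel_measurable M"
  using assms locally_integrable_measurable[OF open_\<Omega>, of G]
  by (auto simp: sobolev_gradient_def has_weak_gradient_def lebesgue_space_def)

lemma sob_lincomb:
  assumes "sobolev_gradient \<Omega> p V G" "sobolev_gradient \<Omega> p W H"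
  shows "sobolev_gradient \<Omega> p (\<lambda>x. a * V x + b * W x) (\<lambda>x. a *\<^sub>R G x + b *\<^sub>R H x)"
  unfolding sobolev_gradient_def
proof (intro conjI)
  note m = sob_measurable[OF assms(1)] sob_measurable[OF assms(2)]
  show "(\<lambda>x. a * V x + b * W x) \<in> lebesgue_space \<Omega> p"
    using assms by (intro Lp_add Lp_cmult) (auto simp: sobolev_gradient_def)
  show "has_weak_gradient \<Omega> (\<lambda>x. a * V x + b * W x) (\<lambda>x. a *\<^sub>R G x + b *\<^sub>R H x)"
    using assms by (intro has_weak_gradient_lincomb) (auto simp: sobolev_gradient_def)
  have "(\<lambda>x. \<bar>a\<bar> * norm (G x) + \<bar>b\<bar> * norm (H x)) \<in> lebesgue_space \<Omega> p"
    using assms by (intro Lp_add Lp_cmult) (auto simp: sobolev_gradient_def)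
  then show "(\<lambda>x. norm (a *\<^sub>R G x + b *\<^sub>R H x)) \<in> lebesgue_space \<Omega> p"
  proof (rule Lp_dominated)
    show "(\<lambda>x. norm (a *\<^sub>R G x + b *\<^sub>R H x)) \<in> borel_measurable M" using m by measurable
    show "AE x in M. \<bar>norm (a *\<^sub>R G x + b *\<^sub>R H x)\<bar> \<le> \<bar>\<bar>a\<bar> * norm (G x) + \<bar>b\<bar> * norm (H x)\<bar>"
    proof (rule AE_I2)
      show "\<bar>norm (a *\<^sub>R G x + b *\<^sub>R H x)\<bar> \<le> \<bar>\<bar>a\<bar> * norm (G x) + \<bar>b\<bar> * norm (H x)\<bar>" for x
        using norm_triangle_ineq[of "a *\<^sub>R G x" "b *\<^sub>R H x"] by simp
    qed
  qed
qed

lemma sob_const: "sobolev_gradient \<Omega> p (\<lambda>x. c) (\<lambda>x. 0)"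
  unfolding sobolev_gradient_def using Lp_const[of c] Lp_const[of 0] has_weak_gradient_const[OF \<Omega>_measurable] by auto

lemma sob_clip:
  assumes "sobolev_gradient \<Omega> p V G" "l \<le> h"
  shows "sobolev_gradient \<Omega> p (\<lambda>x. clip l h (V x)) (\<lambda>x. if l < V x \<and> V x \<le> h then G x else 0)"
  unfolding sobolev_gradient_def
proof (intro conjI)
  note m [measurable] = sob_measurable[OF assms(1)]
  have cm: "(\<lambda>x. clip l h (V x)) \<in> borel_measurable M" unfolding clip_def by measurable
  have "(\<lambda>x. \<bar>l\<bar> + \<bar>h\<bar>) \<in> lebesgue_space \<Omega> p" by (rule Lp_const)
  then show "(\<lambda>x. clip l h (V x)) \<in> lebesgue_space \<Omega> p"
    by (rule Lp_dominated[OF _ cm]) (auto simp: clip_def)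
  show "has_weak_gradient \<Omega> (\<lambda>x. clip l h (V x)) (\<lambda>x. if l < V x \<and> V x \<le> h then G x else 0)"
    using assms by (intro has_weak_gradient_clip open_\<Omega>) (auto simp: sobolev_gradient_def)
  have "(\<lambda>x. norm (G x)) \<in> lebesgue_space \<Omega> p" using assms by (simp add: sobolev_gradient_def)
  then show "(\<lambda>x. norm (if l < V x \<and> V x \<le> h then G x else 0)) \<in> lebesgue_space \<Omega> p"
  proof (rule Lp_dominated)
    show "(\<lambda>x. norm (if l < V x \<and> V x \<le> h then G x else 0)) \<in> borel_measurable M" by measurable
    show "AE x in M. \<bar>norm (if l < V x \<and> V x \<le> h then G x else 0)\<bar> \<le> \<bar>norm (G x)\<bar>" by (intro AE_I2) simp
  qed
qed

lemma sob_pos_part: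
  assumes "sobolev_gradient \<Omega> p V G"
  shows "sobolev_gradient \<Omega> p (\<lambda>x. max (V x) 0) (\<lambda>x. if 0 < V x then G x else 0)"
  unfolding sobolev_gradient_def
proof (intro conjI)
  note m [measurable] = sob_measurable[OF assms(1)]
  have "V \<in> lebesgue_space \<Omega> p" using assms by (simp add: sobolev_gradient_def)
  then show "(\<lambda>x. max (V x) 0) \<in> lebesgue_space \<Omega> p"
  proof (rule Lp_dominated)
    show "(\<lambda>x. max (V x) 0) \<in> borel_measurable M" by measurable
    show "AE x in M. \<bar>max (V x) 0\<bar> \<le> \<bar>V x\<bar>" by (intro AE_I2) (simp add: max_def)
  qed
  show "has_weak_gradient \<Omega> (\<lambda>x. max (V x) 0) (\<lambda>x. if 0 < V x then G x else 0)"
    using assms by (intro has_weak_gradient_pos_part open_\<Omega>) (auto simp: sobolev_gradient_def)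
  have "(\<lambda>x. norm (G x)) \<in> lebesgue_space \<Omega> p" using assms by (simp add: sobolev_gradient_def)
  then show "(\<lambda>x. norm (if 0 < V x then G x else 0)) \<in> lebesgue_space \<Omega> p"
  proof (rule Lp_dominated)
    show "(\<lambda>x. norm (if 0 < V x then G x else 0)) \<in> borel_measurable M" by measurable
    show "AE x in M. \<bar>norm (if 0 < V x then G x else 0)\<bar> \<le> \<bar>norm (G x)\<bar>" by (intro AE_I2) simp
  qed
qed

end

section \<open>Convergence of near-minimizing sequences\<close>

text \<open>Let \<open>\<beta> k\<close> be the infimum of \<open>T\<close> on the sublevel set of
  \<open>J\<close> at height \<open>m + 1 / (k + 1)\<close>. It increases with \<open>k\<close> and
  is bounded by \<open>C\<close>; let \<open>\<beta>'\<close> be its supremum. Points nearly optimal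
  for \<open>T\<close> on late sublevel sets have \<open>T\<close> below
  \<open>\<beta>' + e n\<close>, while their midpoint stays in the sublevel set and so has
  \<open>T\<close> above \<open>\<beta>' - e n\<close>. This forces a small convexity gap of
  \<open>T\<close>, although of \<open>J\<close> only quasi-convexity along midpoints is
  known.\<close>

lemma near_minimizing_sequence:
  fixes J T :: "'x \<Rightarrow> real" and mid :: "'x \<Rightarrow> 'x \<Rightarrow> 'x" and e :: "nat \<Rightarrow> real"
  assumes X: "X \<noteq> {}" and J: "\<And>x. x \<in> X \<Longrightarrow> b \<le> J x" and T: "\<And>x. x \<in> X \<Longrightarrow> 0 \<le> T x"
    and mid: "\<And>x y. x \<in> X \<Longrightarrow> y \<in> X \<Longrightarrow> mid x y \<in> X"
    and Jmid: "\<And>x y. x \<in> X \<Longrightarrow> y \<in> X \<Longrightarrow> J (mid x y) \<le> max (J x) (J y)"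
    and C: "\<And>x. x \<in> X \<Longrightarrow> J x \<le> Inf (J ` X) + 1 \<Longrightarrow> T x \<le> C"
    and e: "\<And>n. 0 < e n" "decseq e"
  obtains s where "\<And>n. s n \<in> X" "\<And>n. J (s n) \<le> Inf (J ` X) + 1 / real (Suc n)"
    "\<And>n. (T (s n) + T (s (Suc n))) / 2 - T (mid (s n) (s (Suc n))) \<le> 2 * e n"
proof -
  define m where "m = Inf (J ` X)"
  define L where "L k = {x \<in> X. J x \<le> m + 1 / real (Suc k)}" for k
  define \<beta> where "\<beta> k = Inf (T ` L k)" for k
  have bdd: "bdd_below (J ` X)" using J by (auto simp: bdd_below_def)
  have L_ne: "L k \<noteq> {}" for k
  proof -
    have "Inf (J ` X) < m + 1 / real (Suc k)" by (simp add: m_def)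
    then obtain y where "y \<in> J ` X" "y < m + 1 / real (Suc k)"
      using cInf_less_iff[of "J ` X"] X bdd by auto
    then show ?thesis by (auto simp: L_def less_imp_le)
  qed
  have L_mono: "L l \<subseteq> L k" if "k \<le> l" for k l
  proof -
    have "1 / real (Suc l) \<le> 1 / real (Suc k)" using that by (simp add: frac_le)
    then show ?thesis unfolding L_def by auto
  qed
  have Tbdd: "bdd_below (T ` L k)" for k using T by (auto simp: bdd_below_def L_def)
  have \<beta>_le: "\<beta> k \<le> T x" if "x \<in> L k" for k x
    unfolding \<beta>_def using that Tbdd by (intro cInf_lower) auto
  have \<beta>_mono: "\<beta> k \<le> \<beta> l" if "k \<le> l" for k l
    unfolding \<beta>_def using L_ne L_mono[OF that] Tbdd by (intro cInf_superset_mono) auto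
  have \<beta>_C: "\<beta> k \<le> C" for k
  proof -
    obtain x where x: "x \<in> L k" using L_ne by blast
    have "1 / real (Suc k) \<le> 1" by simp
    moreover have "x \<in> X" "J x \<le> Inf (J ` X) + 1 / real (Suc k)" using x unfolding L_def m_def by blast+
    ultimately have "T x \<le> C" by (intro C) linarith+
    then show ?thesis using \<beta>_le[OF x] by linarith
  qed
  define \<beta>' where "\<beta>' = Sup (range \<beta>)"
  have bb: "bdd_above (range \<beta>)" using \<beta>_C by (auto simp: bdd_above_def)
  have \<beta>': "\<beta> k \<le> \<beta>'" for k unfolding \<beta>'_def using bb by (intro cSup_upper) auto
  have "\<forall>n. \<exists>k. \<beta>' - e n < \<beta> k"
  proof
    fix n
    have "\<beta>' - e n < Sup (range \<beta>)" using e(1)[of n] by (simp add: \<beta>'_def)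
    then show "\<exists>k. \<beta>' - e n < \<beta> k" using less_cSup_iff[OF _ bb] by auto
  qed
  from choice[OF this] obtain \<kappa> where \<kappa>: "\<And>n. \<beta>' - e n < \<beta> (\<kappa> n)" by blast
  \<comment> \<open>The sum makes \<open>k\<close> increasing, so that \<open>s (Suc n)\<close>
    still lies in the sublevel set belonging to \<open>n\<close>; it is at least \<open>n\<close>,
    for the rate of \<open>J\<close>, and at least \<open>\<kappa> n\<close>, for the rate of
    \<open>T\<close>.\<close>
  define k where "k n = n + (\<Sum>i\<le>n. \<kappa> i)" for n
  have k: "n \<le> k n" "\<kappa> n \<le> k n" "k n \<le> k (Suc n)" for n
    by (auto simp: k_def intro: order_trans[OF member_le_sum[of n "{..n}" \<kappa>]])
  have k\<beta>: "\<beta>' - e n < \<beta> (k n)" for n using \<kappa>[of n] \<beta>_mono[OF k(2), of n] by linarith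
  have "\<forall>n. \<exists>x. x \<in> L (k n) \<and> T x < \<beta> (k n) + e n"
  proof
    fix n
    have "Inf (T ` L (k n)) < \<beta> (k n) + e n" using e(1)[of n] by (simp add: \<beta>_def)
    then show "\<exists>x. x \<in> L (k n) \<and> T x < \<beta> (k n) + e n"
      using cInf_less_iff[of "T ` L (k n)"] L_ne[of "k n"] Tbdd[of "k n"] by auto
  qed
  from choice[OF this] obtain s where s: "\<And>n. s n \<in> L (k n)" "\<And>n. T (s n) < \<beta> (k n) + e n" by blast
  show ?thesis
  proof (rule that)
    show sX: "s n \<in> X" for n using s(1)[of n] by (simp add: L_def)
    show "J (s n) \<le> Inf (J ` X) + 1 / real (Suc n)" for n
      using L_mono[OF k(1)[of n]] s(1)[of n] unfolding L_def m_def by blast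
    fix n
    have sn: "s (Suc n) \<in> L (k n)" using L_mono[OF k(3)[of n]] s(1)[of "Suc n"] by blast
    have "mid (s n) (s (Suc n)) \<in> L (k n)"
      using mid[OF sX sX, of n "Suc n"] Jmid[OF sX sX, of n "Suc n"] s(1)[of n] sn by (auto simp: L_def)
    then have "\<beta>' - e n < T (mid (s n) (s (Suc n)))" using \<beta>_le k\<beta>[of n] by fastforce
    moreover have "T (s n) < \<beta>' + e n" "T (s (Suc n)) < \<beta>' + e (Suc n)"
      using s(2) \<beta>' by (smt (verit))+
    moreover have "e (Suc n) \<le> e n" using e(2) by (simp add: decseq_SucD)
    ultimately show "(T (s n) + T (s (Suc n))) / 2 - T (mid (s n) (s (Suc n))) \<le> 2 * e n" by (simp add: field_simps)
  qed
qed

text \<open>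
  A quantitative strict convexity of \<open>\<xi> \<mapsto> \<surd>(1 + |\<xi>|\<^sup>2)\<close>: with \<open>X, Y, Z\<close> its values at \<open>\<xi>\<close>, \<open>\<eta>\<close> and
  the midpoint, \<open>(X + Y)\<^sup>2 - (2Z)\<^sup>2 = 2 (XY - 1 - \<xi> \<bullet> \<eta>)\<close>.
\<close>

lemma sqrt_one_plus_norm_gap:
  fixes \<xi> \<eta> :: "'a::real_inner"
  assumes "sqrt (1 + (norm \<xi>)\<^sup>2) \<le> R" "sqrt (1 + (norm \<eta>)\<^sup>2) \<le> R"
  shows "(norm (\<xi> - \<eta>))\<^sup>2 \<le> 8 * R^3 * ((sqrt (1 + (norm \<xi>)\<^sup>2) + sqrt (1 + (norm \<eta>)\<^sup>2)) / 2
          - sqrt (1 + (norm ((1/2) *\<^sub>R \<xi> + (1/2) *\<^sub>R \<eta>))\<^sup>2))"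
    and "0 \<le> (sqrt (1 + (norm \<xi>)\<^sup>2) + sqrt (1 + (norm \<eta>)\<^sup>2)) / 2
          - sqrt (1 + (norm ((1/2) *\<^sub>R \<xi> + (1/2) *\<^sub>R \<eta>))\<^sup>2)"
proof -
  define X Y Z where "X = sqrt (1 + (norm \<xi>)\<^sup>2)" "Y = sqrt (1 + (norm \<eta>)\<^sup>2)"
    "Z = sqrt (1 + (norm ((1/2) *\<^sub>R \<xi> + (1/2) *\<^sub>R \<eta>))\<^sup>2)"
  define q where "q = 1 + \<xi> \<bullet> \<eta>"
  define N where "N = (norm (\<xi> - \<eta>))\<^sup>2"
  have sq: "X\<^sup>2 = 1 + \<xi> \<bullet> \<xi>" "Y\<^sup>2 = 1 + \<eta> \<bullet> \<eta>" "4 * Z\<^sup>2 = 4 + \<xi> \<bullet> \<xi> + \<eta> \<bullet> \<eta> + 2 * (\<xi> \<bullet> \<eta>)"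
  proof -
    have "X\<^sup>2 = 1 + (norm \<xi>)\<^sup>2" "Y\<^sup>2 = 1 + (norm \<eta>)\<^sup>2" "Z\<^sup>2 = 1 + (norm ((1/2) *\<^sub>R \<xi> + (1/2) *\<^sub>R \<eta>))\<^sup>2"
      unfolding X_Y_Z_def by (auto intro!: real_sqrt_pow2)
    then show "X\<^sup>2 = 1 + \<xi> \<bullet> \<xi>" "Y\<^sup>2 = 1 + \<eta> \<bullet> \<eta>" "4 * Z\<^sup>2 = 4 + \<xi> \<bullet> \<xi> + \<eta> \<bullet> \<eta> + 2 * (\<xi> \<bullet> \<eta>)"
      by (auto simp: power2_norm_eq_inner inner_add_left inner_add_right inner_commute[of \<eta> \<xi>] algebra_simps)
  qed
  have N: "N = \<xi> \<bullet> \<xi> + \<eta> \<bullet> \<eta> - 2 * (\<xi> \<bullet> \<eta>)"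
    unfolding N_def by (simp add: power2_norm_eq_inner inner_diff_left inner_diff_right inner_commute[of \<eta> \<xi>])
  have pos: "X \<ge> 1" "Y \<ge> 1" "Z \<ge> 1" unfolding X_Y_Z_def by auto
  have R: "X \<le> R" "Y \<le> R" using assms by (auto simp: X_Y_Z_def)
  have CS: "(\<xi> \<bullet> \<eta>)\<^sup>2 \<le> (\<xi> \<bullet> \<xi>) * (\<eta> \<bullet> \<eta>)" by (rule Cauchy_Schwarz_ineq)
  \<comment> \<open>The difference of the two sides is \<open>(\<xi> \<bullet> \<xi>) * (\<eta>
    \<bullet> \<eta>) - (\<xi> \<bullet> \<eta>)\<^sup>2\<close>, so this is Cauchy-Schwarz.\<close>
  have "N + q\<^sup>2 \<le> X\<^sup>2 * Y\<^sup>2"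
    unfolding sq N q_def using CS by (simp add: power2_eq_square algebra_simps)
  then have prod: "N \<le> (X * Y - q) * (X * Y + q)" by (simp add: algebra_simps power2_eq_square)
  have N0: "N \<ge> 0" by (simp add: N_def)
  have "q\<^sup>2 \<le> (X * Y)\<^sup>2" using \<open>N + q\<^sup>2 \<le> X\<^sup>2 * Y\<^sup>2\<close> N0 by (simp add: power_mult_distrib)
  then have q: "\<bar>q\<bar> \<le> X * Y" using pos by (metis abs_le_square_iff abs_of_nonneg mult_nonneg_nonneg order_trans zero_le_one)
  have XY: "X * Y \<le> R * R" using R pos by (intro mult_mono) auto
  have dd: "(X + Y - 2 * Z) * (X + Y + 2 * Z) = 2 * (X * Y - q)"
    using sq by (simp add: algebra_simps power2_eq_square q_def)
  have s: "X + Y + 2 * Z > 0" using pos by linarith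
  have d0: "0 \<le> X + Y - 2 * Z"
  proof (rule ccontr)
    assume "\<not> ?thesis"
    then have "(X + Y - 2 * Z) * (X + Y + 2 * Z) < 0" using s by (simp add: mult_neg_pos)
    moreover have "0 \<le> (X + Y - 2 * Z) * (X + Y + 2 * Z)"
      unfolding dd using order_trans[OF abs_ge_self q] by simp
    ultimately show False by (meson leD)
  qed
  \<comment> \<open>Two factors are estimated: \<open>X * Y + q\<close> by
    \<open>2 * (R * R)\<close>, and \<open>X + Y + 2 * Z\<close> by \<open>4 * R\<close> since
    \<open>2 * Z \<le> X + Y\<close>; together they make up \<open>8 * R^3\<close>.\<close>
  have "N \<le> (X * Y - q) * (2 * (R * R))"
    using prod q XY by (intro order_trans[OF prod] mult_left_mono) auto
  also have "\<dots> = (R * R) * ((X + Y - 2 * Z) * (X + Y + 2 * Z))" using dd by simp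
  also have "\<dots> \<le> (R * R) * ((X + Y - 2 * Z) * (4 * R))"
    using d0 R by (intro mult_left_mono) auto
  also have "\<dots> = 8 * R^3 * ((X + Y) / 2 - Z)" by (simp add: power3_eq_cube algebra_simps)
  finally show "(norm (\<xi> - \<eta>))\<^sup>2 \<le> 8 * R^3 * ((sqrt (1 + (norm \<xi>)\<^sup>2) + sqrt (1 + (norm \<eta>)\<^sup>2)) / 2
          - sqrt (1 + (norm ((1/2) *\<^sub>R \<xi> + (1/2) *\<^sub>R \<eta>))\<^sup>2))"
    by (simp add: X_Y_Z_def N_def)
  show "0 \<le> (sqrt (1 + (norm \<xi>)\<^sup>2) + sqrt (1 + (norm \<eta>)\<^sup>2)) / 2
          - sqrt (1 + (norm ((1/2) *\<^sub>R \<xi> + (1/2) *\<^sub>R \<eta>))\<^sup>2)"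
    using d0 by (simp add: X_Y_Z_def)
qed

text \<open>Divided by \<open>(2 * q)^n\<close> the functions have integrals of at most
  \<open>c * (1/2)^n\<close>, so their series is finite almost everywhere and bounds each term. The
  factor 2 is the price of passing from a rate in the mean to a pointwise one.\<close>

lemma AE_geometric_bound:
  fixes f :: "nat \<Rightarrow> 'a \<Rightarrow> real"
  assumes f: "\<And>n. integrable M (f n)" "\<And>n. AE x in M. 0 \<le> f n x" and q: "q > 0" and c: "\<And>n. (LINT x|M. f n x) \<le> c * q^n"
  shows "AE x in M. \<exists>C. \<forall>n. f n x \<le> C * (2 * q)^n"
proof -
  define g where "g n x = f n x / (2 * q)^n" for n x
  have g: "integrable M (g n)" for n unfolding g_def using f by auto
  have [measurable]: "g n \<in> borel_measurable M" for n using g by auto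
  have g0: "AE x in M. 0 \<le> g n x" for n
    using f(2)[of n] by eventually_elim (use q in \<open>simp add: g_def\<close>)
  have gi: "(LINT x|M. g n x) \<le> c * (1/2)^n" for n
  proof -
    have "(LINT x|M. g n x) = (LINT x|M. f n x) / (2 * q)^n" by (simp add: g_def)
    also have "\<dots> \<le> c * q^n / (2 * q)^n" using q by (intro divide_right_mono c) auto
    also have "\<dots> = c * (1/2)^n" using q by (simp add: power_mult_distrib power_divide)
    finally show ?thesis .
  qed
  have "(\<integral>\<^sup>+x. (\<Sum>n. ennreal (g n x)) \<partial>M) = (\<Sum>n. \<integral>\<^sup>+x. ennreal (g n x) \<partial>M)"
    by (rule nn_integral_suminf) measurable
  also have "\<dots> \<le> (\<Sum>n. ennreal (c * (1/2)^n))"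
  proof (rule suminf_le)
    show "(\<integral>\<^sup>+x. ennreal (g n x) \<partial>M) \<le> ennreal (c * (1/2)^n)" for n
      using gi[of n] by (subst nn_integral_eq_integral[OF g g0]) (rule ennreal_leI)
  qed auto
  also have "\<dots> < \<infinity>"
  proof -
    have c0: "c \<ge> 0" using gi[of 0] integral_nonneg_AE[OF g0[of 0]] by simp
    have "summable (\<lambda>n. c * (1/2)^n)" by (intro summable_mult summable_geometric) auto
    then show ?thesis using c0 by (subst suminf_ennreal2) auto
  qed
  finally have "(\<integral>\<^sup>+x. (\<Sum>n. ennreal (g n x)) \<partial>M) \<noteq> \<infinity>" by simp
  then have "AE x in M. (\<Sum>n. ennreal (g n x)) \<noteq> \<infinity>" by (intro nn_integral_noteq_infinite) auto
  then show ?thesis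
  proof eventually_elim
    case (elim x)
    obtain C where C: "C \<ge> 0" "(\<Sum>n. ennreal (g n x)) = ennreal C"
      using elim by (cases "(\<Sum>n. ennreal (g n x))") auto
    have "g n x \<le> C" for n
    proof -
      have "ennreal (g n x) \<le> (\<Sum>n. ennreal (g n x))"
        using sum_le_suminf[of "\<lambda>n. ennreal (g n x)" "{n}"] by simp
      then show ?thesis using C by (cases "g n x \<ge> 0") auto
    qed
    then have "f n x \<le> C * (2 * q)^n" for n
      using q by (simp add: g_def pos_divide_le_eq)
    then show ?case by blast
  qed
qed

lemma geometric_increments_convergent:
  fixes x :: "nat \<Rightarrow> 'a::banach"
  assumes "\<And>n. norm (x n - x (Suc n)) \<le> C * (1/2)^n"
  shows "convergent x"
proof -
  have "summable (\<lambda>n. C * (1/2)^n)" by (intro summable_mult summable_geometric) auto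
  then have "summable (\<lambda>n. x (Suc n) - x n)"
  proof (rule summable_comparison_test'[of _ 0])
    show "norm (x (Suc n) - x n) \<le> C * (1/2)^n" for n by (subst norm_minus_commute) (rule assms)
  qed
  then have "convergent (\<lambda>n. \<Sum>k<n. x (Suc k) - x k)" by (simp add: summable_iff_convergent)
  then have "convergent (\<lambda>n. (x n - x 0) + x 0)"
    unfolding sum_lessThan_telescope by (intro convergent_add convergent_const)
  then show ?thesis by simp
qed

text \<open>Fatou's lemma with convergent upper bounds \<open>c n\<close> in place of convergent
  integrals: along a minimizing sequence the total energy is controlled, so the integral of its
  gradient part is bounded by what the other part leaves.\<close>

lemma fatou_integral:
  fixes f :: "nat \<Rightarrow> 'a \<Rightarrow> real"
  assumes f: "\<And>n. integrable M (f n)" "\<And>n. AE x in M. 0 \<le> f n x" and g: "g \<in> borel_measurable M"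
    and lim: "AE x in M. (\<lambda>n. f n x) \<longlonglongrightarrow> g x" and c: "\<And>n. (LINT x|M. f n x) \<le> c n" "c \<longlonglongrightarrow> C"
  shows "integrable M g" "(LINT x|M. g x) \<le> C"
proof -
  have g0: "AE x in M. 0 \<le> g x"
  proof -
    have "AE x in M. \<forall>n. 0 \<le> f n x" using f(2) by (simp add: AE_all_countable)
    then show ?thesis using lim
      by eventually_elim (auto intro: LIMSEQ_le_const)
  qed
  have c0: "0 \<le> c n" for n using c(1)[of n] integral_nonneg_AE[OF f(2)[of n]] by linarith
  have C0: "0 \<le> C" using LIMSEQ_le_const[OF c(2)] c0 by blast
  have "(\<integral>\<^sup>+x. ennreal (g x) \<partial>M) = (\<integral>\<^sup>+x. liminf (\<lambda>n. ennreal (f n x)) \<partial>M)"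
  proof (rule nn_integral_cong_AE)
    show "AE x in M. ennreal (g x) = liminf (\<lambda>n. ennreal (f n x))"
      using lim
    proof eventually_elim
      case (elim x)
      have "(\<lambda>n. ennreal (f n x)) \<longlonglongrightarrow> ennreal (g x)" using elim by (rule tendsto_ennrealI)
      then show ?case using lim_imp_Liminf[OF sequentially_bot] by metis
    qed
  qed
  also have "\<dots> \<le> liminf (\<lambda>n. \<integral>\<^sup>+x. ennreal (f n x) \<partial>M)"
    using f by (intro nn_integral_liminf) auto
  also have "\<dots> \<le> liminf (\<lambda>n. ennreal (c n))"
  proof (rule Liminf_mono, intro always_eventually allI)
    show "(\<integral>\<^sup>+x. ennreal (f n x) \<partial>M) \<le> ennreal (c n)" for n
      using c(1)[of n] by (subst nn_integral_eq_integral[OF f]) (rule ennreal_leI)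
  qed
  also have "\<dots> = ennreal C"
    by (rule lim_imp_Liminf[OF sequentially_bot tendsto_ennrealI[OF c(2)]])
  finally have le: "(\<integral>\<^sup>+x. ennreal (g x) \<partial>M) \<le> ennreal C" .
  show gi: "integrable M g"
    by (rule integrableI_nonneg[OF g g0]) (use le in \<open>simp add: order_le_less_trans\<close>)
  show "(LINT x|M. g x) \<le> C"
    using le C0 by (subst (asm) nn_integral_eq_integral[OF gi g0]) (simp add: ennreal_le_iff)
qed

context variable_exponent
begin

text \<open>A Vitali argument. Where |h| > N and N is at least 1, |h| is at most N^(1-pm) |h|^p, so
  a bounded modular makes the tails uniformly small because \<open>pm > 1\<close>; the functions
  clipped to the interval from -N to N are handled by dominated convergence.\<close>

lemma integral_tendsto_of_bounded_modular:
  fixes f :: "nat \<Rightarrow> 'a \<Rightarrow> real"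
  assumes f: "\<And>n. f n \<in> lebesgue_space \<Omega> p" "\<And>n. (LINT x|M. \<bar>f n x\<bar> powr p x) \<le> C"
    and g: "g \<in> borel_measurable M" and lim: "AE x in M. (\<lambda>n. f n x) \<longlonglongrightarrow> g x"
    and D: "D \<in> borel_measurable M" "\<And>x. \<bar>D x\<bar> \<le> B"
  shows "g \<in> lebesgue_space \<Omega> p" "(\<lambda>n. LINT x|M. f n x * D x) \<longlonglongrightarrow> (LINT x|M. g x * D x)"
proof -
  have [measurable]: "f n \<in> borel_measurable M" "g \<in> borel_measurable M" "D \<in> borel_measurable M" for n
    using f(1) g D by (auto simp: lebesgue_space_def)
  have fi: "integrable M (\<lambda>x. \<bar>f n x\<bar> powr p x)" for n using f(1) by (simp add: lebesgue_space_def)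
  have powlim: "AE x in M. (\<lambda>n. \<bar>f n x\<bar> powr p x) \<longlonglongrightarrow> \<bar>g x\<bar> powr p x"
    using lim AE_space[of M]
  proof eventually_elim
    case (elim x)
    then have "p x > 0" using p_pos by simp
    then show ?case using elim by (intro tendsto_powr' tendsto_rabs tendsto_const) auto
  qed
  have gm: "(\<lambda>x. \<bar>g x\<bar> powr p x) \<in> borel_measurable M" by measurable
  have gp: "integrable M (\<lambda>x. \<bar>g x\<bar> powr p x)" "(LINT x|M. \<bar>g x\<bar> powr p x) \<le> C"
    using fatou_integral[OF fi _ gm powlim f(2) tendsto_const] by auto
  show gL: "g \<in> lebesgue_space \<Omega> p" using gp g by (simp add: lebesgue_space_def)
  have B0: "0 \<le> B" using D(2)[of undefined] by linarith
  have C0: "0 \<le> C" by (rule order_trans[OF Bochner_Integration.integral_nonneg f(2)[of 0]]) simp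
  have tail: "\<bar>(LINT x|M. h x * D x) - (LINT x|M. clip (-N) N (h x) * D x)\<bar> \<le> B * N powr (1 - pm) * C"
    if h: "h \<in> lebesgue_space \<Omega> p" "(LINT x|M. \<bar>h x\<bar> powr p x) \<le> C" and N: "N \<ge> 1" for h N
  proof -
    have [measurable]: "h \<in> borel_measurable M" using h by (auto simp: lebesgue_space_def)
    have hi: "integrable M (\<lambda>x. \<bar>h x\<bar> powr p x)" using h by (simp add: lebesgue_space_def)
    have pt: "\<bar>h x * D x - clip (-N) N (h x) * D x\<bar> \<le> B * N powr (1 - pm) * \<bar>h x\<bar> powr p x" if x: "x \<in> \<Omega>" for x
    proof (cases "\<bar>h x\<bar> \<le> N")
      case True
      then have "clip (-N) N (h x) = h x" by (auto simp: clip_def)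
      then show ?thesis using B0 by simp
    next
      case False
      have "\<bar>h x - clip (-N) N (h x)\<bar> \<le> \<bar>h x\<bar>" using False N by (auto simp: clip_def max_def min_def)
      also have "\<bar>h x\<bar> = \<bar>h x\<bar> powr (1 - p x) * \<bar>h x\<bar> powr p x" using False N by (simp flip: powr_add)
      also have "\<dots> \<le> N powr (1 - pm) * \<bar>h x\<bar> powr p x"
      proof (rule mult_right_mono)
        have "\<bar>h x\<bar> powr (1 - p x) \<le> \<bar>h x\<bar> powr (1 - pm)"
          using False N p_bounds[OF x] by (intro powr_mono) auto
        also have "\<dots> \<le> N powr (1 - pm)" using False N pm by (intro powr_mono2') auto
        finally show "\<bar>h x\<bar> powr (1 - p x) \<le> N powr (1 - pm)" .
      qed simp
      finally have "\<bar>h x - clip (-N) N (h x)\<bar> * \<bar>D x\<bar> \<le> (N powr (1 - pm) * \<bar>h x\<bar> powr p x) * B"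
        using D(2) by (intro mult_mono) auto
      then show ?thesis by (simp only: left_diff_distrib[symmetric] abs_mult) (simp add: mult_ac)
    qed
    have cl [measurable]: "(\<lambda>x. clip (-N) N (h x)) \<in> borel_measurable M" unfolding clip_def by measurable
    have i1: "integrable M (\<lambda>x. clip (-N) N (h x) * D x)"
    proof (rule integrable_AE_bounded[of "\<lambda>x. N * B"])
      show "AE x in M. \<bar>clip (-N) N (h x) * D x\<bar> \<le> N * B"
        unfolding abs_mult using D(2) N by (intro AE_I2 mult_mono) (auto simp: clip_def)
    qed simp_all
    have i2: "integrable M (\<lambda>x. h x * D x - clip (-N) N (h x) * D x)"
      by (rule integrable_AE_bounded[of "\<lambda>x. B * N powr (1 - pm) * \<bar>h x\<bar> powr p x"])
        (use hi pt in \<open>auto intro!: AE_I2\<close>)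
    have i3: "integrable M (\<lambda>x. h x * D x)"
      using Bochner_Integration.integrable_add[OF i2 i1] by simp
    have "\<bar>(LINT x|M. h x * D x) - (LINT x|M. clip (-N) N (h x) * D x)\<bar> =
        \<bar>LINT x|M. h x * D x - clip (-N) N (h x) * D x\<bar>"
      by (simp add: Bochner_Integration.integral_diff[OF i3 i1])
    also have "\<dots> \<le> (LINT x|M. B * N powr (1 - pm) * \<bar>h x\<bar> powr p x)"
      by (rule integral_abs_bound[THEN order_trans], rule integral_mono)
        (use i2 hi pt in \<open>auto intro!: integrable_abs\<close>)
    also have "\<dots> = B * N powr (1 - pm) * (LINT x|M. \<bar>h x\<bar> powr p x)" by simp
    also have "\<dots> \<le> B * N powr (1 - pm) * C" using h B0 by (intro mult_left_mono) auto
    finally show ?thesis .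
  qed
  show "(\<lambda>n. LINT x|M. f n x * D x) \<longlonglongrightarrow> (LINT x|M. g x * D x)"
  proof (rule LIMSEQ_I)
    fix e :: real assume e: "e > 0"
    have "((\<lambda>N::real. N powr (1 - pm)) \<longlongrightarrow> 0) at_top"
      using tendsto_neg_powr[of "1 - pm" "\<lambda>N::real. N"] pm by (simp add: filterlim_ident)
    then have "((\<lambda>N::real. B * N powr (1 - pm) * C) \<longlongrightarrow> B * 0 * C) at_top" by (intro tendsto_intros)
    then have lim0: "((\<lambda>N::real. B * N powr (1 - pm) * C) \<longlongrightarrow> 0) at_top" by simp
    have "\<forall>\<^sub>F N in at_top. B * N powr (1 - pm) * C < e/3" using e by (intro order_tendstoD(2)[OF lim0]) simp
    then have "\<forall>\<^sub>F N in at_top. B * N powr (1 - pm) * C < e/3 \<and> N \<ge> 1"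
      using eventually_ge_at_top[of "1::real"] by eventually_elim simp
    then obtain N where N: "B * N powr (1 - pm) * C < e/3" "N \<ge> 1"
      using eventually_happens'[OF trivial_limit_at_top_linorder] by blast
    have "(\<lambda>n. LINT x|M. clip (-N) N (f n x) * D x) \<longlonglongrightarrow> (LINT x|M. clip (-N) N (g x) * D x)"
    proof (rule integral_dominated_convergence[where w = "\<lambda>x. N * B"])
      show "AE x in M. (\<lambda>n. clip (-N) N (f n x) * D x) \<longlonglongrightarrow> clip (-N) N (g x) * D x"
        using lim by eventually_elim (auto simp: clip_def intro!: tendsto_intros)
      show "AE x in M. norm (clip (-N) N (f n x) * D x) \<le> N * B" for n
        unfolding real_norm_def abs_mult using D(2) N by (intro AE_I2 mult_mono) (auto simp: clip_def)
    qed (unfold clip_def, measurable)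
    from LIMSEQ_D[OF this, of "e/3"] e
    obtain n0 where n0: "\<forall>n\<ge>n0. norm ((LINT x|M. clip (-N) N (f n x) * D x) - (LINT x|M. clip (-N) N (g x) * D x)) < e/3"
      by auto
    have "norm ((LINT x|M. f n x * D x) - (LINT x|M. g x * D x)) < e" if "n \<ge> n0" for n
      using n0[rule_format, OF that] tail[OF f(1,2) N(2), of n] tail[OF gL gp(2) N(2)] N(1) unfolding real_norm_def by linarith
    then show "\<exists>no. \<forall>n\<ge>no. norm ((LINT x|M. f n x * D x) - (LINT x|M. g x * D x)) < e" by blast
  qed
qed

end

section \<open>Minimization of the energy\<close>

lemma pot_nonneg:
  assumes "continuous_on UNIV f" "mono f" "f 0 = 0"
  shows "0 \<le> pot f t"
  using pot_subgradient[OF assms(1,2), of 0 t] assms(3) by simp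

lemma pot_le_mult:
  assumes "continuous_on UNIV f" "mono f"
  shows "pot f t \<le> f t * t"
  using pot_subgradient[OF assms(1,2), of t 0] by simp

lemma pot_lower:
  assumes "continuous_on UNIV f" "mono f"
  shows "f 0 * t \<le> pot f t"
  using pot_subgradient[OF assms(1,2), of 0 t] by simp

lemma pot_midpoint:
  assumes f: "continuous_on UNIV f" "mono f"
  shows "pot f (1/2 * s + 1/2 * t) \<le> (pot f s + pot f t) / 2"
proof -
  define m where "m = 1/2 * s + 1/2 * t"
  have "(s - m) + (t - m) = 0" by (simp add: m_def)
  then have "f m * (s - m) + f m * (t - m) = 0" by (metis distrib_left mult_zero_right)
  then show ?thesis
    using pot_subgradient[OF f, of m s] pot_subgradient[OF f, of m t] unfolding m_def[symmetric] by argo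
qed

text \<open>As \<open>sgn 0 = 0\<close>, the value at 0 is 0 without a case distinction. For
  \<open>f = flux x\<close> this will be the field \<open>op_a \<Psi> x\<close>; for a continuous
  monotone \<open>f\<close> with \<open>f 0 = 0\<close> it is a subgradient field of
  \<open>\<xi> \<mapsto> pot f (norm \<xi>)\<close>.\<close>

definition radial :: "(real \<Rightarrow> real) \<Rightarrow> 'a::real_inner \<Rightarrow> 'a" where
  "radial f \<xi> = f (norm \<xi>) *\<^sub>R sgn \<xi>"

lemma norm_radial: "norm (radial f \<xi>) \<le> \<bar>f (norm \<xi>)\<bar>"
  by (simp add: radial_def norm_sgn)

lemma mono_zero_nonneg: "mono f \<Longrightarrow> f 0 = 0 \<Longrightarrow> 0 \<le> s \<Longrightarrow> 0 \<le> f s" for f :: "real \<Rightarrow> real" and s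
  by (drule monoD[of f 0 s]) auto

text \<open>Since \<open>f\<close> is nonnegative at nonnegative arguments and
  \<open>sgn \<xi> \<bullet> \<eta> \<le> norm \<eta>\<close>, the claim follows from the scalar
  subgradient inequality at the two norms.\<close>

lemma radial_subgradient:
  assumes f: "continuous_on UNIV f" "mono f" "f 0 = 0"
  shows "radial f \<xi> \<bullet> (\<eta> - \<xi>) \<le> pot f (norm \<eta>) - pot f (norm \<xi>)"
proof -
  have "sgn \<xi> \<bullet> \<eta> \<le> norm (sgn \<xi>) * norm \<eta>" by (rule norm_cauchy_schwarz)
  also have "\<dots> \<le> norm \<eta>" by (simp add: norm_sgn)
  finally have 1: "sgn \<xi> \<bullet> \<eta> \<le> norm \<eta>" .
  have 2: "sgn \<xi> \<bullet> \<xi> = norm \<xi>"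
    by (cases "\<xi> = 0") (auto simp: sgn_div_norm dot_square_norm power2_eq_square)
  have "radial f \<xi> \<bullet> (\<eta> - \<xi>) = f (norm \<xi>) * (sgn \<xi> \<bullet> \<eta> - norm \<xi>)"
    by (simp add: radial_def inner_diff_right 2 algebra_simps)
  also have "\<dots> \<le> f (norm \<xi>) * (norm \<eta> - norm \<xi>)"
    using 1 mono_zero_nonneg[OF f(2,3), of "norm \<xi>"] by (intro mult_left_mono) auto
  also have "\<dots> \<le> pot f (norm \<eta>) - pot f (norm \<xi>)" by (rule pot_subgradient[OF f(1,2)])
  finally show ?thesis .
qed

lemma radial_monotone:
  assumes f: "continuous_on UNIV f" "mono f" "f 0 = 0"
  shows "0 \<le> (radial f \<xi> - radial f \<eta>) \<bullet> (\<xi> - \<eta>)"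
  using radial_subgradient[OF f, of \<xi> \<eta>] radial_subgradient[OF f, of \<eta> \<xi>]
  by (simp add: inner_diff_left inner_diff_right)

lemma pot_norm_midpoint:
  fixes \<xi> \<eta> :: "'a::real_inner"
  assumes f: "continuous_on UNIV f" "mono f" "f 0 = 0"
  shows "pot f (norm ((1/2) *\<^sub>R \<xi> + (1/2) *\<^sub>R \<eta>)) \<le> (pot f (norm \<xi>) + pot f (norm \<eta>)) / 2"
proof -
  define m where "m = (1/2) *\<^sub>R \<xi> + (1/2) *\<^sub>R \<eta>"
  have "m + m = (1/2 + 1/2) *\<^sub>R \<xi> + (1/2 + 1/2) *\<^sub>R \<eta>" unfolding m_def scaleR_add_left by (simp only: add_ac)
  then have "m + m = \<xi> + \<eta>" by simp
  then have e: "(\<xi> - m) + (\<eta> - m) = 0" by (simp add: algebra_simps)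
  have "radial f m \<bullet> (\<xi> - m) + radial f m \<bullet> (\<eta> - m) = radial f m \<bullet> ((\<xi> - m) + (\<eta> - m))"
    by (rule inner_add_right[symmetric])
  also have "\<dots> = 0" unfolding e by simp
  finally show ?thesis
    using radial_subgradient[OF f, of m \<xi>] radial_subgradient[OF f, of m \<eta>] unfolding m_def[symmetric] by argo
qed

lemma isCont_radial:
  fixes \<xi> :: "'a::real_inner"
  assumes f: "continuous_on UNIV f" and f0: "f 0 = 0"
  shows "isCont (radial f) \<xi>"
proof (cases "\<xi> = 0")
  case True
  have "((\<lambda>\<xi>::'a. \<bar>f (norm \<xi>)\<bar>) \<longlongrightarrow> \<bar>f (norm (0::'a))\<bar>) (at 0)"
    by (intro tendsto_rabs continuous_on_tendsto_compose[OF f] tendsto_norm tendsto_ident_at) auto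
  then have "((\<lambda>\<xi>::'a. \<bar>f (norm \<xi>)\<bar>) \<longlongrightarrow> 0) (at 0)" using f0 by simp
  then have "(radial f \<longlongrightarrow> 0) (at (0::'a))"
    by (rule Lim_null_comparison[rotated]) (intro always_eventually allI norm_radial)
  then show ?thesis using True by (simp add: isCont_def radial_def)
next
  case False
  have "((\<lambda>\<xi>. f (norm \<xi>)) \<longlongrightarrow> f (norm \<xi>)) (at \<xi>)"
    by (intro continuous_on_tendsto_compose[OF f] tendsto_norm tendsto_ident_at) auto
  moreover have "(sgn \<longlongrightarrow> sgn \<xi>) (at \<xi>)" using False tendsto_sgn[OF tendsto_ident_at] by blast
  ultimately show ?thesis unfolding isCont_def radial_def by (rule tendsto_scaleR)
qed

section \<open>Closedness of the Sobolev space under limits almost everywhere\<close>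

context variable_exponent
begin

lemma integrable_locally_integrable:
  fixes f :: "'a \<Rightarrow> 'b::{banach, second_countable_topology}"
  assumes "integrable M f"
  shows "locally_integrable \<Omega> f"
  unfolding locally_integrable_def set_integrable_def
proof (intro allI impI)
  fix K assume K: "compact K \<and> K \<subseteq> \<Omega>"
  have "integrable lebesgue (\<lambda>x. indicator \<Omega> x *\<^sub>R f x)"
    using assms by (subst (asm) integrable_restrict_space) auto
  then have "integrable lebesgue (\<lambda>x. indicator K x *\<^sub>R (indicator \<Omega> x *\<^sub>R f x))"
    by (rule integrable_mult_indicator[rotated]) (use K in \<open>simp add: lmeasurable_compact fmeasurableD\<close>)
  also have "(\<lambda>x. indicator K x *\<^sub>R (indicator \<Omega> x *\<^sub>R f x)) = (\<lambda>x. indicator K x *\<^sub>R f x)"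
    using K by (auto simp: indicator_def fun_eq_iff)
  finally show "integrable lebesgue (\<lambda>x. indicator K x *\<^sub>R f x)" .
qed

lemma test_function_measurable:
  assumes "\<phi> \<in> test_functions \<Omega>" "i \<in> Basis"
  shows "\<phi> \<in> borel_measurable M" "(\<lambda>x. frechet_derivative \<phi> (at x) i) \<in> borel_measurable M"
  using borel_measurable_continuous_onI[OF test_functionD(2)[OF assms(1)]]
    borel_measurable_continuous_onI[OF test_functionD(3)[OF assms]]
  by (auto intro!: measurable_restrict_space1 measurable_completion)

lemma Lp_norm: "sobolev_gradient \<Omega> p V G \<Longrightarrow> (\<lambda>x. norm (G x)) \<in> lebesgue_space \<Omega> p"
  by (simp add: sobolev_gradient_def)

text \<open>The functions are uniformly bounded, so dominated convergence handles the left side of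
  the defining identity. The gradients only have bounded modulars, and
  \<open>integral_tendsto_of_bounded_modular\<close> handles the right side against a bounded test
  function.\<close>

lemma sob_limit:
  assumes sob: "\<And>n. sobolev_gradient \<Omega> p (V n) (G n)"
    and Vb: "\<And>n. AE x in M. \<bar>V n x\<bar> \<le> R" and Gb: "\<And>n. (LINT x|M. norm (G n x) powr p x) \<le> C"
    and lim: "AE x in M. (\<lambda>n. V n x) \<longlonglongrightarrow> W x" "AE x in M. (\<lambda>n. G n x) \<longlonglongrightarrow> H x"
    and m [measurable]: "W \<in> borel_measurable M" "H \<in> borel_measurable M"
  shows "sobolev_gradient \<Omega> p W H"
proof -
  have Wb: "AE x in M. \<bar>W x\<bar> \<le> R"
  proof -
    have "AE x in M. \<forall>n. \<bar>V n x\<bar> \<le> R" using Vb by (simp add: AE_all_countable)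
    then show ?thesis using lim(1)
      by eventually_elim (rule LIMSEQ_le_const2[OF tendsto_rabs], auto)
  qed
  have WL: "W \<in> lebesgue_space \<Omega> p"
  proof (rule Lp_dominated[OF Lp_const[of R] m(1)])
    show "AE x in M. \<bar>W x\<bar> \<le> \<bar>R\<bar>" using Wb by eventually_elim simp
  qed
  have nL: "(\<lambda>x. norm (G n x)) \<in> lebesgue_space \<Omega> p" for n using Lp_norm[OF sob] .
  have Hn: "(\<lambda>x. norm (H x)) \<in> lebesgue_space \<Omega> p"
  proof (rule integral_tendsto_of_bounded_modular(1)[OF nL])
    show "(LINT x|M. \<bar>norm (G n x)\<bar> powr p x) \<le> C" for n using Gb[of n] by simp
    show "AE x in M. (\<lambda>n. norm (G n x)) \<longlonglongrightarrow> norm (H x)" using lim(2) by eventually_elim (rule tendsto_norm)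
    \<comment> \<open>Only the membership of the limit is wanted here, so the weight
      \<open>D\<close> is taken to be 0.\<close>
    show "(\<lambda>x. 0) \<in> borel_measurable M" by simp
    show "\<bar>0::real\<bar> \<le> 0" by simp
  qed measurable
  have Hi: "integrable M H" using Lp_integrable[OF Hn] integrable_norm_iff[OF m(2)] by simp
  have "has_weak_gradient \<Omega> W H"
    unfolding has_weak_gradient_def
  proof (intro conjI ballI)
    show "locally_integrable \<Omega> W" using Lp_integrable[OF WL] by (rule integrable_locally_integrable)
    show "locally_integrable \<Omega> H" using Hi by (rule integrable_locally_integrable)
    fix \<phi> i assume \<phi>: "\<phi> \<in> test_functions \<Omega>" and i: "(i::'a) \<in> Basis"
    note T = test_functionD[OF \<phi>]
    let ?D = "\<lambda>x. frechet_derivative \<phi> (at x) i"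
    note tm [measurable] = test_function_measurable[OF \<phi> i]
    have Gm [measurable]: "G n \<in> borel_measurable M" and Vm [measurable]: "V n \<in> borel_measurable M" for n
      using sob_measurable[OF sob] by auto
    obtain B1 where B1: "B1 > 0" "\<And>x. \<bar>\<phi> x\<bar> \<le> B1"
      by (rule compactly_supported_bounded[OF T(2,4,6)]) (assumption, rule that)
    obtain B2 where B2: "B2 > 0" "\<And>x. \<bar>?D x\<bar> \<le> B2"
      by (rule compactly_supported_bounded[OF T(3)[OF i] T(4,7)]) (assumption, rule that)
    have 1: "(\<lambda>n. LINT x|M. V n x * ?D x) \<longlonglongrightarrow> (LINT x|M. W x * ?D x)"
    proof (rule integral_dominated_convergence[where w = "\<lambda>x. \<bar>R\<bar> * B2"])
      show "AE x in M. (\<lambda>n. V n x * ?D x) \<longlonglongrightarrow> W x * ?D x"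
        using lim(1) by eventually_elim (intro tendsto_mult tendsto_const)
      show "AE x in M. norm (V n x * ?D x) \<le> \<bar>R\<bar> * B2" for n
        using Vb[of n]
      proof eventually_elim
        case (elim x)
        then show ?case unfolding real_norm_def abs_mult using B2 by (intro mult_mono) auto
      qed
      show "(\<lambda>x. W x * ?D x) \<in> borel_measurable M" by (intro borel_measurable_times m tm)
      show "(\<lambda>x. V n x * ?D x) \<in> borel_measurable M" for n by (intro borel_measurable_times Vm tm)
    qed simp
    have 2: "(\<lambda>n. LINT x|M. (G n x \<bullet> i) * \<phi> x) \<longlonglongrightarrow> (LINT x|M. (H x \<bullet> i) * \<phi> x)"
    proof (rule integral_tendsto_of_bounded_modular(2))
      show gi: "(\<lambda>x. G n x \<bullet> i) \<in> lebesgue_space \<Omega> p" for n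
      proof (rule Lp_dominated[OF nL[of n]])
        show "AE x in M. \<bar>G n x \<bullet> i\<bar> \<le> \<bar>norm (G n x)\<bar>" using Basis_le_norm[OF i] by simp
      qed measurable
      show "(LINT x|M. \<bar>G n x \<bullet> i\<bar> powr p x) \<le> C" for n
      proof -
        have "(LINT x|M. \<bar>G n x \<bullet> i\<bar> powr p x) \<le> (LINT x|M. norm (G n x) powr p x)"
        proof (rule integral_mono)
          show "integrable M (\<lambda>x. \<bar>G n x \<bullet> i\<bar> powr p x)" using gi[of n] by (simp add: lebesgue_space_def)
          show "integrable M (\<lambda>x. norm (G n x) powr p x)" using nL[of n] by (simp add: lebesgue_space_def)
          show "\<bar>G n x \<bullet> i\<bar> powr p x \<le> norm (G n x) powr p x" if "x \<in> space M" for x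
            using p_pos[of x] that Basis_le_norm[OF i, of "G n x"] by (intro powr_mono2) auto
        qed
        then show ?thesis using Gb[of n] by linarith
      qed
      show "AE x in M. (\<lambda>n. G n x \<bullet> i) \<longlonglongrightarrow> H x \<bullet> i"
        using lim(2) by eventually_elim (intro tendsto_inner tendsto_const)
      show "\<bar>\<phi> x\<bar> \<le> B1" for x by (rule B1)
    qed measurable
    have "(LINT x|M. V n x * ?D x) = - (LINT x|M. (G n x \<bullet> i) * \<phi> x)" for n
      using sob[of n] \<phi> i by (auto simp: sobolev_gradient_def has_weak_gradient_def)
    with 1 have "(\<lambda>n. - (LINT x|M. (G n x \<bullet> i) * \<phi> x)) \<longlonglongrightarrow> (LINT x|M. W x * ?D x)" by simp
    then show "(LINT x|M. W x * ?D x) = - (LINT x|M. (H x \<bullet> i) * \<phi> x)"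
      using LIMSEQ_unique tendsto_minus[OF 2] by blast
  qed
  then show ?thesis using WL Hn by (simp add: sobolev_gradient_def)
qed

end

text \<open>\<open>f1\<close> stands for the flux and \<open>f2\<close> for the reaction minus the
  source. \<open>f1_Lp\<close> is restricted to nonnegative \<open>v\<close> because the flux will
  be an odd function and \<open>op_Phi\<close> is an even one, so that they agree for nonnegative
  arguments. \<open>f2_sign\<close> is the condition under which truncation to the interval from 0
  to \<open>\<delta>\<close> does not raise the energy.\<close>

locale energy = variable_exponent +
  fixes f1 f2 :: "'a \<Rightarrow> real \<Rightarrow> real" and \<delta> :: real
  assumes \<delta>: "0 < \<delta>"
    and f1: "AE x in M. continuous_on UNIV (f1 x) \<and> mono (f1 x) \<and> f1 x 0 = 0"
    and f1_Lp: "\<And>v. v \<in> lebesgue_space \<Omega> p \<Longrightarrow> (\<And>x. 0 \<le> v x) \<Longrightarrow> (\<lambda>x. f1 x (v x)) \<in> lebesgue_space \<Omega> (conj_exponent p)"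
    and coercive: "\<And>V G. (\<And>n::nat. sobolev_gradient \<Omega> p (V n) (G n)) \<Longrightarrow>
      filterlim (\<lambda>n. LINT x|M. norm (G n x) powr p x) at_top sequentially \<Longrightarrow>
      filterlim (\<lambda>n. LINT x|M. pot (f1 x) (norm (G n x))) at_top sequentially"
    and f2: "AE x in M. continuous_on UNIV (f2 x) \<and> mono (f2 x)"
    and f2_measurable: "\<And>s. (\<lambda>x. f2 x s) \<in> borel_measurable M"
    and f2_bound: "\<And>R. \<exists>h. integrable M h \<and> (AE x in M. \<forall>s. \<bar>s\<bar> \<le> R \<longrightarrow> \<bar>f2 x s\<bar> \<le> h x)"
    and f2_sign: "AE x in M. (\<forall>s\<le>0. f2 x s \<le> 0) \<and> (\<forall>s\<ge>\<delta>. 0 \<le> f2 x s)"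
begin

lemma f1_norm_measurable:
  assumes "sobolev_gradient \<Omega> p V G" "0 \<le> r"
  shows "(\<lambda>x. f1 x (r * norm (G x))) \<in> borel_measurable M"
  using f1_Lp[OF Lp_cmult[OF Lp_norm[OF assms(1)], of r]] assms(2) by (simp add: lebesgue_space_def)

lemma A_integrable:
  assumes "sobolev_gradient \<Omega> p V G"
  shows "integrable M (\<lambda>x. pot (f1 x) (norm (G x)))"
proof (rule integrable_AE_bounded)
  show "integrable M (\<lambda>x. norm (G x) * f1 x (norm (G x)))"
    using Lp_norm[OF assms] by (intro Lp_mult_integrable f1_Lp) auto
  have f1': "AE x in M. continuous_on UNIV (f1 x) \<and> mono (f1 x)" using f1 by eventually_elim auto
  note m = sob_measurable[OF assms]
  show "(\<lambda>x. pot (f1 x) (norm (G x))) \<in> borel_measurable M"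
    using m f1_norm_measurable[OF assms] by (intro borel_measurable_pot \<Omega>_measurable f1') auto
  show "AE x in M. \<bar>pot (f1 x) (norm (G x))\<bar> \<le> norm (G x) * f1 x (norm (G x))"
    using f1
  proof eventually_elim
    case (elim x)
    then show ?case
      using pot_nonneg[of "f1 x" "norm (G x)"] pot_le_mult[of "f1 x" "norm (G x)"] by (simp add: mult.commute)
  qed
qed

lemma radial_integrable:
  assumes "sobolev_gradient \<Omega> p V G" "sobolev_gradient \<Omega> p W H"
  shows "integrable M (\<lambda>x. radial (f1 x) (G x) \<bullet> H x)"
proof (rule integrable_AE_bounded)
  show "integrable M (\<lambda>x. norm (H x) * f1 x (norm (G x)))"
    using Lp_norm[OF assms(1)] Lp_norm[OF assms(2)] by (intro Lp_mult_integrable f1_Lp) auto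
  note m [measurable] = sob_measurable[OF assms(1)] sob_measurable[OF assms(2)]
  have [measurable]: "(\<lambda>x. f1 x (norm (G x))) \<in> borel_measurable M" using f1_norm_measurable[OF assms(1), of 1] by simp
  show "(\<lambda>x. radial (f1 x) (G x) \<bullet> H x) \<in> borel_measurable M"
    unfolding radial_def sgn_div_norm by measurable
  show "AE x in M. \<bar>radial (f1 x) (G x) \<bullet> H x\<bar> \<le> norm (H x) * f1 x (norm (G x))"
    using f1
  proof eventually_elim
    case (elim x)
    have "\<bar>radial (f1 x) (G x) \<bullet> H x\<bar> \<le> norm (radial (f1 x) (G x)) * norm (H x)" by (rule Cauchy_Schwarz_ineq2)
    also have "\<dots> \<le> \<bar>f1 x (norm (G x))\<bar> * norm (H x)" by (intro mult_right_mono norm_radial) auto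
    finally show ?case using elim mono_zero_nonneg[of "f1 x" "norm (G x)"] by (simp add: mult.commute)
  qed
qed

lemma f2_comp_measurable: "v \<in> borel_measurable M \<Longrightarrow> (\<lambda>x. f2 x (v x)) \<in> borel_measurable M"
proof (rule caratheodory_measurable[OF \<Omega>_measurable f2_measurable])
  show "AE x in M. continuous_on UNIV (f2 x)" using f2 by eventually_elim auto
qed

lemma F_measurable: "v \<in> borel_measurable M \<Longrightarrow> (\<lambda>x. pot (f2 x) (v x)) \<in> borel_measurable M"
  using f2 by (intro borel_measurable_pot \<Omega>_measurable f2_comp_measurable) auto

text \<open>Convexity encloses \<open>pot (f2 x) s\<close> between \<open>f2 x 0 * s\<close> and
  \<open>f2 x s * s\<close>, so the bound on \<open>f2\<close> carries over with the factor
  \<open>1 + \<bar>R\<bar>\<close>; one majorant then serves the potential and its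
  derivative.\<close>

lemma F_bound:
  obtains h where "integrable M h" "AE x in M. \<forall>s. \<bar>s\<bar> \<le> R \<longrightarrow> \<bar>pot (f2 x) s\<bar> \<le> h x \<and> \<bar>f2 x s\<bar> \<le> h x"
proof -
  obtain h where h: "integrable M h" "AE x in M. \<forall>s. \<bar>s\<bar> \<le> R \<longrightarrow> \<bar>f2 x s\<bar> \<le> h x" using f2_bound by blast
  show ?thesis
  proof (rule that[of "\<lambda>x. (1 + \<bar>R\<bar>) * \<bar>h x\<bar>"])
    show "integrable M (\<lambda>x. (1 + \<bar>R\<bar>) * \<bar>h x\<bar>)" using h by auto
    show "AE x in M. \<forall>s. \<bar>s\<bar> \<le> R \<longrightarrow> \<bar>pot (f2 x) s\<bar> \<le> (1 + \<bar>R\<bar>) * \<bar>h x\<bar> \<and> \<bar>f2 x s\<bar> \<le> (1 + \<bar>R\<bar>) * \<bar>h x\<bar>"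
      using h(2) f2
    proof eventually_elim
      case (elim x)
      show ?case
      proof (intro allI impI)
        fix s assume s: "\<bar>s\<bar> \<le> R"
        have b: "\<bar>f2 x s\<bar> \<le> \<bar>h x\<bar>" "\<bar>f2 x 0\<bar> \<le> \<bar>h x\<bar>" using elim(1)[rule_format, OF s] elim(1)[rule_format, of 0] s by auto
        have p: "\<bar>f2 x s * s\<bar> \<le> \<bar>h x\<bar> * \<bar>R\<bar>" "\<bar>f2 x 0 * s\<bar> \<le> \<bar>h x\<bar> * \<bar>R\<bar>"
          unfolding abs_mult using b s by (auto intro!: mult_mono)
        have "f2 x 0 * s \<le> pot (f2 x) s" "pot (f2 x) s \<le> f2 x s * s"
          using elim(2) by (auto intro: pot_lower pot_le_mult)
        then have "\<bar>pot (f2 x) s\<bar> \<le> \<bar>h x\<bar> * \<bar>R\<bar>" using p by linarith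
        moreover have "(1 + \<bar>R\<bar>) * \<bar>h x\<bar> = \<bar>h x\<bar> + \<bar>h x\<bar> * \<bar>R\<bar>" by (simp add: algebra_simps)
        moreover have "0 \<le> \<bar>h x\<bar> * \<bar>R\<bar>" by simp
        ultimately show "\<bar>pot (f2 x) s\<bar> \<le> (1 + \<bar>R\<bar>) * \<bar>h x\<bar> \<and> \<bar>f2 x s\<bar> \<le> (1 + \<bar>R\<bar>) * \<bar>h x\<bar>"
          using b(1) by linarith
      qed
    qed
  qed
qed

lemma F_integrable:
  assumes "v \<in> borel_measurable M" "AE x in M. \<bar>v x\<bar> \<le> R"
  shows "integrable M (\<lambda>x. pot (f2 x) (v x))" "integrable M (\<lambda>x. f2 x (v x))"
proof -
  obtain h where h: "integrable M h" "AE x in M. \<forall>s. \<bar>s\<bar> \<le> R \<longrightarrow> \<bar>pot (f2 x) s\<bar> \<le> h x \<and> \<bar>f2 x s\<bar> \<le> h x"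
    by (rule F_bound)
  show "integrable M (\<lambda>x. pot (f2 x) (v x))"
    by (rule integrable_AE_bounded[OF h(1) F_measurable[OF assms(1)]])
      (use assms(2) h(2) in eventually_elim, blast)
  show "integrable M (\<lambda>x. f2 x (v x))"
    by (rule integrable_AE_bounded[OF h(1) f2_comp_measurable[OF assms(1)]])
      (use assms(2) h(2) in eventually_elim, blast)
qed

definition total_energy :: "('a \<Rightarrow> real) \<Rightarrow> ('a \<Rightarrow> 'a) \<Rightarrow> real" where
  "total_energy V G = (LINT x|M. pot (f1 x) (norm (G x))) + (LINT x|M. pot (f2 x) (V x))"

definition admissible :: "('a \<Rightarrow> real) \<Rightarrow> ('a \<Rightarrow> 'a) \<Rightarrow> bool" where
  "admissible V G \<longleftrightarrow> sobolev_gradient \<Omega> p V G \<and> (AE x in M. 0 \<le> V x \<and> V x \<le> \<delta>)"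

lemma admissible_bounded: "admissible V G \<Longrightarrow> AE x in M. \<bar>V x\<bar> \<le> \<delta>"
proof -
  assume "admissible V G"
  then have "AE x in M. 0 \<le> V x \<and> V x \<le> \<delta>" unfolding admissible_def by (rule conjunct2)
  then show ?thesis by eventually_elim auto
qed

lemma admissible_F_integrable: "admissible V G \<Longrightarrow> integrable M (\<lambda>x. pot (f2 x) (V x))"
  using admissible_bounded[of V G] sob_measurable[of V G] by (intro F_integrable(1)[of _ \<delta>]) (auto simp: admissible_def)

lemma A_nonneg: "sobolev_gradient \<Omega> p V G \<Longrightarrow> AE x in M. 0 \<le> pot (f1 x) (norm (G x))"
  using f1 by eventually_elim (auto intro: pot_nonneg)

lemma F_integral_bound:
  obtains c where "\<And>V G. admissible V G \<Longrightarrow> \<bar>LINT x|M. pot (f2 x) (V x)\<bar> \<le> c"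
proof -
  obtain h where h: "integrable M h" "AE x in M. \<forall>s. \<bar>s\<bar> \<le> \<delta> \<longrightarrow> \<bar>pot (f2 x) s\<bar> \<le> h x \<and> \<bar>f2 x s\<bar> \<le> h x"
    by (rule F_bound)
  show ?thesis
  proof (rule that)
    fix V G assume a: "admissible V G"
    show "\<bar>LINT x|M. pot (f2 x) (V x)\<bar> \<le> (LINT x|M. h x)"
    proof (rule integral_abs_bound[THEN order_trans], rule integral_mono_AE)
      show "integrable M (\<lambda>x. \<bar>pot (f2 x) (V x)\<bar>)" using admissible_F_integrable[OF a] by (rule integrable_abs)
      show "AE x in M. \<bar>pot (f2 x) (V x)\<bar> \<le> h x"
        using h(2) admissible_bounded[OF a] by eventually_elim blast
    qed (rule h)
  qed
qed

text \<open>Coercivity is a statement on sequences, so the bound comes by contradiction: modulars of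
  at least \<open>n\<close> at bounded energy would send the gradient part to infinity, while the
  potential part is uniformly bounded on the admissible pairs.\<close>

lemma modular_bound:
  obtains C where "\<And>V G. admissible V G \<Longrightarrow> total_energy V G \<le> m \<Longrightarrow> (LINT x|M. norm (G x) powr p x) \<le> C"
proof -
  obtain c where c: "\<And>V G. admissible V G \<Longrightarrow> \<bar>LINT x|M. pot (f2 x) (V x)\<bar> \<le> c" by (rule F_integral_bound) (rule that)
  have "\<exists>C. \<forall>V G. admissible V G \<longrightarrow> total_energy V G \<le> m \<longrightarrow> (LINT x|M. norm (G x) powr p x) \<le> C"
  proof (rule ccontr)
    assume "\<not> ?thesis"
    then have "\<forall>n::nat. \<exists>VG. admissible (fst VG) (snd VG) \<and> total_energy (fst VG) (snd VG) \<le> m \<and>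
        real n \<le> (LINT x|M. norm (snd VG x) powr p x)"
      by (simp add: not_le) (meson less_imp_le)
    from choice[OF this] obtain VG where VG: "\<And>n. admissible (fst (VG n)) (snd (VG n))" "\<And>n. total_energy (fst (VG n)) (snd (VG n)) \<le> m"
      "\<And>n. real n \<le> (LINT x|M. norm (snd (VG n) x) powr p x)" by blast
    have "filterlim (\<lambda>n. LINT x|M. norm (snd (VG n) x) powr p x) at_top sequentially"
      using VG(3) by (intro filterlim_at_top_mono[OF filterlim_real_sequentially]) (auto intro: always_eventually)
    then have "filterlim (\<lambda>n. LINT x|M. pot (f1 x) (norm (snd (VG n) x))) at_top sequentially"
      using VG(1) by (intro coercive[of "\<lambda>n. fst (VG n)"]) (auto simp: admissible_def)
    then have "\<forall>\<^sub>F n in sequentially. m + c + 1 \<le> (LINT x|M. pot (f1 x) (norm (snd (VG n) x)))"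
      by (simp add: filterlim_at_top)
    then obtain n where n: "m + c + 1 \<le> (LINT x|M. pot (f1 x) (norm (snd (VG n) x)))"
      by (auto simp: eventually_sequentially)
    then show False using VG(2)[of n] c[OF VG(1)[of n]] unfolding total_energy_def by linarith
  qed
  then show ?thesis using that by blast
qed

lemma admissible_midpoint:
  assumes "admissible V G" "admissible W H"
  shows "admissible (\<lambda>x. 1/2 * V x + 1/2 * W x) (\<lambda>x. (1/2) *\<^sub>R G x + (1/2) *\<^sub>R H x)"
proof -
  have "AE x in M. 0 \<le> V x \<and> V x \<le> \<delta>" "AE x in M. 0 \<le> W x \<and> W x \<le> \<delta>" using assms by (auto simp: admissible_def)
  then have "AE x in M. 0 \<le> 1/2 * V x + 1/2 * W x \<and> 1/2 * V x + 1/2 * W x \<le> \<delta>"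
    by eventually_elim auto
  then show ?thesis using assms unfolding admissible_def by (intro conjI sob_lincomb) blast+
qed

lemma total_energy_midpoint:
  assumes a: "admissible V G" "admissible W H"
  shows "total_energy (\<lambda>x. 1/2 * V x + 1/2 * W x) (\<lambda>x. (1/2) *\<^sub>R G x + (1/2) *\<^sub>R H x) \<le> (total_energy V G + total_energy W H) / 2"
proof -
  note s = a[unfolded admissible_def, THEN conjunct1] admissible_midpoint[OF a, unfolded admissible_def, THEN conjunct1]
  have "(LINT x|M. pot (f1 x) (norm ((1/2) *\<^sub>R G x + (1/2) *\<^sub>R H x))) \<le>
      (LINT x|M. (pot (f1 x) (norm (G x)) + pot (f1 x) (norm (H x))) / 2)"
    using A_integrable[OF s(1)] A_integrable[OF s(2)] A_integrable[OF s(3)]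
  proof (intro integral_mono_AE)
    show "AE x in M. pot (f1 x) (norm ((1/2) *\<^sub>R G x + (1/2) *\<^sub>R H x)) \<le> (pot (f1 x) (norm (G x)) + pot (f1 x) (norm (H x))) / 2"
      using f1 by eventually_elim (rule pot_norm_midpoint, auto)
  qed auto
  moreover have "(LINT x|M. pot (f2 x) (1/2 * V x + 1/2 * W x)) \<le> (LINT x|M. (pot (f2 x) (V x) + pot (f2 x) (W x)) / 2)"
  proof (intro integral_mono_AE)
    show "AE x in M. pot (f2 x) (1/2 * V x + 1/2 * W x) \<le> (pot (f2 x) (V x) + pot (f2 x) (W x)) / 2"
      using f2 by eventually_elim (rule pot_midpoint, auto)
    show "integrable M (\<lambda>x. pot (f2 x) (1/2 * V x + 1/2 * W x))" by (rule admissible_F_integrable[OF admissible_midpoint[OF a]])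
    show "integrable M (\<lambda>x. (pot (f2 x) (V x) + pot (f2 x) (W x)) / 2)"
      using admissible_F_integrable[OF a(1)] admissible_F_integrable[OF a(2)] by auto
  qed
  ultimately show ?thesis
    using A_integrable[OF s(1)] A_integrable[OF s(2)] admissible_F_integrable[OF a(1)] admissible_F_integrable[OF a(2)]
    by (simp add: total_energy_def)
qed

end

section \<open>Selection of a convergent minimizing sequence and existence of a minimizer\<close>

context energy
begin

lemma admissible_zero: "admissible (\<lambda>x. 0) (\<lambda>x. 0)"
  using sob_const[of 0] \<delta> by (simp add: admissible_def)

text \<open>Linear growth makes it integrable for every Sobolev gradient, and yet it is strictly
  convex with the explicit modulus of \<open>sqrt_one_plus_norm_gap\<close>.\<close>

definition bracket :: "'a \<Rightarrow> real" where "bracket \<xi> = sqrt (1 + (norm \<xi>)\<^sup>2)"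

lemma bracket_bounds: "1 \<le> bracket \<xi>" "norm \<xi> \<le> bracket \<xi>" "bracket \<xi> \<le> 1 + norm \<xi>"
proof -
  show "1 \<le> bracket \<xi>" "norm \<xi> \<le> bracket \<xi>" by (auto simp: bracket_def intro!: real_le_rsqrt)
  show "bracket \<xi> \<le> 1 + norm \<xi>"
    using sqrt_sum_squares_le_sum[of 1 "norm \<xi>"] by (simp add: bracket_def)
qed

lemma bracket_integrable:
  assumes "sobolev_gradient \<Omega> p V G"
  shows "integrable M (\<lambda>x. bracket (G x))"
proof (rule integrable_AE_bounded)
  show "integrable M (\<lambda>x. 1 + norm (G x))" using Lp_integrable[OF Lp_norm[OF assms]] by simp
  have [measurable]: "G \<in> borel_measurable M" using sob_measurable[OF assms] by simp
  show "(\<lambda>x. bracket (G x)) \<in> borel_measurable M" unfolding bracket_def by measurable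
  show "AE x in M. \<bar>bracket (G x)\<bar> \<le> 1 + norm (G x)"
  proof (rule AE_I2)
    show "\<bar>bracket (G x)\<bar> \<le> 1 + norm (G x)" for x using bracket_bounds[of "G x"] by linarith
  qed
qed

lemma admissible_square_integrable:
  assumes "admissible V G"
  shows "integrable M (\<lambda>x. (V x)\<^sup>2)"
proof (rule integrable_AE_bounded[of "\<lambda>x. \<delta>\<^sup>2"])
  have [measurable]: "V \<in> borel_measurable M" using assms sob_measurable unfolding admissible_def by blast
  show "(\<lambda>x. (V x)\<^sup>2) \<in> borel_measurable M" by measurable
  show "AE x in M. \<bar>(V x)\<^sup>2\<bar> \<le> \<delta>\<^sup>2"
    using admissible_bounded[OF assms] by eventually_elim (simp add: abs_le_square_iff[symmetric])
qed simp

text \<open>The gradient term does not see additive constants; the square of \<open>V\<close> makes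
  \<open>V\<close> itself converge.\<close>

definition strict_energy :: "('a \<Rightarrow> real) \<Rightarrow> ('a \<Rightarrow> 'a) \<Rightarrow> real" where
  "strict_energy V G = (LINT x|M. bracket (G x)) + (LINT x|M. (V x)\<^sup>2)"

lemma strict_energy_bound:
  obtains C where "C \<ge> 0" "\<And>V G. admissible V G \<Longrightarrow> total_energy V G \<le> m \<Longrightarrow> strict_energy V G \<le> C \<and> (LINT x|M. bracket (G x)) \<le> C"
proof -
  obtain C where C: "\<And>V G. admissible V G \<Longrightarrow> total_energy V G \<le> m \<Longrightarrow> (LINT x|M. norm (G x) powr p x) \<le> C"
    by (rule modular_bound) (rule that)
  define C' where "C' = \<bar>measure M (space M) * 2 + C\<bar> + \<bar>measure M (space M) * \<delta>\<^sup>2\<bar>"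
  show ?thesis
  proof (rule that[of C'])
    show "C' \<ge> 0" by (simp add: C'_def)
    fix V G assume a: "admissible V G" "total_energy V G \<le> m"
    have s: "sobolev_gradient \<Omega> p V G" using a by (simp add: admissible_def)
    have gi: "integrable M (\<lambda>x. norm (G x) powr p x)" using Lp_norm[OF s] by (simp add: lebesgue_space_def)
    have "(LINT x|M. bracket (G x)) \<le> (LINT x|M. 2 + norm (G x) powr p x)"
    proof (rule integral_mono)
      show "bracket (G x) \<le> 2 + norm (G x) powr p x" if "x \<in> space M" for x
        using bracket_bounds(3)[of "G x"] abs_le_1_powr[of x "norm (G x)"] that by simp
    qed (use gi bracket_integrable[OF s] in auto)
    also have "\<dots> = measure M (space M) * 2 + (LINT x|M. norm (G x) powr p x)"
      using gi by (subst Bochner_Integration.integral_add) auto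
    also have "\<dots> \<le> measure M (space M) * 2 + C" using C[OF a] by simp
    finally have 1: "(LINT x|M. bracket (G x)) \<le> measure M (space M) * 2 + C" .
    have "(LINT x|M. (V x)\<^sup>2) \<le> (LINT x|M. \<delta>\<^sup>2)"
    proof (intro integral_mono_AE)
      show "AE x in M. (V x)\<^sup>2 \<le> \<delta>\<^sup>2"
        using admissible_bounded[OF a(1)] by eventually_elim (use \<delta> in \<open>simp add: abs_le_square_iff[symmetric]\<close>)
    qed (use admissible_square_integrable[OF a(1)] in auto)
    also have "\<dots> = measure M (space M) * \<delta>\<^sup>2" by simp
    finally have 2: "(LINT x|M. (V x)\<^sup>2) \<le> measure M (space M) * \<delta>\<^sup>2" .
    show "strict_energy V G \<le> C' \<and> (LINT x|M. bracket (G x)) \<le> C'" using 1 2 unfolding strict_energy_def C'_def by linarith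
  qed
qed

text \<open>Balance of rates: gaps with integrals of order 64^-n are pointwise of order 32^-n, and
  \<open>bracket (G n x)\<close> grows at most like 2^n. The convexity estimate loses the cube of
  the latter, so the squared increments of \<open>G n x\<close> are of order 8^n 32^-n = 4^-n, and
  the increments are summable.\<close>

lemma ex_convergent_minimizing_sequence:
  obtains V G where "\<And>n. admissible (V n) (G n)" "\<And>n. total_energy (V n) (G n) \<le> Inf {total_energy V G |V G. admissible V G} + 1 / real (Suc n)"
    "AE x in M. convergent (\<lambda>n. V n x)" "AE x in M. convergent (\<lambda>n. G n x)"
proof -
  define X where "X = {VG. admissible (fst VG) (snd VG)}"
  define J' where "J' VG = total_energy (fst VG) (snd VG)" for VG
  define T' where "T' VG = strict_energy (fst VG) (snd VG)" for VG
  define mid :: "('a \<Rightarrow> real) \<times> ('a \<Rightarrow> 'a) \<Rightarrow> ('a \<Rightarrow> real) \<times> ('a \<Rightarrow> 'a) \<Rightarrow> ('a \<Rightarrow> real) \<times> ('a \<Rightarrow> 'a)"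
    where "mid VG WH = ((\<lambda>x. 1/2 * fst VG x + 1/2 * fst WH x), (\<lambda>x. (1/2) *\<^sub>R snd VG x + (1/2) *\<^sub>R snd WH x))" for VG WH
  define e :: "nat \<Rightarrow> real" where "e n = (1/64)^n" for n
  have inf_eq: "J' ` X = {total_energy V G |V G. admissible V G}" 
  proof safe
    fix V G assume "admissible V G"
    then show "total_energy V G \<in> J' ` X" by (intro image_eqI[of _ _ "(V, G)"]) (auto simp: J'_def X_def)
  qed (auto simp: J'_def X_def)
  obtain c where c: "\<And>V G. admissible V G \<Longrightarrow> \<bar>LINT x|M. pot (f2 x) (V x)\<bar> \<le> c" by (rule F_integral_bound) (rule that)
  obtain C where C: "C \<ge> 0" "\<And>V G. admissible V G \<Longrightarrow> total_energy V G \<le> Inf (J' ` X) + 1 \<Longrightarrow> strict_energy V G \<le> C \<and> (LINT x|M. bracket (G x)) \<le> C"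
    by (rule strict_energy_bound[where m = "Inf (J' ` X) + 1"]) (rule that)
  obtain s where s: "\<And>n. s n \<in> X" "\<And>n. J' (s n) \<le> Inf (J' ` X) + 1 / real (Suc n)"
    "\<And>n. (T' (s n) + T' (s (Suc n))) / 2 - T' (mid (s n) (s (Suc n))) \<le> 2 * e n"
  proof (rule near_minimizing_sequence[of X "-c" J' T' mid C e])
    show "X \<noteq> {}" using admissible_zero unfolding X_def by fastforce
    show "- c \<le> J' x" if "x \<in> X" for x
    proof -
      have a: "admissible (fst x) (snd x)" using that by (simp add: X_def)
      have "0 \<le> (LINT y|M. pot (f1 y) (norm (snd x y)))"
        using a by (intro integral_nonneg_AE A_nonneg) (auto simp: admissible_def)
      then show ?thesis using c[OF a] unfolding J'_def total_energy_def by linarith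
    qed
    show "0 \<le> T' x" for x
      unfolding T'_def strict_energy_def
      using order_trans[OF zero_le_one bracket_bounds(1)]
      by (intro add_nonneg_nonneg Bochner_Integration.integral_nonneg) auto
    show "mid x y \<in> X" if "x \<in> X" "y \<in> X" for x y
      using that admissible_midpoint[of "fst x" "snd x" "fst y" "snd y"] by (simp add: X_def mid_def)
    show "J' (mid x y) \<le> max (J' x) (J' y)" if "x \<in> X" "y \<in> X" for x y
    proof -
      have "J' (mid x y) \<le> (J' x + J' y) / 2"
        using that total_energy_midpoint[of "fst x" "snd x" "fst y" "snd y"] unfolding X_def mid_def J'_def by simp
      also have "\<dots> \<le> max (J' x) (J' y)" by (simp add: max_def)
      finally show ?thesis .
    qed
    show "T' x \<le> C" if "x \<in> X" "J' x \<le> Inf (J' ` X) + 1" for x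
      using C(2)[of "fst x" "snd x"] that by (simp add: X_def J'_def T'_def)
    show "0 < e n" for n by (simp add: e_def)
    show "decseq e" unfolding e_def by (intro decseq_SucI) simp
  qed (rule that)
  define V where "V n = fst (s n)" for n
  define G where "G n = snd (s n)" for n
  have a: "admissible (V n) (G n)" for n using s(1)[of n] by (simp add: X_def V_def G_def)
  have sob: "sobolev_gradient \<Omega> p (V n) (G n)" for n using a[of n] by (simp add: admissible_def)
  have Jn: "total_energy (V n) (G n) \<le> Inf (J' ` X) + 1 / real (Suc n)" for n using s(2)[of n] by (simp add: J'_def V_def G_def)
  define Gm where "Gm n x = (1/2) *\<^sub>R G n x + (1/2) *\<^sub>R G (Suc n) x" for n x
  define Vm where "Vm n x = 1/2 * V n x + 1/2 * V (Suc n) x" for n x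
  have am: "admissible (Vm n) (Gm n)" for n unfolding Vm_def Gm_def by (intro admissible_midpoint a)
  have sobm: "sobolev_gradient \<Omega> p (Vm n) (Gm n)" for n using am[of n] by (simp add: admissible_def)
  have gap: "(strict_energy (V n) (G n) + strict_energy (V (Suc n)) (G (Suc n))) / 2 - strict_energy (Vm n) (Gm n) \<le> 2 * e n" for n
    using s(3)[of n] unfolding T'_def mid_def V_def G_def Vm_def Gm_def by simp
  define gG where "gG n x = (bracket (G n x) + bracket (G (Suc n) x)) / 2 - bracket (Gm n x)" for n x
  \<comment> \<open>The parallelogram identity: the midpoint gap of the square function is exactly a
    quarter of the squared difference.\<close>
  define gV where "gV n x = (V n x - V (Suc n) x)\<^sup>2 / 4" for n x
  have gV_eq: "gV n x = ((V n x)\<^sup>2 + (V (Suc n) x)\<^sup>2) / 2 - (Vm n x)\<^sup>2" for n x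
    by (simp add: gV_def Vm_def power2_eq_square field_simps)
  have gG0: "0 \<le> gG n x" for n x
    unfolding gG_def Gm_def bracket_def by (rule sqrt_one_plus_norm_gap(2)[OF max.cobounded1 max.cobounded2])
  have gV0: "0 \<le> gV n x" for n x by (simp add: gV_def)
  have igG: "integrable M (gG n)" for n
    unfolding gG_def using bracket_integrable[OF sob[of n]] bracket_integrable[OF sob[of "Suc n"]] bracket_integrable[OF sobm[of n]] by auto
  have igV: "integrable M (gV n)" for n
    unfolding gV_eq using admissible_square_integrable[OF a[of n]] admissible_square_integrable[OF a[of "Suc n"]] admissible_square_integrable[OF am[of n]] by auto
  have sum: "(LINT x|M. gG n x) + (LINT x|M. gV n x) \<le> 2 * e n" for n
  proof -
    have "(LINT x|M. gG n x) = ((LINT x|M. bracket (G n x)) + (LINT x|M. bracket (G (Suc n) x))) / 2 - (LINT x|M. bracket (Gm n x))"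
      unfolding gG_def using bracket_integrable[OF sob[of n]] bracket_integrable[OF sob[of "Suc n"]] bracket_integrable[OF sobm[of n]] by simp
    moreover have "(LINT x|M. gV n x) = ((LINT x|M. (V n x)\<^sup>2) + (LINT x|M. (V (Suc n) x)\<^sup>2)) / 2 - (LINT x|M. (Vm n x)\<^sup>2)"
      unfolding gV_eq using admissible_square_integrable[OF a[of n]] admissible_square_integrable[OF a[of "Suc n"]] admissible_square_integrable[OF am[of n]] by simp
    ultimately show ?thesis using gap[of n] unfolding strict_energy_def by argo
  qed
  have "0 \<le> (LINT x|M. gG n x)" "0 \<le> (LINT x|M. gV n x)" for n
    using gG0 gV0 by (auto intro: Bochner_Integration.integral_nonneg)
  then have bG: "(LINT x|M. gG n x) \<le> 2 * (1/64)^n" and bV: "(LINT x|M. gV n x) \<le> 2 * (1/64)^n" for n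
    using sum[of n] unfolding e_def by (smt (verit))+
  have AG: "AE x in M. \<exists>K. \<forall>n. gG n x \<le> K * (2 * (1/64))^n"
    by (rule AE_geometric_bound[OF igG _ _ bG]) (use gG0 in auto)
  have AV: "AE x in M. \<exists>K. \<forall>n. gV n x \<le> K * (2 * (1/64))^n"
    by (rule AE_geometric_bound[OF igV _ _ bV]) (use gV0 in auto)
  \<comment> \<open>With \<open>q = 1\<close> the bounded integrals give the pointwise growth
    \<open>2^n\<close>; the gaps were chosen small enough to outweigh it.\<close>
  have AR: "AE x in M. \<exists>K. \<forall>n. bracket (G n x) \<le> K * (2 * 1)^n"
  proof (rule AE_geometric_bound)
    show "integrable M (\<lambda>x. bracket (G n x))" for n by (rule bracket_integrable[OF sob])
    show "AE x in M. 0 \<le> bracket (G n x)" for n using order_trans[OF zero_le_one bracket_bounds(1)] by (intro AE_I2)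
    show "(LINT x|M. bracket (G n x)) \<le> C * 1^n" for n
    proof -
      have "total_energy (V n) (G n) \<le> Inf (J' ` X) + 1" using Jn[of n] by (rule order_trans) simp
      then show ?thesis using C(2)[OF a[of n]] by simp
    qed
  qed simp
  show ?thesis
  proof (rule that[of V G])
    show "admissible (V n) (G n)" for n by (rule a)
    show "total_energy (V n) (G n) \<le> Inf {total_energy V G |V G. admissible V G} + 1 / real (Suc n)" for n using Jn[of n] unfolding inf_eq .
    show "AE x in M. convergent (\<lambda>n. V n x)"
      using AV
    proof eventually_elim
      case (elim x)
      then obtain K where K: "\<And>n. gV n x \<le> K * (2 * (1/64))^n" by blast
      have K0: "0 \<le> K" using order_trans[OF gV0 K[of 0]] by simp
      show ?case
      proof (rule geometric_increments_convergent)
        fix n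
        have "(V n x - V (Suc n) x)\<^sup>2 = 4 * gV n x" by (simp add: gV_def)
        also have "\<dots> \<le> 4 * (K * (1/32)^n)" using K[of n] by simp
        \<comment> \<open>Weakened to a rate whose square root is \<open>(1/2)^n\<close>.\<close>
        also have "\<dots> \<le> 4 * (K * (1/4)^n)" using K0 by (intro mult_left_mono power_mono) auto
        also have "(1/4 :: real)^n = ((1/2)^n)\<^sup>2" by (simp add: power2_eq_square flip: power_mult_distrib)
        also have "4 * (K * ((1/2)^n)\<^sup>2) = (sqrt (4 * K) * (1/2)^n)\<^sup>2" using K0 by (simp add: power_mult_distrib)
        finally have "\<bar>V n x - V (Suc n) x\<bar> \<le> \<bar>sqrt (4 * K) * (1/2)^n\<bar>" by (simp only: abs_le_square_iff)
        then show "norm (V n x - V (Suc n) x) \<le> \<bar>sqrt (4 * K)\<bar> * (1/2)^n" by (simp add: abs_mult)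
      qed
    qed
    show "AE x in M. convergent (\<lambda>n. G n x)"
      using AG AR
    proof eventually_elim
      case (elim x)
      obtain K where K: "\<And>n. gG n x \<le> K * (2 * (1/64))^n" using elim(1) by blast
      obtain D where D: "\<And>n. bracket (G n x) \<le> D * (2 * 1)^n" using elim(2) by blast
      have K0: "0 \<le> K" using order_trans[OF gG0 K[of 0]] by simp
      have D0: "0 \<le> D" using order_trans[OF bracket_bounds(1) D[of 0]] by simp
      \<comment> \<open>This is \<open>8 * R^3 * K\<close> without its growth \<open>8^n\<close>,
        for the \<open>R\<close> chosen below.\<close>
      define B where "B = 64 * D^3 * K"
      have B0: "0 \<le> B" using K0 D0 by (simp add: B_def)
      show ?case
      proof (rule geometric_increments_convergent)
        fix n
        \<comment> \<open>The factor 2 lets one \<open>R\<close> bound both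
          \<open>bracket (G n x)\<close> and \<open>bracket (G (Suc n) x)\<close>.\<close>
        define R where "R = 2 * D * 2^n"
        have R: "bracket (G n x) \<le> R" "bracket (G (Suc n) x) \<le> R"
        proof -
          have "bracket (G n x) \<le> D * 2^n" using D[of n] by simp
          also have "D * 2^n \<le> R" using D0 by (simp add: R_def)
          finally show "bracket (G n x) \<le> R" .
          show "bracket (G (Suc n) x) \<le> R" using D[of "Suc n"] by (simp add: R_def mult_ac)
        qed
        have R0: "0 \<le> R" using D0 by (simp add: R_def)
        have "(norm (G n x - G (Suc n) x))\<^sup>2 \<le> 8 * R^3 * gG n x"
          using sqrt_one_plus_norm_gap(1)[of "G n x" R "G (Suc n) x"] R unfolding gG_def Gm_def bracket_def by simp
        also have "\<dots> \<le> 8 * R^3 * (K * (1/32)^n)" using K[of n] R0 by (intro mult_left_mono) auto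
        also have "\<dots> = B * (8^n * (1/32)^n)"
        proof -
          have "(2^n)^3 = ((2::real)^3)^n" by (simp only: power_mult[symmetric] mult.commute[of n 3])
          then have "(2^n)^3 = (8::real)^n" by simp
          then show ?thesis by (simp add: R_def B_def power_mult_distrib)
        qed
        also have "8^n * (1/32)^n = (1/4 :: real)^n" by (simp flip: power_mult_distrib)
        also have "(1/4 :: real)^n = ((1/2)^n)\<^sup>2" by (simp add: power2_eq_square flip: power_mult_distrib)
        also have "B * ((1/2)^n)\<^sup>2 = (sqrt B * (1/2)^n)\<^sup>2" using B0 by (simp add: power_mult_distrib)
        finally have "(norm (G n x - G (Suc n) x))\<^sup>2 \<le> (sqrt B * (1/2)^n)\<^sup>2" .
        moreover have "0 \<le> sqrt B * (1/2)^n" using B0 by simp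
        ultimately show "norm (G n x - G (Suc n) x) \<le> sqrt B * (1/2)^n" by (rule power2_le_imp_le)
      qed
    qed
  qed
qed

text \<open>Lower semicontinuity along the almost everywhere convergent sequence: the potential term
  converges, being dominated thanks to the constraint, and Fatou's lemma bounds the nonnegative
  gradient term by what then remains of the infimum.\<close>

lemma ex_minimizer:
  obtains V G where "admissible V G" "\<And>W H. admissible W H \<Longrightarrow> total_energy V G \<le> total_energy W H"
proof -
  define m where "m = Inf {total_energy V G |V G. admissible V G}"
  obtain V G where a: "\<And>n. admissible (V n) (G n)" and Jn': "\<And>n. total_energy (V n) (G n) \<le> Inf {total_energy V G |V G. admissible V G} + 1 / real (Suc n)"
    and cV: "AE x in M. convergent (\<lambda>n. V n x)" and cG: "AE x in M. convergent (\<lambda>n. G n x)"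
    by (rule ex_convergent_minimizing_sequence) (rule that)
  have Jn: "total_energy (V n) (G n) \<le> m + 1 / real (Suc n)" for n using Jn'[of n] unfolding m_def .
  have sob: "sobolev_gradient \<Omega> p (V n) (G n)" for n using a[of n] by (simp add: admissible_def)
  have Vm [measurable]: "V n \<in> borel_measurable M" and Gm [measurable]: "G n \<in> borel_measurable M" for n
    using sob_measurable[OF sob] by auto
  define W where "W x = lim (\<lambda>n. V n x)" for x
  define H where "H x = lim (\<lambda>n. G n x)" for x
  have Wm [measurable]: "W \<in> borel_measurable M" unfolding W_def by (rule borel_measurable_lim_metric[OF Vm])
  have Hm [measurable]: "H \<in> borel_measurable M" unfolding H_def by (rule borel_measurable_lim_metric[OF Gm])
  have lV: "AE x in M. (\<lambda>n. V n x) \<longlonglongrightarrow> W x" using cV by eventually_elim (simp add: W_def convergent_LIMSEQ_iff)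
  have lG: "AE x in M. (\<lambda>n. G n x) \<longlonglongrightarrow> H x" using cG by eventually_elim (simp add: H_def convergent_LIMSEQ_iff)
  obtain C where C: "\<And>V G. admissible V G \<Longrightarrow> total_energy V G \<le> m + 1 \<Longrightarrow> (LINT x|M. norm (G x) powr p x) \<le> C"
    by (rule modular_bound) (rule that)
  have Cn: "(LINT x|M. norm (G n x) powr p x) \<le> C" for n
  proof (rule C[OF a])
    show "total_energy (V n) (G n) \<le> m + 1" using Jn[of n] by (rule order_trans) simp
  qed
  have sW: "sobolev_gradient \<Omega> p W H"
    by (rule sob_limit[OF sob admissible_bounded[OF a] Cn lV lG Wm Hm])
  have W01: "AE x in M. 0 \<le> W x \<and> W x \<le> \<delta>"
  proof -
    have "AE x in M. 0 \<le> V n x \<and> V n x \<le> \<delta>" for n using a[of n] unfolding admissible_def by (rule conjunct2)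
    then have "AE x in M. \<forall>n. 0 \<le> V n x \<and> V n x \<le> \<delta>" by (subst AE_all_countable) blast
    then show ?thesis using lV
    proof eventually_elim
      case (elim x)
      then show ?case using LIMSEQ_le_const[OF elim(2), of 0] LIMSEQ_le_const2[OF elim(2), of \<delta>] by blast
    qed
  qed
  have aW: "admissible W H" using sW W01 unfolding admissible_def by (rule conjI)
  obtain h where h: "integrable M h" "AE x in M. \<forall>s. \<bar>s\<bar> \<le> \<delta> \<longrightarrow> \<bar>pot (f2 x) s\<bar> \<le> h x \<and> \<bar>f2 x s\<bar> \<le> h x"
    by (rule F_bound)
  have Flim: "(\<lambda>n. LINT x|M. pot (f2 x) (V n x)) \<longlonglongrightarrow> (LINT x|M. pot (f2 x) (W x))"
  proof (rule integral_dominated_convergence[where w = h])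
    show "AE x in M. (\<lambda>n. pot (f2 x) (V n x)) \<longlonglongrightarrow> pot (f2 x) (W x)"
      using lV f2
    proof eventually_elim
      case (elim x)
      then show ?case by (intro isCont_tendsto_compose[OF isCont_pot]) auto
    qed
    show "AE x in M. norm (pot (f2 x) (V n x)) \<le> h x" for n
      using admissible_bounded[OF a[of n]] h(2) by eventually_elim simp
    show "(\<lambda>x. pot (f2 x) (W x)) \<in> borel_measurable M" by (rule F_measurable[OF Wm])
    show "(\<lambda>x. pot (f2 x) (V n x)) \<in> borel_measurable M" for n by (rule F_measurable[OF Vm])
  qed (rule h)
  define c where "c n = m + 1 / real (Suc n) - (LINT x|M. pot (f2 x) (V n x))" for n
  have c: "c \<longlonglongrightarrow> m + 0 - (LINT x|M. pot (f2 x) (W x))"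
    unfolding c_def by (intro tendsto_intros Flim LIMSEQ_Suc[OF lim_1_over_n])
  have A: "(LINT x|M. pot (f1 x) (norm (H x))) \<le> m + 0 - (LINT x|M. pot (f2 x) (W x))"
  proof (rule fatou_integral(2)[OF A_integrable[OF sob] A_nonneg[OF sob] _ _ _ c])
    show "(\<lambda>x. pot (f1 x) (norm (H x))) \<in> borel_measurable M" using A_integrable[OF sW] by auto
    show "AE x in M. (\<lambda>n. pot (f1 x) (norm (G n x))) \<longlonglongrightarrow> pot (f1 x) (norm (H x))"
      using lG f1
    proof eventually_elim
      case (elim x)
      then show ?case by (intro isCont_tendsto_compose[OF isCont_pot] tendsto_norm) auto
    qed
    show "(LINT x|M. pot (f1 x) (norm (G n x))) \<le> c n" for n using Jn[of n] unfolding total_energy_def c_def by linarith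
  qed
  show ?thesis
  proof (rule that[OF aW])
    fix W' H' assume a': "admissible W' H'"
    obtain c where c: "\<And>V G. admissible V G \<Longrightarrow> \<bar>LINT x|M. pot (f2 x) (V x)\<bar> \<le> c" by (rule F_integral_bound) (rule that)
    have "bdd_below {total_energy V G |V G. admissible V G}"
    proof (rule bdd_belowI)
      fix y assume "y \<in> {total_energy V G |V G. admissible V G}"
      then obtain V G where VG: "admissible V G" "y = total_energy V G" by blast
      have "0 \<le> (LINT y|M. pot (f1 y) (norm (G y)))"
        using VG by (intro integral_nonneg_AE A_nonneg) (auto simp: admissible_def)
      then show "- c \<le> y" using c[OF VG(1)] unfolding VG(2) total_energy_def by linarith
    qed
    then have "m \<le> total_energy W' H'" unfolding m_def using a' by (intro cInf_lower) auto
    moreover have "total_energy W H \<le> m" using A unfolding total_energy_def by linarith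
    ultimately show "total_energy W H \<le> total_energy W' H'" by linarith
  qed
qed

end

section \<open>The Euler-Lagrange equation\<close>

context energy
begin

text \<open>Where truncation changes \<open>s\<close>, the value of \<open>f\<close> at the
  truncated point has the sign of \<open>s - clip 0 \<delta> s\<close> or is 0, so the subgradient
  inequality there gives the claim.\<close>

lemma pot_clip_le:
  assumes "continuous_on UNIV f" "mono f" "\<forall>s\<le>0. f s \<le> 0" "\<forall>s\<ge>\<delta>. 0 \<le> f s"
  shows "pot f (clip 0 \<delta> s) \<le> pot f s"
proof -
  have "0 \<le> f (clip 0 \<delta> s) * (s - clip 0 \<delta> s)"
  proof -
    consider "s < 0" | "0 \<le> s" "s \<le> \<delta>" | "\<delta> < s" by linarith
    then show ?thesis
    proof cases
      case 1
      then have "clip 0 \<delta> s = 0" using \<delta> by (simp add: clip_def)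
      then show ?thesis using 1 assms(3) by (simp add: mult_nonpos_nonpos)
    next
      case 2
      then have "clip 0 \<delta> s = s" by (simp add: clip_def)
      then show ?thesis by simp
    next
      case 3
      then have "clip 0 \<delta> s = \<delta>" using \<delta> by (simp add: clip_def)
      then show ?thesis using 3 assms(4) by simp
    qed
  qed
  then show ?thesis using pot_subgradient[OF assms(1,2), of "clip 0 \<delta> s" s] by linarith
qed

text \<open>\<open>V + t \<phi>\<close> may violate the constraint, so its truncation is the
  competitor; truncation raises neither part of the energy, hence \<open>V\<close> has at most the
  energy of \<open>V + t \<phi>\<close> as well. Dividing by \<open>t\<close> and letting
  \<open>t\<close> tend to 0 gives the inequality.\<close>

lemma minimizer_variation_nonneg:
  assumes a: "admissible V G" and min: "\<And>W H. admissible W H \<Longrightarrow> total_energy V G \<le> total_energy W H"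
    and \<phi>: "sobolev_gradient \<Omega> p \<phi> H" and B: "AE x in M. \<bar>\<phi> x\<bar> \<le> B"
  shows "0 \<le> (LINT x|M. radial (f1 x) (G x) \<bullet> H x) + (LINT x|M. f2 x (V x) * \<phi> x)"
proof -
  define t where "t n = 1 / real (Suc n)" for n
  have t: "0 < t n" "t n \<le> 1" for n by (auto simp: t_def)
  have t0: "t \<longlonglongrightarrow> 0" unfolding t_def by (rule LIMSEQ_Suc[OF lim_1_over_n])
  have sV: "sobolev_gradient \<Omega> p V G" using a by (simp add: admissible_def)
  note m [measurable] = sob_measurable[OF sV] sob_measurable[OF \<phi>]
  define Vn where "Vn n x = V x + t n * \<phi> x" for n x
  define Gn where "Gn n x = G x + t n *\<^sub>R H x" for n x
  have sn: "sobolev_gradient \<Omega> p (Vn n) (Gn n)" for n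
    using sob_lincomb[OF sV \<phi>, of 1 "t n"] by (simp add: Vn_def[abs_def] Gn_def[abs_def])
  have mn [measurable]: "Vn n \<in> borel_measurable M" "Gn n \<in> borel_measurable M" for n
    using sob_measurable[OF sn] by auto
  have Vb: "AE x in M. \<bar>Vn n x\<bar> \<le> \<delta> + B" for n
    using admissible_bounded[OF a] B
  proof eventually_elim
    case (elim x)
    have "\<bar>t n * \<phi> x\<bar> \<le> \<bar>\<phi> x\<bar>" using t[of n] by (simp add: abs_mult mult_left_le_one_le)
    then show ?case using elim unfolding Vn_def by linarith
  qed
  obtain h where h: "integrable M h" "AE x in M. \<forall>s. \<bar>s\<bar> \<le> \<delta> + B \<longrightarrow> \<bar>pot (f2 x) s\<bar> \<le> h x \<and> \<bar>f2 x s\<bar> \<le> h x"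
    by (rule F_bound)
  have f2\<phi>: "integrable M (\<lambda>x. f2 x (v x) * \<phi> x)"
    if v: "v \<in> borel_measurable M" "AE x in M. \<bar>v x\<bar> \<le> \<delta> + B" for v
  proof (rule integrable_AE_bounded)
    show "integrable M (\<lambda>x. h x * B)" using h by simp
    show "(\<lambda>x. f2 x (v x) * \<phi> x) \<in> borel_measurable M"
      using f2_comp_measurable[OF v(1)] m(3) by (rule borel_measurable_times)
    show "AE x in M. \<bar>f2 x (v x) * \<phi> x\<bar> \<le> h x * B"
      using v(2) h(2) B
    proof eventually_elim
      case (elim x)
      then have "\<bar>f2 x (v x)\<bar> \<le> h x" by blast
      then show ?case unfolding abs_mult using elim(3) by (intro mult_mono) auto
    qed
  qed
  have Vb0: "AE x in M. \<bar>V x\<bar> \<le> \<delta> + B" using admissible_bounded[OF a] B by eventually_elim linarith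
  have nonneg: "0 \<le> (LINT x|M. radial (f1 x) (Gn n x) \<bullet> H x) + (LINT x|M. f2 x (Vn n x) * \<phi> x)" for n
  proof -
    let ?W = "\<lambda>x. clip 0 \<delta> (Vn n x)" and ?K = "\<lambda>x. if 0 < Vn n x \<and> Vn n x \<le> \<delta> then Gn n x else 0"
    have sK: "sobolev_gradient \<Omega> p ?W ?K" using \<delta> by (intro sob_clip sn) simp
    have aK: "admissible ?W ?K" unfolding admissible_def using sK \<delta> by (auto simp: clip_def)
    note iA = A_integrable[OF sV] A_integrable[OF sn[of n]] A_integrable[OF sK]
    note iF = F_integrable(1)[OF mn(1) Vb, of n] admissible_F_integrable[OF a] admissible_F_integrable[OF aK]
    have "(LINT x|M. pot (f1 x) (norm (?K x))) \<le> (LINT x|M. pot (f1 x) (norm (Gn n x)))"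
    proof (rule integral_mono_AE[OF iA(3,2)])
      show "AE x in M. pot (f1 x) (norm (?K x)) \<le> pot (f1 x) (norm (Gn n x))"
        using A_nonneg[OF sn[of n]] by eventually_elim auto
    qed
    moreover have "(LINT x|M. pot (f2 x) (?W x)) \<le> (LINT x|M. pot (f2 x) (Vn n x))"
    proof (rule integral_mono_AE[OF iF(3,1)])
      show "AE x in M. pot (f2 x) (?W x) \<le> pot (f2 x) (Vn n x)"
        using f2 f2_sign by eventually_elim (rule pot_clip_le, auto)
    qed
    \<comment> \<open>The subgradient is taken at the perturbed point \<open>Gn n x\<close>, not at
      \<open>G x\<close>: this bounds the increment from above by \<open>t n\<close> times an
      integral, and continuity of \<open>radial\<close> removes the perturbation afterwards.\<close>
    moreover have "(LINT x|M. pot (f1 x) (norm (Gn n x))) - (LINT x|M. pot (f1 x) (norm (G x)))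
        \<le> t n * (LINT x|M. radial (f1 x) (Gn n x) \<bullet> H x)"
    proof -
      have "(LINT x|M. pot (f1 x) (norm (Gn n x)) - pot (f1 x) (norm (G x))) \<le> (LINT x|M. t n * (radial (f1 x) (Gn n x) \<bullet> H x))"
      proof (rule integral_mono_AE)
        show "AE x in M. pot (f1 x) (norm (Gn n x)) - pot (f1 x) (norm (G x)) \<le> t n * (radial (f1 x) (Gn n x) \<bullet> H x)"
          using f1
        proof eventually_elim
          case (elim x)
          have "G x - Gn n x = - (t n *\<^sub>R H x)" by (simp add: Gn_def)
          then show ?case using radial_subgradient[of "f1 x" "Gn n x" "G x"] elim by simp
        qed
      qed (use iA radial_integrable[OF sn \<phi>] in auto)
      then show ?thesis using iA by simp
    qed
    moreover have "(LINT x|M. pot (f2 x) (Vn n x)) - (LINT x|M. pot (f2 x) (V x)) \<le> t n * (LINT x|M. f2 x (Vn n x) * \<phi> x)"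
    proof -
      have "(LINT x|M. pot (f2 x) (Vn n x) - pot (f2 x) (V x)) \<le> (LINT x|M. t n * (f2 x (Vn n x) * \<phi> x))"
      proof (rule integral_mono_AE)
        show "AE x in M. pot (f2 x) (Vn n x) - pot (f2 x) (V x) \<le> t n * (f2 x (Vn n x) * \<phi> x)"
          using f2
        proof eventually_elim
          case (elim x)
          have "V x - Vn n x = - (t n * \<phi> x)" by (simp add: Vn_def)
          then show ?case using pot_subgradient[of "f2 x" "Vn n x" "V x"] elim by (simp add: mult_ac)
        qed
      qed (use iF f2\<phi>[OF mn(1) Vb] in auto)
      then show ?thesis using iF by simp
    qed
    moreover have "total_energy V G \<le> total_energy ?W ?K" by (rule min[OF aK])
    ultimately have "0 \<le> t n * (LINT x|M. radial (f1 x) (Gn n x) \<bullet> H x) + t n * (LINT x|M. f2 x (Vn n x) * \<phi> x)"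
      unfolding total_energy_def by linarith
    then have "0 \<le> t n * ((LINT x|M. radial (f1 x) (Gn n x) \<bullet> H x) + (LINT x|M. f2 x (Vn n x) * \<phi> x))"
      by (simp add: distrib_left)
    then show ?thesis using t(1)[of n] by (simp add: zero_le_mult_iff)
  qed
  have "(\<lambda>n. LINT x|M. radial (f1 x) (Gn n x) \<bullet> H x) \<longlonglongrightarrow> (LINT x|M. radial (f1 x) (G x) \<bullet> H x)"
  \<comment> \<open>As \<open>t n \<le> 1\<close> and \<open>f1 x\<close> is monotone, the field at
    \<open>Gn n x\<close> is bounded by \<open>f1 x (norm (G x) + norm (H x))\<close>, which lies in
    the space with the conjugate exponent; Young's inequality makes the product with
    \<open>norm (H x)\<close> integrable.\<close>
  proof (rule integral_dominated_convergence[where w = "\<lambda>x. norm (H x) * f1 x (norm (G x) + norm (H x))"])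
    show "(\<lambda>x. radial (f1 x) (G x) \<bullet> H x) \<in> borel_measurable M" using radial_integrable[OF sV \<phi>] by auto
    show "(\<lambda>x. radial (f1 x) (Gn n x) \<bullet> H x) \<in> borel_measurable M" for n using radial_integrable[OF sn \<phi>] by auto
    show "integrable M (\<lambda>x. norm (H x) * f1 x (norm (G x) + norm (H x)))"
      using Lp_norm[OF sV] Lp_norm[OF \<phi>] by (intro Lp_mult_integrable f1_Lp Lp_add) auto
    show "AE x in M. (\<lambda>n. radial (f1 x) (Gn n x) \<bullet> H x) \<longlonglongrightarrow> radial (f1 x) (G x) \<bullet> H x"
      using f1
    proof eventually_elim
      case (elim x)
      have "(\<lambda>n. Gn n x) \<longlonglongrightarrow> G x + 0 *\<^sub>R H x" unfolding Gn_def by (intro tendsto_intros t0)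
      then have "(\<lambda>n. Gn n x) \<longlonglongrightarrow> G x" by simp
      then show ?case using elim
        by (intro tendsto_inner tendsto_const isCont_tendsto_compose[OF isCont_radial]) auto
    qed
    show "AE x in M. norm (radial (f1 x) (Gn n x) \<bullet> H x) \<le> norm (H x) * f1 x (norm (G x) + norm (H x))" for n
      using f1
    proof eventually_elim
      case (elim x)
      have "norm (Gn n x) \<le> norm (G x) + norm (t n *\<^sub>R H x)" unfolding Gn_def by (rule norm_triangle_ineq)
      also have "norm (t n *\<^sub>R H x) \<le> norm (H x)" using t[of n] by (simp add: mult_left_le_one_le)
      finally have le: "norm (Gn n x) \<le> norm (G x) + norm (H x)" by simp
      have "\<bar>radial (f1 x) (Gn n x) \<bullet> H x\<bar> \<le> norm (radial (f1 x) (Gn n x)) * norm (H x)" by (rule Cauchy_Schwarz_ineq2)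
      also have "\<dots> \<le> \<bar>f1 x (norm (Gn n x))\<bar> * norm (H x)" by (intro mult_right_mono norm_radial) auto
      also have "\<dots> = f1 x (norm (Gn n x)) * norm (H x)"
        using mono_zero_nonneg[of "f1 x" "norm (Gn n x)"] elim by simp
      also have "\<dots> \<le> f1 x (norm (G x) + norm (H x)) * norm (H x)"
        using elim monoD[of "f1 x", OF _ le] by (intro mult_right_mono) auto
      finally show ?case by (simp add: mult.commute)
    qed
  qed
  moreover have "(\<lambda>n. LINT x|M. f2 x (Vn n x) * \<phi> x) \<longlonglongrightarrow> (LINT x|M. f2 x (V x) * \<phi> x)"
  proof (rule integral_dominated_convergence[where w = "\<lambda>x. h x * B"])
    show "(\<lambda>x. f2 x (V x) * \<phi> x) \<in> borel_measurable M" using f2\<phi>[OF m(1) Vb0] by auto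
    show "(\<lambda>x. f2 x (Vn n x) * \<phi> x) \<in> borel_measurable M" for n using f2\<phi>[OF mn(1) Vb] by auto
    show "integrable M (\<lambda>x. h x * B)" using h by simp
    show "AE x in M. (\<lambda>n. f2 x (Vn n x) * \<phi> x) \<longlonglongrightarrow> f2 x (V x) * \<phi> x"
      using f2
    proof eventually_elim
      case (elim x)
      have "(\<lambda>n. Vn n x) \<longlonglongrightarrow> V x + 0 * \<phi> x" unfolding Vn_def by (intro tendsto_intros t0)
      then have l: "(\<lambda>n. Vn n x) \<longlonglongrightarrow> V x" by simp
      have "(\<lambda>n. f2 x (Vn n x)) \<longlonglongrightarrow> f2 x (V x)"
        using elim by (intro continuous_on_tendsto_compose[OF _ l, of UNIV]) auto
      then show ?case by (intro tendsto_mult tendsto_const)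
    qed
    show "AE x in M. norm (f2 x (Vn n x) * \<phi> x) \<le> h x * B" for n
      using Vb[of n] h(2) B
    proof eventually_elim
      case (elim x)
      then have "\<bar>f2 x (Vn n x)\<bar> \<le> h x" by blast
      then show ?case unfolding real_norm_def abs_mult using elim(3) by (intro mult_mono) auto
    qed
  qed
  ultimately show ?thesis
    by (intro LIMSEQ_le_const[OF tendsto_add]) (use nonneg in auto)
qed

text \<open>The first variation is linear in the test function, so the inequality for
  \<open>\<phi>\<close> and for its negative gives equality; truncating the competitors has made
  both signs available.\<close>

theorem ex_bounded_weak_solution:
  obtains V G where "sobolev_gradient \<Omega> p V G" "AE x in M. 0 \<le> V x \<and> V x \<le> \<delta>"
    "\<And>\<phi> H B. sobolev_gradient \<Omega> p \<phi> H \<Longrightarrow> AE x in M. \<bar>\<phi> x\<bar> \<le> B \<Longrightarrow>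
      (LINT x|M. radial (f1 x) (G x) \<bullet> H x) + (LINT x|M. f2 x (V x) * \<phi> x) = 0"
proof -
  obtain V G where a: "admissible V G" and min: "\<And>W H. admissible W H \<Longrightarrow> total_energy V G \<le> total_energy W H"
    by (rule ex_minimizer) (rule that)
  show ?thesis
  proof (rule that[of V G])
    show "sobolev_gradient \<Omega> p V G" "AE x in M. 0 \<le> V x \<and> V x \<le> \<delta>"
      using a unfolding admissible_def by blast+
    fix \<phi> H B assume \<phi>: "sobolev_gradient \<Omega> p \<phi> H" and B: "AE x in M. \<bar>\<phi> x\<bar> \<le> B"
    have neg: "sobolev_gradient \<Omega> p (\<lambda>x. - \<phi> x) (\<lambda>x. - H x)"
      using sob_lincomb[OF \<phi> \<phi>, of "-1" 0] by simp
    have "0 \<le> (LINT x|M. radial (f1 x) (G x) \<bullet> - H x) + (LINT x|M. f2 x (V x) * - \<phi> x)"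
      using B by (intro minimizer_variation_nonneg[OF a min neg]) auto
    then show "(LINT x|M. radial (f1 x) (G x) \<bullet> H x) + (LINT x|M. f2 x (V x) * \<phi> x) = 0"
      using minimizer_variation_nonneg[OF a min \<phi> B] by simp
  qed
qed

end

section \<open>The Neumann problem\<close>

definition spow :: "real \<Rightarrow> real \<Rightarrow> real" where
  "spow r s = \<bar>s\<bar> powr (r - 2) * s"

text \<open>The exponent \<open>r - 2\<close> of the definition may be negative. Here only
  \<open>r - 1\<close> occurs, positive for \<open>r > 1\<close>, so continuity at 0 and
  monotonicity can be seen term by term.\<close>

lemma spow_eq: "spow r s = max s 0 powr (r - 1) - max (- s) 0 powr (r - 1)"
proof -
  have *: "t powr (r - 2) * t = t powr (r - 1)" if "t > 0" for t :: real
  proof -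
    have "t powr (r - 2) * t = t powr (r - 2) * t powr 1" using that by simp
    also have "\<dots> = t powr (r - 2 + 1)" by (rule powr_add[symmetric])
    finally show ?thesis by simp
  qed
  consider "s > 0" | "s < 0" | "s = 0" by linarith
  then show ?thesis
  proof cases
    case 2
    then show ?thesis using *[of "- s"] by (simp add: spow_def)
  qed (use * in \<open>auto simp: spow_def\<close>)
qed

lemma abs_spow: "\<bar>spow r s\<bar> = \<bar>s\<bar> powr (r - 1)"
  unfolding spow_eq by (cases "s \<ge> 0") auto

lemma continuous_spow:
  assumes "1 < r"
  shows "continuous_on UNIV (spow r)"
  unfolding spow_eq[abs_def] using assms
  by (intro continuous_on_diff continuous_on_powr' continuous_intros) auto

lemma strict_mono_spow:
  assumes r: "1 < r"
  shows "strict_mono (spow r)"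
proof (rule strict_monoI)
  fix s t :: real assume st: "s < t"
  have 1: "max s 0 powr (r - 1) \<le> max t 0 powr (r - 1)" using st r by (intro powr_mono2) auto
  have 2: "max (- t) 0 powr (r - 1) \<le> max (- s) 0 powr (r - 1)" using st r by (intro powr_mono2) auto
  show "spow r s < spow r t"
  proof (cases "t > 0")
    case True
    have "max s 0 powr (r - 1) < max t 0 powr (r - 1)" using st True r by (intro powr_less_mono2) auto
    then show ?thesis using 2 unfolding spow_eq by linarith
  next
    case False
    have "max (- t) 0 powr (r - 1) < max (- s) 0 powr (r - 1)" using st False r by (intro powr_less_mono2) auto
    then show ?thesis using 1 unfolding spow_eq by linarith
  qed
qed

lemma b_ext_eq:
  assumes "0 < \<delta>"
  shows "b_ext \<delta> b x s = b x (clip 0 \<delta> s) + min s 0 + max (s - \<delta>) 0"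
  using assms by (auto simp: b_ext_def clip_def)

lemma log_holder_imp_continuous:
  assumes "log_holder_on S p"
  shows "continuous_on S p"
  unfolding continuous_on_iff
proof (intro ballI allI impI)
  fix x and e :: real assume x: "x \<in> S" and e: "0 < e"
  obtain C where C: "C > 0" "\<And>x y. x \<in> S \<Longrightarrow> y \<in> S \<Longrightarrow> 0 < dist x y \<Longrightarrow> dist x y \<le> 1/2 \<Longrightarrow> \<bar>p x - p y\<bar> \<le> C / (- ln (dist x y))"
    using assms unfolding log_holder_on_def by blast
  show "\<exists>d>0. \<forall>x'\<in>S. dist x' x < d \<longrightarrow> dist (p x') (p x) < e"
  \<comment> \<open>At distances d below \<open>exp (- (C / e))\<close> the modulus
    \<open>C / (- ln d)\<close> is smaller than \<open>e\<close>; the bound 1/2 is the range in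
    which the log-Hoelder condition speaks.\<close>
  proof (intro exI[of _ "min (1/2) (exp (- (C / e)))"] conjI ballI impI)
    fix y assume y: "y \<in> S" "dist y x < min (1/2) (exp (- (C / e)))"
    show "dist (p y) (p x) < e"
    proof (cases "y = x")
      case False
      define L where "L = - ln (dist y x)"
      have "ln (dist y x) < ln (exp (- (C / e)))" using y False by (intro ln_less_cancel_iff[THEN iffD2]) auto
      then have l: "C / e < L" by (simp add: L_def)
      have "0 < C / e" using C e by simp
      then have "0 < L" using l by linarith
      moreover have "C < L * e" using l e by (simp add: pos_divide_less_eq)
      ultimately have "C / (- ln (dist y x)) < e" unfolding L_def[symmetric] by (simp add: pos_divide_less_eq mult.commute)
      moreover have "\<bar>p y - p x\<bar> \<le> C / (- ln (dist y x))" using y x False by (intro C) auto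
      ultimately show ?thesis unfolding dist_real_def by linarith
    qed (use e in simp)
  qed simp
qed

text \<open>By completeness of the measure a non-measurable \<open>f\<close> forces a non-measurable
  \<open>g\<close>, and both integrals then have the default value 0; the measurable case is the
  usual one.\<close>

lemma integral_lebesgue_on_cong_AE:
  fixes f g :: "'a::euclidean_space \<Rightarrow> real"
  assumes S: "S \<in> sets lebesgue" and ae: "AE x in lebesgue_on S. f x = g x"
  shows "(LINT x|lebesgue_on S. f x) = (LINT x|lebesgue_on S. g x)"
proof (cases "f \<in> borel_measurable (lebesgue_on S)")
  case True
  then show ?thesis using borel_measurable_lebesgue_on_AE[OF S True ae] ae by (intro integral_cong_AE)
next
  case False
  have ae': "AE x in lebesgue_on S. g x = f x" using ae by eventually_elim simp
  have "g \<notin> borel_measurable (lebesgue_on S)" using borel_measurable_lebesgue_on_AE[OF S _ ae'] False by blast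
  then have "\<not> integrable (lebesgue_on S) f" "\<not> integrable (lebesgue_on S) g" using False by auto
  then show ?thesis by (simp add: not_integrable_integral_eq)
qed

lemma abs_continuous_imp_continuous:
  assumes "abs_continuous_on c d f"
  shows "continuous_on {c..d} f"
  unfolding continuous_on_iff
proof (intro ballI allI impI)
  fix x and e :: real assume x: "x \<in> {c..d}" and e: "0 < e"
  have "\<exists>r>0. \<forall>D. finite D \<and> (\<forall>(u, v)\<in>D. c \<le> u \<and> u < v \<and> v \<le> d) \<and>
        pairwise (\<lambda>I J. {fst I<..<snd I} \<inter> {fst J<..<snd J} = {}) D \<and>
        (\<Sum>(u, v)\<in>D. v - u) < r \<longrightarrow> (\<Sum>(u, v)\<in>D. \<bar>f v - f u\<bar>) < e"
    using assms e unfolding abs_continuous_on_def by (elim allE[of _ e]) (erule mp)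
  then obtain r where r: "r > 0" and r': "\<forall>D. finite D \<and> (\<forall>(u, v)\<in>D. c \<le> u \<and> u < v \<and> v \<le> d) \<and>
        pairwise (\<lambda>I J. {fst I<..<snd I} \<inter> {fst J<..<snd J} = {}) D \<and>
        (\<Sum>(u, v)\<in>D. v - u) < r \<longrightarrow> (\<Sum>(u, v)\<in>D. \<bar>f v - f u\<bar>) < e"
    by (elim exE conjE) (rule that)
  have single: "\<bar>f v - f u\<bar> < e" if "c \<le> u" "u < v" "v \<le> d" "v - u < r" for u v
    using spec[OF r', of "{(u, v)}"] that by (simp add: pairwise_def)
  show "\<exists>r>0. \<forall>x'\<in>{c..d}. dist x' x < r \<longrightarrow> dist (f x') (f x) < e"
  proof (intro exI[of _ r] conjI ballI impI r)
    fix y assume y: "y \<in> {c..d}" "dist y x < r"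
    consider "x < y" | "y < x" | "x = y" by linarith
    then show "dist (f y) (f x) < e"
    proof cases
      case 1
      then show ?thesis using single[of x y] x y by (simp add: dist_real_def)
    next
      case 2
      then show ?thesis using single[of y x] x y by (simp add: dist_real_def abs_minus_commute)
    qed (use e in simp)
  qed
qed

text \<open>The lemmas on \<open>pot\<close> work with functions on the whole line, so the positive
  branch is extended oddly, as \<open>k s - k (- s)\<close>. Continuity at 0 is the hypothesis that
  \<open>h\<close> tends to 0 there.\<close>

lemma pos_extension_continuous_mono:
  fixes h :: "real \<Rightarrow> real"
  assumes c: "continuous_on {0<..} h" and lim: "(h \<longlongrightarrow> 0) (at_right 0)" and m: "strict_mono_on {0<..} h"
    and pos: "\<And>s. 0 < s \<Longrightarrow> 0 < h s"
  defines "k \<equiv> \<lambda>s. if s \<le> 0 then 0 else h s"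
  shows "continuous_on UNIV (\<lambda>s. k s - k (- s))" "mono (\<lambda>s. k s - k (- s))"
proof -
  have "isCont k s" for s
  proof -
    consider "s > 0" | "s < 0" | "s = 0" by linarith
    then show ?thesis
    proof cases
      case 1
      have "isCont h s" using c 1 by (simp add: continuous_on_eq_continuous_at)
      moreover have "\<forall>\<^sub>F t in nhds s. k t = h t"
        using eventually_nhds_in_open[of "{0<..}" s] 1 by (auto elim!: eventually_mono simp: k_def)
      ultimately show ?thesis by (subst isCont_cong)
    next
      case 2
      have "\<forall>\<^sub>F t in nhds s. k t = 0"
        using eventually_nhds_in_open[of "{..<0}" s] 2 by (auto elim!: eventually_mono simp: k_def)
      then show ?thesis by (subst isCont_cong) auto
    next
      case 3
      have "(k \<longlongrightarrow> 0) (at_right 0)"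
      proof (rule Lim_transform_eventually[OF lim])
        show "\<forall>\<^sub>F s in at_right 0. h s = k s"
          using eventually_at_right_less[of 0] by eventually_elim (simp add: k_def)
      qed
      moreover have "(k \<longlongrightarrow> 0) (at_left 0)"
      proof (rule Lim_transform_eventually[OF tendsto_const])
        show "\<forall>\<^sub>F s in at_left 0. 0 = k s"
          using eventually_at_left_real[of "-1" 0] by (auto elim!: eventually_mono simp: k_def)
      qed
      ultimately have "(k \<longlongrightarrow> 0) (at 0)" by (simp add: filterlim_split_at)
      then show ?thesis using 3 by (simp add: isCont_def k_def)
    qed
  qed
  then have kc: "continuous_on UNIV k" by (simp add: continuous_on_eq_continuous_at)
  show "continuous_on UNIV (\<lambda>s. k s - k (- s))"
    by (intro continuous_on_diff kc continuous_on_compose2[OF kc] continuous_intros) auto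
  have km: "k s \<le> k t" if "s \<le> t" for s t
  proof -
    consider "t \<le> 0" | "s \<le> 0" "0 < t" | "0 < s" by linarith
    then show ?thesis
    proof cases
      case 3
      then show ?thesis using that strict_mono_onD[OF m, of s t] by (cases "s = t") (auto simp: k_def less_imp_le)
    qed (use that pos in \<open>auto simp: k_def less_imp_le\<close>)
  qed
  show "mono (\<lambda>s. k s - k (- s))"
  proof (rule monoI)
    fix s t :: real assume "s \<le> t"
    then show "k s - k (- s) \<le> k t - k (- t)" using km[of s t] km[of "- t" "- s"] by simp
  qed
qed

section \<open>The Neumann problem as an instance of the abstract energy\<close>

locale neumann_problem = variable_exponent \<Omega> p pm pM
  for \<Omega> :: "'a::euclidean_space set" and p pm pM +
  fixes \<Psi> b :: "'a \<Rightarrow> real \<Rightarrow> real" and \<delta>\<^sub>0 lam \<epsilon> :: real and g :: "'a \<Rightarrow> real"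
  assumes Psi: "admissible_Psi \<Omega> p \<Psi>" and \<delta>\<^sub>0: "0 < \<delta>\<^sub>0" and b: "admissible_b \<Omega> \<delta>\<^sub>0 b"
    and lam: "0 < lam" and g: "g \<in> M_set \<Omega> \<delta>\<^sub>0 b lam" and \<epsilon>: "0 < \<epsilon>"
begin

text \<open>The odd extension of \<open>\<Phi>(x,\<cdot>)\<close>.\<close>

definition flux :: "'a \<Rightarrow> real \<Rightarrow> real" where
  "flux x s = (if s \<le> 0 then 0 else \<Psi> x s * s) - (if - s \<le> 0 then 0 else \<Psi> x (- s) * (- s))"

text \<open>The source is counted as part of the reaction: the bounds on \<open>g\<close> in
  \<open>M_set\<close> then become the sign condition of the locale \<open>energy\<close>.\<close>

definition reaction :: "'a \<Rightarrow> real \<Rightarrow> real" where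
  "reaction x s = lam * b_ext \<delta>\<^sub>0 b x s + \<epsilon> * spow (p x) s - g x"

lemma flux_Phi: "0 \<le> s \<Longrightarrow> flux x s = op_Phi \<Psi> x s"
  by (auto simp: flux_def op_Phi_def)

lemma flux_regular: "AE x in M. continuous_on UNIV (flux x) \<and> mono (flux x) \<and> flux x 0 = 0"
proof -
  have "AE x in M. (\<forall>c d. 0 < c \<and> c \<le> d \<longrightarrow> abs_continuous_on c d (\<Psi> x)) \<and>
        ((\<lambda>s. \<Psi> x s * s) \<longlongrightarrow> 0) (at_right 0) \<and> strict_mono_on {0<..} (\<lambda>s. \<Psi> x s * s)"
    using Psi unfolding admissible_Psi_def by blast
  then show ?thesis using AE_space[of M]
  proof eventually_elim
    case (elim x)
    have x: "x \<in> closure \<Omega>" using elim(2) closure_subset by auto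
    have pos: "0 < \<Psi> x s * s" if "0 < s" for s
      using Psi x that unfolding admissible_Psi_def by simp
    have "isCont (\<Psi> x) s" if "0 < s" for s
    proof -
      have "continuous_on {s/2..2 * s} (\<Psi> x)" using elim(1) that by (intro abs_continuous_imp_continuous) auto
      then have "continuous_on {s/2<..<2 * s} (\<Psi> x)" by (rule continuous_on_subset) auto
      then show ?thesis using that by (simp add: continuous_on_eq_continuous_at)
    qed
    then have c: "continuous_on {0<..} (\<lambda>s. \<Psi> x s * s)"
      by (intro continuous_at_imp_continuous_on ballI isCont_mult continuous_ident) simp
    have eq: "flux x = (\<lambda>s. (if s \<le> 0 then 0 else \<Psi> x s * s) - (if - s \<le> 0 then 0 else \<Psi> x (- s) * (- s)))"
      by (simp add: flux_def[abs_def])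
    show ?case
      using pos_extension_continuous_mono[OF c _ _ pos] elim(1) by (auto simp: eq)
  qed
qed

text \<open>The null set must not depend on \<open>\<xi>\<close>, as \<open>\<xi>\<close> will be
  replaced by gradients \<open>G n x\<close>; hence the quantifier inside.\<close>

lemma op_A_flux: "AE x in M. \<forall>\<xi>. op_A \<Psi> x \<xi> = pot (flux x) (norm \<xi>)"
  using flux_regular
proof eventually_elim
  case (elim x)
  show ?case
  proof
    fix \<xi> :: 'a
    have c: "continuous_on UNIV (flux x)" using elim by simp
    have c': "continuous_on {0..norm \<xi>} (op_Phi \<Psi> x)"
      by (rule continuous_on_eq[OF continuous_on_subset[OF c subset_UNIV]]) (simp add: flux_Phi)
    have "op_A \<Psi> x \<xi> = integral {0..norm \<xi>} (op_Phi \<Psi> x)"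
      unfolding op_A_def by (rule set_borel_integral_eq_integral(2)[OF borel_integrable_atLeastAtMost'[OF c']])
    also have "\<dots> = integral {0..norm \<xi>} (flux x)"
      by (rule Henstock_Kurzweil_Integration.integral_cong) (simp add: flux_Phi)
    also have "\<dots> = pot (flux x) (norm \<xi>)" by (rule pot_eq_integral[OF c, symmetric]) simp
    finally show "op_A \<Psi> x \<xi> = pot (flux x) (norm \<xi>)" .
  qed
qed

lemma op_a_flux: "op_a \<Psi> x \<xi> = radial (flux x) \<xi>"
  by (simp add: op_a_def radial_def flux_def sgn_div_norm)

lemma b_regular: "AE x in M. continuous_on {0..\<delta>\<^sub>0} (b x) \<and> strict_mono_on {0..\<delta>\<^sub>0} (b x)"
  using b by (simp add: admissible_b_def)

lemma b_nonneg: "x \<in> \<Omega> \<Longrightarrow> 0 \<le> b x (clip 0 \<delta>\<^sub>0 s)"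
proof -
  assume "x \<in> \<Omega>"
  then have "x \<in> closure \<Omega>" using closure_subset by blast
  then show ?thesis using b \<delta>\<^sub>0 unfolding admissible_b_def by (auto simp: clip_def)
qed

text \<open>The three properties are read off from \<open>b_ext_eq\<close>, a composition of
  \<open>b x\<close> with the truncation plus two monotone terms; the growth bound adds that
  \<open>b\<close> is nonnegative and increasing.\<close>

lemma b_ext_regular:
  "AE x in M. continuous_on UNIV (b_ext \<delta>\<^sub>0 b x) \<and> mono (b_ext \<delta>\<^sub>0 b x) \<and>
    (\<forall>s. \<bar>b_ext \<delta>\<^sub>0 b x s\<bar> \<le> b x \<delta>\<^sub>0 + \<bar>s\<bar>)"
  using b_regular AE_space[of M]
proof eventually_elim
  case (elim x)
  have c: "continuous_on {0..\<delta>\<^sub>0} (b x)" and m: "mono_on {0..\<delta>\<^sub>0} (b x)"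
    using elim(1) strict_mono_on_imp_mono_on by auto
  have cl: "clip 0 \<delta>\<^sub>0 s \<in> {0..\<delta>\<^sub>0}" for s using \<delta>\<^sub>0 by (auto simp: clip_def)
  have eq: "b_ext \<delta>\<^sub>0 b x = (\<lambda>s. b x (clip 0 \<delta>\<^sub>0 s) + min s 0 + max (s - \<delta>\<^sub>0) 0)"
    by (rule ext) (rule b_ext_eq[OF \<delta>\<^sub>0])
  have "continuous_on UNIV (\<lambda>s. b x (clip 0 \<delta>\<^sub>0 s))"
  proof (rule continuous_on_compose2[OF c])
    show "continuous_on UNIV (clip 0 \<delta>\<^sub>0)" unfolding clip_def[abs_def] by (intro continuous_intros)
  qed (use cl in auto)
  then have 1: "continuous_on UNIV (b_ext \<delta>\<^sub>0 b x)" unfolding eq by (intro continuous_intros)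
  have 2: "mono (b_ext \<delta>\<^sub>0 b x)"
  proof (rule monoI)
    fix s t :: real assume st: "s \<le> t"
    then have "clip 0 \<delta>\<^sub>0 s \<le> clip 0 \<delta>\<^sub>0 t" by (auto simp: clip_def)
    then have "b x (clip 0 \<delta>\<^sub>0 s) \<le> b x (clip 0 \<delta>\<^sub>0 t)" using mono_onD[OF m cl cl] by blast
    then show "b_ext \<delta>\<^sub>0 b x s \<le> b_ext \<delta>\<^sub>0 b x t"
      unfolding eq using st by (intro add_mono) auto
  qed
  have "\<bar>b_ext \<delta>\<^sub>0 b x s\<bar> \<le> b x \<delta>\<^sub>0 + \<bar>s\<bar>" for s
  proof -
    have "clip 0 \<delta>\<^sub>0 s \<le> \<delta>\<^sub>0" using cl by auto
    then have "b x (clip 0 \<delta>\<^sub>0 s) \<le> b x \<delta>\<^sub>0" using cl[of s] \<delta>\<^sub>0 by (intro mono_onD[OF m]) auto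
    moreover have "0 \<le> b x (clip 0 \<delta>\<^sub>0 s)" using b_nonneg elim(2) by simp
    moreover have "\<bar>min s 0 + max (s - \<delta>\<^sub>0) 0\<bar> \<le> \<bar>s\<bar>" using \<delta>\<^sub>0 by (auto simp: min_def max_def)
    ultimately show ?thesis unfolding eq by linarith
  qed
  with 1 2 show ?case by blast
qed

lemma b_ext_measurable: "(\<lambda>x. b_ext \<delta>\<^sub>0 b x s) \<in> borel_measurable M"
proof -
  have "clip 0 \<delta>\<^sub>0 s \<in> {0..\<delta>\<^sub>0}" using \<delta>\<^sub>0 by (auto simp: clip_def)
  then have "(\<lambda>x. b x (clip 0 \<delta>\<^sub>0 s)) \<in> borel_measurable (lebesgue_on (closure \<Omega>))"
    using b unfolding admissible_b_def by blast
  then have [measurable]: "(\<lambda>x. b x (clip 0 \<delta>\<^sub>0 s)) \<in> borel_measurable M"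
    by (rule measurable_restrict_mono) (rule closure_subset)
  show ?thesis unfolding b_ext_eq[OF \<delta>\<^sub>0] by measurable
qed

lemma b_ext_comp_measurable: "v \<in> borel_measurable M \<Longrightarrow> (\<lambda>x. b_ext \<delta>\<^sub>0 b x (v x)) \<in> borel_measurable M"
proof (rule caratheodory_measurable[OF \<Omega>_measurable b_ext_measurable])
  show "AE x in M. continuous_on UNIV (b_ext \<delta>\<^sub>0 b x)" using b_ext_regular by eventually_elim simp
qed

lemma b_top_integrable: "integrable M (\<lambda>x. b x \<delta>\<^sub>0)"
proof (rule integrable_AE_bounded[of "\<lambda>x. 1 + \<bar>b x \<delta>\<^sub>0\<bar> powr 2"])
  have "(\<lambda>x. b x \<delta>\<^sub>0) \<in> lebesgue_space \<Omega> (\<lambda>_. 2)" using b by (simp add: admissible_b_def)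
  then show "integrable M (\<lambda>x. 1 + \<bar>b x \<delta>\<^sub>0\<bar> powr 2)" "(\<lambda>x. b x \<delta>\<^sub>0) \<in> borel_measurable M"
    by (auto simp: lebesgue_space_def)
  show "AE x in M. \<bar>b x \<delta>\<^sub>0\<bar> \<le> 1 + \<bar>b x \<delta>\<^sub>0\<bar> powr 2"
  proof (rule AE_I2)
    fix x
    have "2 * \<bar>b x \<delta>\<^sub>0\<bar> \<le> 1 + \<bar>b x \<delta>\<^sub>0\<bar>\<^sup>2" using zero_le_power2[of "\<bar>b x \<delta>\<^sub>0\<bar> - 1"] by (simp add: power2_diff)
    then show "\<bar>b x \<delta>\<^sub>0\<bar> \<le> 1 + \<bar>b x \<delta>\<^sub>0\<bar> powr 2" by (simp add: powr_numeral)
  qed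
qed

lemma g_bounded:
  obtains C where "C \<ge> 0" "AE x in M. \<bar>g x\<bar> \<le> C"
proof -
  obtain C where "AE x in M. \<bar>g x\<bar> \<le> C" using g unfolding M_set_def ess_bounded_def by blast
  then have "AE x in M. \<bar>g x\<bar> \<le> \<bar>C\<bar>" by eventually_elim linarith
  then show ?thesis using that[of "\<bar>C\<bar>"] by simp
qed

lemma g_measurable [measurable]: "g \<in> borel_measurable M"
  using g by (simp add: M_set_def ess_bounded_def)

lemma g_mult_integrable:
  assumes "integrable M \<phi>"
  shows "integrable M (\<lambda>x. g x * \<phi> x)"
proof -
  obtain C where C: "C \<ge> 0" "AE x in M. \<bar>g x\<bar> \<le> C" by (rule g_bounded)
  show ?thesis
  proof (rule integrable_AE_bounded)
    show "integrable M (\<lambda>x. C * \<bar>\<phi> x\<bar>)" using assms by auto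
    show "(\<lambda>x. g x * \<phi> x) \<in> borel_measurable M" using assms by (intro borel_measurable_times g_measurable) auto
    show "AE x in M. \<bar>g x * \<phi> x\<bar> \<le> C * \<bar>\<phi> x\<bar>"
      using C(2) by eventually_elim (simp add: abs_mult mult_right_mono)
  qed
qed

lemma g_range: "AE x in M. lam * b x 0 \<le> g x \<and> g x \<le> lam * b x \<delta>\<^sub>0"
  using g by (simp add: M_set_def)

lemma spow_comp_measurable:
  assumes [measurable]: "v \<in> borel_measurable M"
  shows "(\<lambda>x. spow (p x) (v x)) \<in> borel_measurable M"
proof -
  note [measurable] = p_measurable
  show ?thesis unfolding spow_def by measurable
qed

sublocale energy \<Omega> p pm pM flux reaction \<delta>\<^sub>0
proof unfold_locales
  show "0 < \<delta>\<^sub>0" by (rule \<delta>\<^sub>0)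
  show "AE x in M. continuous_on UNIV (flux x) \<and> mono (flux x) \<and> flux x 0 = 0" by (rule flux_regular)
  show "(\<lambda>x. flux x (v x)) \<in> lebesgue_space \<Omega> (conj_exponent p)" if "v \<in> lebesgue_space \<Omega> p" "\<And>x. 0 \<le> v x" for v
    using Psi that unfolding admissible_Psi_def by (simp add: flux_Phi)
  show "filterlim (\<lambda>n. LINT x|M. pot (flux x) (norm (G n x))) at_top sequentially"
    if "\<And>n::nat. sobolev_gradient \<Omega> p (V n) (G n)"
      "filterlim (\<lambda>n. LINT x|M. norm (G n x) powr p x) at_top sequentially" for V G
  proof -
    have "filterlim (\<lambda>n. LINT x|M. op_A \<Psi> x (G n x)) at_top sequentially"
      using Psi that unfolding admissible_Psi_def by blast
    moreover have "(LINT x|M. op_A \<Psi> x (G n x)) = (LINT x|M. pot (flux x) (norm (G n x)))" for n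
    proof (rule integral_lebesgue_on_cong_AE[OF \<Omega>_measurable])
      show "AE x in M. op_A \<Psi> x (G n x) = pot (flux x) (norm (G n x))" using op_A_flux by eventually_elim blast
    qed
    ultimately show ?thesis by simp
  qed
  show "AE x in M. continuous_on UNIV (reaction x) \<and> mono (reaction x)"
    using b_ext_regular AE_space[of M]
  proof eventually_elim
    case (elim x)
    have r: "1 < p x" using p_pos elim(2) by simp
    have "continuous_on UNIV (reaction x)"
      unfolding reaction_def[abs_def] using elim(1) continuous_spow[OF r]
      by (intro continuous_intros) auto
    moreover have "mono (reaction x)"
    proof (rule monoI)
      fix s t :: real assume st: "s \<le> t"
      have "b_ext \<delta>\<^sub>0 b x s \<le> b_ext \<delta>\<^sub>0 b x t" using elim(1) st by (auto dest: monoD)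
      moreover have "spow (p x) s \<le> spow (p x) t"
        using strict_mono_mono[OF strict_mono_spow[OF r]] st by (rule monoD)
      ultimately show "reaction x s \<le> reaction x t"
        unfolding reaction_def using lam \<epsilon> by (intro diff_mono add_mono mult_left_mono) auto
    qed
    ultimately show ?case by blast
  qed
  show "(\<lambda>x. reaction x s) \<in> borel_measurable M" for s
    unfolding reaction_def using b_ext_measurable[of s] spow_comp_measurable[of "\<lambda>_. s"] by measurable
  show "\<exists>h. integrable M h \<and> (AE x in M. \<forall>s. \<bar>s\<bar> \<le> R \<longrightarrow> \<bar>reaction x s\<bar> \<le> h x)" for R
  proof (intro exI conjI)
    \<comment> \<open>The base \<open>1 + \<bar>R\<bar>\<close> is at least 1, so its power with
      \<open>pM\<close> bounds those with all the exponents \<open>p x - 1\<close> that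
      occur.\<close>
    let ?h = "\<lambda>x. lam * (b x \<delta>\<^sub>0 + \<bar>R\<bar>) + \<epsilon> * (1 + \<bar>R\<bar>) powr pM + \<bar>g x\<bar>"
    have "integrable M g" using g_mult_integrable[of "\<lambda>_. 1"] by simp
    then show "integrable M ?h" using b_top_integrable by auto
    show "AE x in M. \<forall>s. \<bar>s\<bar> \<le> R \<longrightarrow> \<bar>reaction x s\<bar> \<le> ?h x"
      using b_ext_regular AE_space[of M]
    proof eventually_elim
      case (elim x)
      show ?case
      proof (intro allI impI)
        fix s assume s: "\<bar>s\<bar> \<le> R"
        have px: "1 < p x" "p x \<le> pM" using p_pos p_bounds elim(2) by auto
        have "\<bar>spow (p x) s\<bar> \<le> (1 + \<bar>R\<bar>) powr (p x - 1)"
          unfolding abs_spow using s px by (intro powr_mono2) auto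
        also have "\<dots> \<le> (1 + \<bar>R\<bar>) powr pM" using px by (intro powr_mono) auto
        finally have 1: "\<epsilon> * \<bar>spow (p x) s\<bar> \<le> \<epsilon> * (1 + \<bar>R\<bar>) powr pM" using \<epsilon> by (intro mult_left_mono) auto
        have "\<bar>b_ext \<delta>\<^sub>0 b x s\<bar> \<le> b x \<delta>\<^sub>0 + \<bar>s\<bar>" using elim(1) by blast
        also have "\<dots> \<le> b x \<delta>\<^sub>0 + \<bar>R\<bar>" using s by simp
        finally have 2: "lam * \<bar>b_ext \<delta>\<^sub>0 b x s\<bar> \<le> lam * (b x \<delta>\<^sub>0 + \<bar>R\<bar>)" using lam by (intro mult_left_mono) auto
        have "\<bar>lam * b_ext \<delta>\<^sub>0 b x s\<bar> = lam * \<bar>b_ext \<delta>\<^sub>0 b x s\<bar>" "\<bar>\<epsilon> * spow (p x) s\<bar> = \<epsilon> * \<bar>spow (p x) s\<bar>"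
          using lam \<epsilon> by (auto simp: abs_mult)
        then show "\<bar>reaction x s\<bar> \<le> ?h x" unfolding reaction_def using 1 2 by linarith
      qed
    qed
  qed
  \<comment> \<open>For s at most 0, monotonicity gives lam b_ext(x,s) at most lam b(x,0), hence at
    most g(x), and the power term is at most 0. Above \<open>\<delta>\<^sub>0\<close> the upper
    bound on \<open>g\<close> is used in the same way.\<close>
  show "AE x in M. (\<forall>s\<le>0. reaction x s \<le> 0) \<and> (\<forall>s\<ge>\<delta>\<^sub>0. 0 \<le> reaction x s)"
    using g_range b_ext_regular AE_space[of M]
  proof eventually_elim
    case (elim x)
    have r: "1 < p x" using p_pos elim(3) by simp
    have sm: "mono (spow (p x))" using strict_mono_mono[OF strict_mono_spow[OF r]] .
    have s0: "spow (p x) 0 = 0" by (simp add: spow_def)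
    have bm: "mono (b_ext \<delta>\<^sub>0 b x)" using elim(2) by blast
    have b0: "b_ext \<delta>\<^sub>0 b x 0 = b x 0" "b_ext \<delta>\<^sub>0 b x \<delta>\<^sub>0 = b x \<delta>\<^sub>0" using \<delta>\<^sub>0 by (auto simp: b_ext_def)
    show ?case
    proof (intro conjI allI impI)
      fix s :: real assume s: "s \<le> 0"
      have "lam * b_ext \<delta>\<^sub>0 b x s \<le> lam * b x 0" using monoD[OF bm s] lam b0 by (intro mult_left_mono) auto
      moreover have "\<epsilon> * spow (p x) s \<le> 0" using monoD[OF sm s] s0 \<epsilon> by (simp add: mult_le_0_iff)
      ultimately show "reaction x s \<le> 0" unfolding reaction_def using elim(1) by linarith
    next
      fix s assume s: "\<delta>\<^sub>0 \<le> s"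
      have "lam * b x \<delta>\<^sub>0 \<le> lam * b_ext \<delta>\<^sub>0 b x s" using monoD[OF bm s] lam b0 by (intro mult_left_mono) auto
      moreover have "0 \<le> \<epsilon> * spow (p x) s" using monoD[OF sm, of 0 s] s \<delta>\<^sub>0 s0 \<epsilon> by simp
      ultimately show "0 \<le> reaction x s" unfolding reaction_def using elim(1) by linarith
    qed
  qed
qed

end

lemma bounded_imp_min_max:
  fixes p :: "'a::euclidean_space \<Rightarrow> real"
  assumes "compact S" "S \<noteq> {}" "continuous_on S p" "\<And>x. x \<in> S \<Longrightarrow> 1 < p x"
  obtains pm pM where "1 < pm" "\<And>x. x \<in> S \<Longrightarrow> pm \<le> p x" "\<And>x. x \<in> S \<Longrightarrow> p x \<le> pM"
proof -
  obtain y where y: "y \<in> S" "\<forall>x\<in>S. p y \<le> p x" using continuous_attains_inf[OF assms(1-3)] by blast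
  obtain z where z: "z \<in> S" "\<forall>x\<in>S. p x \<le> p z" using continuous_attains_sup[OF assms(1-3)] by blast
  show ?thesis by (rule that[of "p y" "p z"]) (use y z assms(4) in auto)
qed

section \<open>Existence for all test functions, and uniqueness\<close>

context neumann_problem
begin

lemma b_ext_Lp_mult_integrable:
  assumes v: "v \<in> lebesgue_space \<Omega> p" and \<phi>: "\<phi> \<in> borel_measurable M" "AE x in M. \<bar>\<phi> x\<bar> \<le> B"
  shows "integrable M (\<lambda>x. b_ext \<delta>\<^sub>0 b x (v x) * \<phi> x)"
proof (rule integrable_AE_bounded)
  show "integrable M (\<lambda>x. (b x \<delta>\<^sub>0 + \<bar>v x\<bar>) * B)"
    using b_top_integrable Lp_integrable[OF v] by auto
  show "(\<lambda>x. b_ext \<delta>\<^sub>0 b x (v x) * \<phi> x) \<in> borel_measurable M"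
    using b_ext_comp_measurable[OF Lp_measurable[OF v]] \<phi>(1) by (rule borel_measurable_times)
  show "AE x in M. \<bar>b_ext \<delta>\<^sub>0 b x (v x) * \<phi> x\<bar> \<le> (b x \<delta>\<^sub>0 + \<bar>v x\<bar>) * B"
    using b_ext_regular \<phi>(2)
  proof eventually_elim
    case (elim x)
    have "\<bar>b_ext \<delta>\<^sub>0 b x (v x)\<bar> \<le> b x \<delta>\<^sub>0 + \<bar>v x\<bar>" using elim(1) by blast
    then show ?case unfolding abs_mult using elim(2) by (intro mult_mono) auto
  qed
qed

text \<open>The power with exponent \<open>p x - 1\<close> is at most 1 plus the one with
  \<open>p x\<close>, according to whether \<open>\<bar>v x\<bar>\<close> is at most 1 or not, and
  the latter is integrable.\<close>

lemma spow_Lp_mult_integrable: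
  assumes v: "v \<in> lebesgue_space \<Omega> p" and \<phi>: "\<phi> \<in> borel_measurable M" "AE x in M. \<bar>\<phi> x\<bar> \<le> B"
  shows "integrable M (\<lambda>x. spow (p x) (v x) * \<phi> x)"
proof (rule integrable_AE_bounded)
  show "integrable M (\<lambda>x. (1 + \<bar>v x\<bar> powr p x) * B)" using v by (auto simp: lebesgue_space_def)
  show "(\<lambda>x. spow (p x) (v x) * \<phi> x) \<in> borel_measurable M"
    using spow_comp_measurable[OF Lp_measurable[OF v]] \<phi>(1) by (rule borel_measurable_times)
  show "AE x in M. \<bar>spow (p x) (v x) * \<phi> x\<bar> \<le> (1 + \<bar>v x\<bar> powr p x) * B"
    using \<phi>(2) AE_space[of M]
  proof eventually_elim
    case (elim x)
    have px: "1 < p x" using p_pos elim(2) by simp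
    have "\<bar>spow (p x) (v x)\<bar> \<le> 1 + \<bar>v x\<bar> powr p x"
    proof (cases "\<bar>v x\<bar> \<le> 1")
      case True
      then have "\<bar>v x\<bar> powr (p x - 1) \<le> 1 powr (p x - 1)" using px by (intro powr_mono2) auto
      then have "\<bar>spow (p x) (v x)\<bar> \<le> 1" by (simp add: abs_spow)
      then show ?thesis using powr_ge_zero[of "\<bar>v x\<bar>" "p x"] by linarith
    next
      case False
      then have "\<bar>v x\<bar> powr (p x - 1) \<le> \<bar>v x\<bar> powr p x" by (intro powr_mono) auto
      then show ?thesis by (simp add: abs_spow)
    qed
    then show ?case unfolding abs_mult using elim(1) powr_ge_zero[of "\<bar>v x\<bar>" "p x"] by (intro mult_mono) auto
  qed
qed

text \<open>Counterpart of the preceding lemma with the roles exchanged: \<open>v\<close> bounded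
  and the test function merely integrable, as the passage to unbounded test functions
  requires.\<close>

lemma spow_bounded_mult_integrable:
  assumes v: "v \<in> borel_measurable M" "AE x in M. 0 \<le> v x \<and> v x \<le> \<delta>\<^sub>0" and \<phi>: "integrable M \<phi>"
  shows "integrable M (\<lambda>x. spow (p x) (v x) * \<phi> x)"
proof (rule integrable_AE_bounded)
  show "integrable M (\<lambda>x. (1 + \<delta>\<^sub>0) powr pM * \<bar>\<phi> x\<bar>)" using \<phi> by auto
  show "(\<lambda>x. spow (p x) (v x) * \<phi> x) \<in> borel_measurable M"
    using spow_comp_measurable[OF v(1)] \<phi> by (intro borel_measurable_times) auto
  show "AE x in M. \<bar>spow (p x) (v x) * \<phi> x\<bar> \<le> (1 + \<delta>\<^sub>0) powr pM * \<bar>\<phi> x\<bar>"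
    using v(2) AE_space[of M]
  proof eventually_elim
    case (elim x)
    have px: "1 < p x" "p x \<le> pM" using p_pos p_bounds elim(2) by auto
    have "\<bar>spow (p x) (v x)\<bar> \<le> (1 + \<delta>\<^sub>0) powr (p x - 1)"
      unfolding abs_spow using elim(1) px by (intro powr_mono2) auto
    also have "\<dots> \<le> (1 + \<delta>\<^sub>0) powr pM" using px \<delta>\<^sub>0 by (intro powr_mono) auto
    finally show ?case unfolding abs_mult by (intro mult_right_mono) auto
  qed
qed

definition weak_form :: "('a \<Rightarrow> real) \<Rightarrow> ('a \<Rightarrow> 'a) \<Rightarrow> ('a \<Rightarrow> real) \<Rightarrow> ('a \<Rightarrow> 'a) \<Rightarrow> bool" where
  "weak_form V G \<phi> H \<longleftrightarrow>
    (LINT x|M. radial (flux x) (G x) \<bullet> H x) + lam * (LINT x|M. b_ext \<delta>\<^sub>0 b x (V x) * \<phi> x)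
      + \<epsilon> * (LINT x|M. spow (p x) (V x) * \<phi> x) = (LINT x|M. g x * \<phi> x)"

lemma weak_solution_iff:
  "weak_solution \<Omega> p \<Psi> \<delta>\<^sub>0 b lam \<epsilon> g V \<longleftrightarrow>
    (\<exists>G. sobolev_gradient \<Omega> p V G \<and> (\<forall>\<phi> H. sobolev_gradient \<Omega> p \<phi> H \<longrightarrow> weak_form V G \<phi> H))"
  unfolding weak_solution_def weak_form_def spow_def op_a_flux ..

text \<open>
  No embedding into \<open>L\<^sup>2(\<Omega>)\<close> is needed for unbounded test functions: as \<open>b \<ge> 0\<close>, monotone convergence
  along truncations of \<open>\<phi>\<close> yields the integrability of \<open>b(x, V) \<phi>\<close> from the convergence of all other terms.
\<close>

lemma weak_form_extend:
  assumes sV: "sobolev_gradient \<Omega> p V G" and V01: "AE x in M. 0 \<le> V x \<and> V x \<le> \<delta>\<^sub>0"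
    and bdd: "\<And>\<phi> H B. sobolev_gradient \<Omega> p \<phi> H \<Longrightarrow> AE x in M. \<bar>\<phi> x\<bar> \<le> B \<Longrightarrow> weak_form V G \<phi> H"
    and s\<phi>: "sobolev_gradient \<Omega> p \<phi> H"
  shows "weak_form V G \<phi> H"
proof -
  have VL: "V \<in> lebesgue_space \<Omega> p" using sV by (simp add: sobolev_gradient_def)
  have bV0: "AE x in M. 0 \<le> b_ext \<delta>\<^sub>0 b x (V x)"
    using V01 AE_space[of M]
  proof eventually_elim
    case (elim x)
    then have "b_ext \<delta>\<^sub>0 b x (V x) = b x (clip 0 \<delta>\<^sub>0 (V x))" unfolding b_ext_eq[OF \<delta>\<^sub>0] by simp
    then show ?case using b_nonneg[of x "V x"] elim(2) by simp
  qed
  \<comment> \<open>Stated for general truncations because it is used twice: for the one-sided ones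
    that increase to a positive part and for the two-sided ones that tend to \<open>\<phi>\<close>.
    The term with \<open>b\<close> is left out, as its majorant is not yet known to be
    integrable.\<close>
  have lims: "(\<lambda>n. LINT x|M. radial (flux x) (G x) \<bullet> Hn n x) \<longlonglongrightarrow> (LINT x|M. radial (flux x) (G x) \<bullet> K x)"
      "(\<lambda>n. LINT x|M. spow (p x) (V x) * fn n x) \<longlonglongrightarrow> (LINT x|M. spow (p x) (V x) * \<psi> x)"
      "(\<lambda>n. LINT x|M. g x * fn n x) \<longlonglongrightarrow> (LINT x|M. g x * \<psi> x)"
    if sn: "\<And>n. sobolev_gradient \<Omega> p (fn n) (Hn n)" and s: "sobolev_gradient \<Omega> p \<theta> L"
      and sK: "sobolev_gradient \<Omega> p \<psi> K"
      and dom: "\<And>n x. \<bar>fn n x\<bar> \<le> \<bar>\<theta> x\<bar>" "\<And>n x. Hn n x = 0 \<or> Hn n x = L x"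
      and lim: "\<And>x. (\<lambda>n. fn n x) \<longlonglongrightarrow> \<psi> x" "\<And>x. (\<lambda>n. Hn n x) \<longlonglongrightarrow> K x" for fn Hn \<psi> K \<theta> L
  proof -
    have \<theta>: "integrable M \<theta>" using s Lp_integrable by (simp add: sobolev_gradient_def)
    have fi: "integrable M (fn n)" for n using sn Lp_integrable by (simp add: sobolev_gradient_def)
    have \<psi>i: "integrable M \<psi>" using sK Lp_integrable by (simp add: sobolev_gradient_def)
    have Vm: "V \<in> borel_measurable M" using sob_measurable[OF sV] by simp
    note ms = spow_comp_measurable[OF Vm]
    show "(\<lambda>n. LINT x|M. radial (flux x) (G x) \<bullet> Hn n x) \<longlonglongrightarrow> (LINT x|M. radial (flux x) (G x) \<bullet> K x)"
    proof (rule integral_dominated_convergence[where w = "\<lambda>x. \<bar>radial (flux x) (G x) \<bullet> L x\<bar>"])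
      show "(\<lambda>x. radial (flux x) (G x) \<bullet> K x) \<in> borel_measurable M" using radial_integrable[OF sV sK] by auto
      show "(\<lambda>x. radial (flux x) (G x) \<bullet> Hn n x) \<in> borel_measurable M" for n using radial_integrable[OF sV sn] by auto
      show "integrable M (\<lambda>x. \<bar>radial (flux x) (G x) \<bullet> L x\<bar>)" using radial_integrable[OF sV s] by (rule integrable_abs)
      show "AE x in M. (\<lambda>n. radial (flux x) (G x) \<bullet> Hn n x) \<longlonglongrightarrow> radial (flux x) (G x) \<bullet> K x"
        by (intro AE_I2 tendsto_inner tendsto_const lim)
      show "AE x in M. norm (radial (flux x) (G x) \<bullet> Hn n x) \<le> \<bar>radial (flux x) (G x) \<bullet> L x\<bar>" for n
      proof (rule AE_I2)
        fix x show "norm (radial (flux x) (G x) \<bullet> Hn n x) \<le> \<bar>radial (flux x) (G x) \<bullet> L x\<bar>"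
          using dom(2)[of n x] by auto
      qed
    qed
    have dom_mult: "norm (c * fn n x) \<le> \<bar>c * \<theta> x\<bar>" for c n x
      using dom(1)[of n x] by (simp add: abs_mult mult_left_mono)
    show "(\<lambda>n. LINT x|M. spow (p x) (V x) * fn n x) \<longlonglongrightarrow> (LINT x|M. spow (p x) (V x) * \<psi> x)"
    proof (rule integral_dominated_convergence[where w = "\<lambda>x. \<bar>spow (p x) (V x) * \<theta> x\<bar>"])
      show "integrable M (\<lambda>x. \<bar>spow (p x) (V x) * \<theta> x\<bar>)"
        using spow_bounded_mult_integrable[OF Vm V01 \<theta>] by (rule integrable_abs)
      show "(\<lambda>x. spow (p x) (V x) * \<psi> x) \<in> borel_measurable M" using ms \<psi>i by (intro borel_measurable_times) auto
      show "(\<lambda>x. spow (p x) (V x) * fn n x) \<in> borel_measurable M" for n using ms fi by (intro borel_measurable_times) auto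
      show "AE x in M. (\<lambda>n. spow (p x) (V x) * fn n x) \<longlonglongrightarrow> spow (p x) (V x) * \<psi> x"
        by (intro AE_I2 tendsto_mult tendsto_const lim)
      show "AE x in M. norm (spow (p x) (V x) * fn n x) \<le> \<bar>spow (p x) (V x) * \<theta> x\<bar>" for n
        by (intro AE_I2 dom_mult)
    qed
    show "(\<lambda>n. LINT x|M. g x * fn n x) \<longlonglongrightarrow> (LINT x|M. g x * \<psi> x)"
    proof (rule integral_dominated_convergence[where w = "\<lambda>x. \<bar>g x * \<theta> x\<bar>"])
      show "integrable M (\<lambda>x. \<bar>g x * \<theta> x\<bar>)" using g_mult_integrable[OF \<theta>] by (rule integrable_abs)
      show "(\<lambda>x. g x * \<psi> x) \<in> borel_measurable M" using g_mult_integrable[OF \<psi>i] by auto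
      show "(\<lambda>x. g x * fn n x) \<in> borel_measurable M" for n using g_mult_integrable[OF fi] by auto
      show "AE x in M. (\<lambda>n. g x * fn n x) \<longlonglongrightarrow> g x * \<psi> x" by (intro AE_I2 tendsto_mult tendsto_const lim)
      show "AE x in M. norm (g x * fn n x) \<le> \<bar>g x * \<theta> x\<bar>" for n by (intro AE_I2 dom_mult)
    qed
  qed
  have ev: "\<forall>\<^sub>F n in sequentially. \<bar>c\<bar> < real n" for c :: real
    using filterlim_real_sequentially by (simp add: filterlim_at_top_dense)
  have bpos: "integrable M (\<lambda>x. b_ext \<delta>\<^sub>0 b x (V x) * max (\<theta> x) 0)" if s: "sobolev_gradient \<Omega> p \<theta> L" for \<theta> L
  proof -
    define fn where "fn n x = clip 0 (real n) (\<theta> x)" for n x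
    define Hn where "Hn n x = (if 0 < \<theta> x \<and> \<theta> x \<le> real n then L x else 0)" for n x
    have sn: "sobolev_gradient \<Omega> p (fn n) (Hn n)" for n unfolding fn_def Hn_def by (rule sob_clip[OF s]) simp
    have l1: "(\<lambda>n. fn n x) \<longlonglongrightarrow> max (\<theta> x) 0" for x
      by (rule Lim_transform_eventually[OF tendsto_const], rule eventually_mono[OF ev[of "\<theta> x"]])
        (auto simp: fn_def clip_def)
    have l2: "(\<lambda>n. Hn n x) \<longlonglongrightarrow> (if 0 < \<theta> x then L x else 0)" for x
      by (rule Lim_transform_eventually[OF tendsto_const], rule eventually_mono[OF ev[of "\<theta> x"]])
        (auto simp: Hn_def)
    have fb: "AE x in M. \<bar>fn n x\<bar> \<le> real n" for n by (intro AE_I2) (auto simp: fn_def clip_def)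
    note lm = lims[OF sn s sob_pos_part[OF s] _ _ l1 l2]
    have d: "\<bar>fn n x\<bar> \<le> \<bar>\<theta> x\<bar>" "Hn n x = 0 \<or> Hn n x = L x" for n x by (auto simp: fn_def Hn_def clip_def)
    have "lam * (LINT x|M. b_ext \<delta>\<^sub>0 b x (V x) * fn n x) = (LINT x|M. g x * fn n x)
        - (LINT x|M. radial (flux x) (G x) \<bullet> Hn n x) - \<epsilon> * (LINT x|M. spow (p x) (V x) * fn n x)" for n
      using bdd[OF sn fb, of n] unfolding weak_form_def by linarith
    then have "(\<lambda>n. lam * (LINT x|M. b_ext \<delta>\<^sub>0 b x (V x) * fn n x)) \<longlonglongrightarrow>
        (LINT x|M. g x * max (\<theta> x) 0) - (LINT x|M. radial (flux x) (G x) \<bullet> (if 0 < \<theta> x then L x else 0))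
          - \<epsilon> * (LINT x|M. spow (p x) (V x) * max (\<theta> x) 0)" (is "_ \<longlonglongrightarrow> ?l")
      by (simp only:) (intro tendsto_diff tendsto_mult tendsto_const lm d)
    from tendsto_mult[OF tendsto_const[of "1 / lam"] this]
    have conv: "(\<lambda>n. LINT x|M. b_ext \<delta>\<^sub>0 b x (V x) * fn n x) \<longlonglongrightarrow> 1 / lam * ?l" using lam by simp
    show ?thesis
    proof (rule integrable_monotone_convergence[OF _ _ _ conv])
      show "integrable M (\<lambda>x. b_ext \<delta>\<^sub>0 b x (V x) * fn n x)" for n
        using sob_measurable[OF sn] by (intro b_ext_Lp_mult_integrable[OF VL _ fb]) auto
      show "AE x in M. mono (\<lambda>n. b_ext \<delta>\<^sub>0 b x (V x) * fn n x)"
        using bV0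
      proof eventually_elim
        case (elim x)
        show ?case
        proof (rule monoI)
          fix m n :: nat assume mn: "m \<le> n"
          have "fn m x \<le> fn n x" using mn by (auto simp: fn_def clip_def)
          then show "b_ext \<delta>\<^sub>0 b x (V x) * fn m x \<le> b_ext \<delta>\<^sub>0 b x (V x) * fn n x" using elim by (rule mult_left_mono)
        qed
      qed
      show "AE x in M. (\<lambda>n. b_ext \<delta>\<^sub>0 b x (V x) * fn n x) \<longlonglongrightarrow> b_ext \<delta>\<^sub>0 b x (V x) * max (\<theta> x) 0"
        by (intro AE_I2 tendsto_mult tendsto_const l1)
      show "(\<lambda>x. b_ext \<delta>\<^sub>0 b x (V x) * max (\<theta> x) 0) \<in> borel_measurable M"
        using b_ext_comp_measurable[OF Lp_measurable[OF VL]] sob_measurable(1)[OF sob_pos_part[OF s]]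
        by (rule borel_measurable_times)
    qed
  qed
  \<comment> \<open>Integrability for positive parts is applied to \<open>\<phi>\<close> and to its
    negative; the difference is the full term.\<close>
  have neg: "sobolev_gradient \<Omega> p (\<lambda>x. - \<phi> x) (\<lambda>x. - H x)"
    using sob_lincomb[OF s\<phi> s\<phi>, of "-1" 0] by simp
  have "integrable M (\<lambda>x. b_ext \<delta>\<^sub>0 b x (V x) * max (\<phi> x) 0 - b_ext \<delta>\<^sub>0 b x (V x) * max (- \<phi> x) 0)"
    using bpos[OF s\<phi>] bpos[OF neg] by (rule Bochner_Integration.integrable_diff)
  also have "(\<lambda>x. b_ext \<delta>\<^sub>0 b x (V x) * max (\<phi> x) 0 - b_ext \<delta>\<^sub>0 b x (V x) * max (- \<phi> x) 0) = (\<lambda>x. b_ext \<delta>\<^sub>0 b x (V x) * \<phi> x)"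
  proof
    fix x
    have "max (\<phi> x) 0 - max (- \<phi> x) 0 = \<phi> x" by (simp add: max_def)
    then show "b_ext \<delta>\<^sub>0 b x (V x) * max (\<phi> x) 0 - b_ext \<delta>\<^sub>0 b x (V x) * max (- \<phi> x) 0 = b_ext \<delta>\<^sub>0 b x (V x) * \<phi> x"
      by (metis right_diff_distrib)
  qed
  finally have ib: "integrable M (\<lambda>x. b_ext \<delta>\<^sub>0 b x (V x) * \<phi> x)" .
  \<comment> \<open>Now that \<open>b_ext \<delta>\<^sub>0 b x (V x) * \<phi> x\<close> is
    integrable, its absolute value is a majorant, and the two-sided truncations can be passed to the
    limit in all terms.\<close>
  define fn where "fn n x = clip (- real n) (real n) (\<phi> x)" for n x
  define Hn where "Hn n x = (if - real n < \<phi> x \<and> \<phi> x \<le> real n then H x else 0)" for n x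
  have sn: "sobolev_gradient \<Omega> p (fn n) (Hn n)" for n unfolding fn_def Hn_def by (rule sob_clip[OF s\<phi>]) simp
  have l1: "(\<lambda>n. fn n x) \<longlonglongrightarrow> \<phi> x" for x
    by (rule Lim_transform_eventually[OF tendsto_const], rule eventually_mono[OF ev[of "\<phi> x"]])
      (auto simp: fn_def clip_def)
  have l2: "(\<lambda>n. Hn n x) \<longlonglongrightarrow> H x" for x
    by (rule Lim_transform_eventually[OF tendsto_const], rule eventually_mono[OF ev[of "\<phi> x"]])
      (auto simp: Hn_def)
  have fb: "AE x in M. \<bar>fn n x\<bar> \<le> real n" for n by (intro AE_I2) (auto simp: fn_def clip_def)
  have d: "\<bar>fn n x\<bar> \<le> \<bar>\<phi> x\<bar>" "Hn n x = 0 \<or> Hn n x = H x" for n x by (auto simp: fn_def Hn_def clip_def)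
  note lm = lims[OF sn s\<phi> s\<phi> d l1 l2]
  have bl: "(\<lambda>n. LINT x|M. b_ext \<delta>\<^sub>0 b x (V x) * fn n x) \<longlonglongrightarrow> (LINT x|M. b_ext \<delta>\<^sub>0 b x (V x) * \<phi> x)"
  proof (rule integral_dominated_convergence[where w = "\<lambda>x. \<bar>b_ext \<delta>\<^sub>0 b x (V x) * \<phi> x\<bar>"])
    show "integrable M (\<lambda>x. \<bar>b_ext \<delta>\<^sub>0 b x (V x) * \<phi> x\<bar>)" using ib by (rule integrable_abs)
    show "(\<lambda>x. b_ext \<delta>\<^sub>0 b x (V x) * \<phi> x) \<in> borel_measurable M" using ib by auto
    show "(\<lambda>x. b_ext \<delta>\<^sub>0 b x (V x) * fn n x) \<in> borel_measurable M" for n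
      using b_ext_comp_measurable[OF Lp_measurable[OF VL]] sob_measurable(1)[OF sn] by (rule borel_measurable_times)
    show "AE x in M. (\<lambda>n. b_ext \<delta>\<^sub>0 b x (V x) * fn n x) \<longlonglongrightarrow> b_ext \<delta>\<^sub>0 b x (V x) * \<phi> x"
      by (intro AE_I2 tendsto_mult tendsto_const l1)
    show "AE x in M. norm (b_ext \<delta>\<^sub>0 b x (V x) * fn n x) \<le> \<bar>b_ext \<delta>\<^sub>0 b x (V x) * \<phi> x\<bar>" for n
    proof (rule AE_I2)
      fix x show "norm (b_ext \<delta>\<^sub>0 b x (V x) * fn n x) \<le> \<bar>b_ext \<delta>\<^sub>0 b x (V x) * \<phi> x\<bar>"
        using d(1)[of n x] by (simp add: abs_mult mult_left_mono)
    qed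
  qed
  have "(\<lambda>n. (LINT x|M. radial (flux x) (G x) \<bullet> Hn n x) + lam * (LINT x|M. b_ext \<delta>\<^sub>0 b x (V x) * fn n x)
      + \<epsilon> * (LINT x|M. spow (p x) (V x) * fn n x)) \<longlonglongrightarrow>
    (LINT x|M. radial (flux x) (G x) \<bullet> H x) + lam * (LINT x|M. b_ext \<delta>\<^sub>0 b x (V x) * \<phi> x)
      + \<epsilon> * (LINT x|M. spow (p x) (V x) * \<phi> x)"
    by (intro tendsto_add tendsto_mult tendsto_const lm bl)
  moreover have "(LINT x|M. radial (flux x) (G x) \<bullet> Hn n x) + lam * (LINT x|M. b_ext \<delta>\<^sub>0 b x (V x) * fn n x)
      + \<epsilon> * (LINT x|M. spow (p x) (V x) * fn n x) = (LINT x|M. g x * fn n x)" for n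
    using bdd[OF sn fb, of n] unfolding weak_form_def .
  ultimately have "(\<lambda>n. LINT x|M. g x * fn n x) \<longlonglongrightarrow>
    (LINT x|M. radial (flux x) (G x) \<bullet> H x) + lam * (LINT x|M. b_ext \<delta>\<^sub>0 b x (V x) * \<phi> x)
      + \<epsilon> * (LINT x|M. spow (p x) (V x) * \<phi> x)" by simp
  then show ?thesis unfolding weak_form_def using LIMSEQ_unique lm(3) by blast
qed

text \<open>The Euler-Lagrange equation is split into the terms of \<open>weak_form\<close> while
  the test function is still bounded, since each summand is then integrable by itself; the extension
  to all test functions comes afterwards.\<close>

lemma ex_weak_solution:
  "\<exists>V. weak_solution \<Omega> p \<Psi> \<delta>\<^sub>0 b lam \<epsilon> g V \<and> V \<in> U_set \<Omega> \<delta>\<^sub>0"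
proof -
  obtain V G where sV: "sobolev_gradient \<Omega> p V G" and V01: "AE x in M. 0 \<le> V x \<and> V x \<le> \<delta>\<^sub>0"
    and EL: "\<And>\<phi> H B. sobolev_gradient \<Omega> p \<phi> H \<Longrightarrow> AE x in M. \<bar>\<phi> x\<bar> \<le> B \<Longrightarrow>
      (LINT x|M. radial (flux x) (G x) \<bullet> H x) + (LINT x|M. reaction x (V x) * \<phi> x) = 0"
    by (rule ex_bounded_weak_solution) (rule that)
  have VL: "V \<in> lebesgue_space \<Omega> p" using sV by (simp add: sobolev_gradient_def)
  have bdd: "weak_form V G \<phi> H" if s: "sobolev_gradient \<Omega> p \<phi> H" and B: "AE x in M. \<bar>\<phi> x\<bar> \<le> B" for \<phi> H B
  proof -
    have m: "\<phi> \<in> borel_measurable M" using sob_measurable[OF s] by simp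
    have i: "integrable M (\<lambda>x. b_ext \<delta>\<^sub>0 b x (V x) * \<phi> x)" "integrable M (\<lambda>x. spow (p x) (V x) * \<phi> x)" "integrable M (\<lambda>x. g x * \<phi> x)"
      using b_ext_Lp_mult_integrable[OF VL m B] spow_Lp_mult_integrable[OF VL m B]
        g_mult_integrable[OF Lp_integrable] s by (auto simp: sobolev_gradient_def)
    have "(LINT x|M. reaction x (V x) * \<phi> x) =
      (LINT x|M. lam * (b_ext \<delta>\<^sub>0 b x (V x) * \<phi> x) + \<epsilon> * (spow (p x) (V x) * \<phi> x) - g x * \<phi> x)"
      by (simp add: reaction_def algebra_simps)
    also have "\<dots> = lam * (LINT x|M. b_ext \<delta>\<^sub>0 b x (V x) * \<phi> x) + \<epsilon> * (LINT x|M. spow (p x) (V x) * \<phi> x) - (LINT x|M. g x * \<phi> x)"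
      using i by simp
    finally show ?thesis using EL[OF s B] unfolding weak_form_def by linarith
  qed
  have "weak_form V G \<phi> H" if "sobolev_gradient \<Omega> p \<phi> H" for \<phi> H
    by (rule weak_form_extend[OF sV V01 _ that]) (rule bdd)
  then have "weak_solution \<Omega> p \<Psi> \<delta>\<^sub>0 b lam \<epsilon> g V" unfolding weak_solution_iff using sV by blast
  moreover have "V \<in> U_set \<Omega> \<delta>\<^sub>0"
  proof -
    have "AE x in M. \<bar>V x\<bar> \<le> \<delta>\<^sub>0" using V01 by eventually_elim auto
    then have "V \<in> ess_bounded \<Omega>" using sob_measurable[OF sV] unfolding ess_bounded_def by blast
    then show ?thesis unfolding U_set_def using V01 by blast
  qed
  ultimately show ?thesis by blast
qed

text \<open>The integrability lemmas for a solution that is merely in the Sobolev space ask for a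
  bounded test function, hence the truncation of \<open>W - V\<close>, which keeps its sign. The
  three differences have nonnegative integrals and, weighted, sum to 0; the power term, present as
  \<open>\<epsilon> > 0\<close> and strictly increasing, then identifies \<open>V\<close> and
  \<open>W\<close>.\<close>

lemma weak_solution_unique:
  assumes "weak_solution \<Omega> p \<Psi> \<delta>\<^sub>0 b lam \<epsilon> g V" "weak_solution \<Omega> p \<Psi> \<delta>\<^sub>0 b lam \<epsilon> g W"
  shows "AE x in M. W x = V x"
proof -
  obtain G where V: "sobolev_gradient \<Omega> p V G" "\<And>\<phi> H. sobolev_gradient \<Omega> p \<phi> H \<Longrightarrow> weak_form V G \<phi> H"
    using assms(1) unfolding weak_solution_iff by blast
  obtain K where W: "sobolev_gradient \<Omega> p W K" "\<And>\<phi> H. sobolev_gradient \<Omega> p \<phi> H \<Longrightarrow> weak_form W K \<phi> H"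
    using assms(2) unfolding weak_solution_iff by blast
  have VL: "V \<in> lebesgue_space \<Omega> p" and WL: "W \<in> lebesgue_space \<Omega> p" using V W by (auto simp: sobolev_gradient_def)
  define \<phi> where "\<phi> x = clip (-1) 1 (W x - V x)" for x
  define H where "H x = (if -1 < W x - V x \<and> W x - V x \<le> 1 then K x - G x else 0)" for x
  have "sobolev_gradient \<Omega> p (\<lambda>x. W x - V x) (\<lambda>x. K x - G x)"
    using sob_lincomb[OF W(1) V(1), of 1 "-1"] by simp
  then have s: "sobolev_gradient \<Omega> p \<phi> H" unfolding \<phi>_def H_def by (rule sob_clip) simp
  have m: "\<phi> \<in> borel_measurable M" using sob_measurable[OF s] by simp
  have B: "AE x in M. \<bar>\<phi> x\<bar> \<le> 1" by (intro AE_I2) (auto simp: \<phi>_def clip_def)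
  note iV = radial_integrable[OF V(1) s] b_ext_Lp_mult_integrable[OF VL m B] spow_Lp_mult_integrable[OF VL m B]
  note iW = radial_integrable[OF W(1) s] b_ext_Lp_mult_integrable[OF WL m B] spow_Lp_mult_integrable[OF WL m B]
  let ?a = "\<lambda>x. radial (flux x) (K x) \<bullet> H x - radial (flux x) (G x) \<bullet> H x"
  let ?b = "\<lambda>x. b_ext \<delta>\<^sub>0 b x (W x) * \<phi> x - b_ext \<delta>\<^sub>0 b x (V x) * \<phi> x"
  let ?c = "\<lambda>x. spow (p x) (W x) * \<phi> x - spow (p x) (V x) * \<phi> x"
  have a0: "0 \<le> (LINT x|M. ?a x)"
  proof (rule integral_nonneg_AE)
    show "AE x in M. 0 \<le> ?a x"
      using flux_regular
    proof eventually_elim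
      case (elim x)
      then have "0 \<le> (radial (flux x) (K x) - radial (flux x) (G x)) \<bullet> (K x - G x)" by (intro radial_monotone) auto
      \<comment> \<open>Where the truncation is active, \<open>H x\<close> is 0 and so is the
        integrand.\<close>
      then show ?case by (auto simp: H_def inner_diff_left)
    qed
  qed
  have sgn_mult: "0 \<le> f (W x) * \<phi> x - f (V x) * \<phi> x" if "mono f" for f x
  proof (cases "V x \<le> W x")
    case True
    then have "0 \<le> (f (W x) - f (V x)) * \<phi> x" using monoD[OF that True] by (intro mult_nonneg_nonneg) (auto simp: \<phi>_def clip_def)
    then show ?thesis by (simp add: left_diff_distrib)
  next
    case False
    then have "0 \<le> (f (W x) - f (V x)) * \<phi> x" using monoD[OF that, of "W x" "V x"] by (intro mult_nonpos_nonpos) (auto simp: \<phi>_def clip_def)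
    then show ?thesis by (simp add: left_diff_distrib)
  qed
  have b0: "0 \<le> (LINT x|M. ?b x)"
  proof (rule integral_nonneg_AE)
    show "AE x in M. 0 \<le> ?b x" using b_ext_regular by eventually_elim (rule sgn_mult, blast)
  qed
  have px: "AE x in M. 1 < p x" using AE_space[of M] by eventually_elim (simp add: p_pos)
  have cp: "AE x in M. 0 \<le> ?c x" using px by eventually_elim (rule sgn_mult, rule strict_mono_mono, rule strict_mono_spow)
  have "(LINT x|M. ?a x) + lam * (LINT x|M. ?b x) + \<epsilon> * (LINT x|M. ?c x) = 0"
  proof -
    have eqs: "(LINT x|M. ?a x) = (LINT x|M. radial (flux x) (K x) \<bullet> H x) - (LINT x|M. radial (flux x) (G x) \<bullet> H x)"
      "(LINT x|M. ?b x) = (LINT x|M. b_ext \<delta>\<^sub>0 b x (W x) * \<phi> x) - (LINT x|M. b_ext \<delta>\<^sub>0 b x (V x) * \<phi> x)"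
      "(LINT x|M. ?c x) = (LINT x|M. spow (p x) (W x) * \<phi> x) - (LINT x|M. spow (p x) (V x) * \<phi> x)"
      by (rule Bochner_Integration.integral_diff[OF iW(1) iV(1)] Bochner_Integration.integral_diff[OF iW(2) iV(2)]
          Bochner_Integration.integral_diff[OF iW(3) iV(3)])+
    show ?thesis
      unfolding eqs right_diff_distrib using V(2)[OF s] W(2)[OF s] unfolding weak_form_def by linarith
  qed
  moreover have c0: "0 \<le> (LINT x|M. ?c x)" using cp by (rule integral_nonneg_AE)
  moreover have "0 \<le> lam * (LINT x|M. ?b x)" "0 \<le> \<epsilon> * (LINT x|M. ?c x)" using b0 c0 lam \<epsilon> by auto
  ultimately have "\<epsilon> * (LINT x|M. ?c x) = 0" using a0 by linarith
  then have "(LINT x|M. ?c x) = 0" using \<epsilon> by simp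
  then have "AE x in M. ?c x = 0"
    using integral_nonneg_eq_0_iff_AE[OF Bochner_Integration.integrable_diff[OF iW(3) iV(3)] cp] by simp
  then show ?thesis using px
  proof eventually_elim
    case (elim x)
    have "(spow (p x) (W x) - spow (p x) (V x)) * \<phi> x = 0" using elim(1) by (simp add: left_diff_distrib)
    then have "spow (p x) (W x) = spow (p x) (V x) \<or> \<phi> x = 0" by simp
    \<comment> \<open>The truncation interval contains 0 in its interior, so \<open>\<phi> x\<close>
      vanishes only where the difference itself does.\<close>
    moreover have "\<phi> x = 0 \<Longrightarrow> W x = V x" by (auto simp: \<phi>_def clip_def max_def min_def split: if_splits)
    ultimately show ?case using strict_mono_eq[OF strict_mono_spow[OF elim(2)]] by blast
  qed
qed

end

theorem theorem5p1:
  fixes \<Omega> :: "'a::euclidean_space set"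
    and p :: "'a \<Rightarrow> real"
    and \<Psi> b :: "'a \<Rightarrow> real \<Rightarrow> real"
    and \<delta>\<^sub>0 lam \<epsilon> :: real
    and g :: "'a \<Rightarrow> real"
  assumes "DIM('a) \<ge> 2"
    and "open \<Omega>" and "bounded \<Omega>" and "connected \<Omega>" and "\<Omega> \<noteq> {}"
    and "lipschitz_boundary \<Omega>"
    and "admissible_exponent \<Omega> p"
    and "admissible_Psi \<Omega> p \<Psi>"
    and "0 < \<delta>\<^sub>0"
    and "admissible_b \<Omega> \<delta>\<^sub>0 b"
    and "0 < lam"
    and "g \<in> M_set \<Omega> \<delta>\<^sub>0 b lam"
    and "0 < \<epsilon>"
  shows "\<exists>V. weak_solution \<Omega> p \<Psi> \<delta>\<^sub>0 b lam \<epsilon> g V \<and> V \<in> U_set \<Omega> \<delta>\<^sub>0 \<and>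
           (\<forall>W. weak_solution \<Omega> p \<Psi> \<delta>\<^sub>0 b lam \<epsilon> g W \<longrightarrow> (AE x in lebesgue_on \<Omega>. W x = V x))"
proof -
  have cont: "continuous_on (closure \<Omega>) p"
    using assms(7) log_holder_imp_continuous unfolding admissible_exponent_def by blast
  have cl: "compact (closure \<Omega>)" "closure \<Omega> \<noteq> {}" using assms(3,5) by (auto simp: compact_closure)
  have p1: "1 < p x" if "x \<in> closure \<Omega>" for x using assms(7) that unfolding admissible_exponent_def by blast
  \<comment> \<open>Continuity on the compact closure turns \<open>1 < p x\<close> into a uniform
    bound \<open>1 < pm\<close>, on which the uniform integrability of the gradients rests.\<close>
  obtain pm pM where p: "1 < pm" "\<And>x. x \<in> closure \<Omega> \<Longrightarrow> pm \<le> p x" "\<And>x. x \<in> closure \<Omega> \<Longrightarrow> p x \<le> pM"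
    by (rule bounded_imp_min_max[OF cl cont p1]) (assumption, rule that)
  have pmeas: "p \<in> borel_measurable (lebesgue_on \<Omega>)"
    using continuous_on_subset[OF cont closure_subset] assms(2)
    by (intro continuous_imp_measurable_on_sets_lebesgue) (auto simp: lmeasurable_open sets_completionI_sets)
  interpret neumann_problem \<Omega> p pm pM \<Psi> b \<delta>\<^sub>0 lam \<epsilon> g
    by unfold_locales (use assms p pmeas closure_subset[of \<Omega>] in auto)
  show ?thesis using ex_weak_solution weak_solution_unique by blast
qed

end
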